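(* Let $(V=\mathbb C^n,J,g)$ be the standard pseudo-Hermitian vector space of complex signature $(p,q)$, $p+q=n$, and let $f$ be a holomorphic function defined on an open subset $M\subset V$. Assume that the pointwise support of the cubic tensor field $\partial^3f:M\to S^{3,0}V^*$ defined by the holomorphic third partial derivatives of $f$ is isotropic, and put $S_f:=\partial^3f+\overline{\partial^3f}\in S^3V^*$ (pointwise). Then $M_f:=(M,J,g,\nabla:=D+S_f)$ is a flat special Kähler manifold. Moreover, any flat special Kähler manifold arises locally in this way (i.e. every point has a neighbourhood isomorphic, as a special Kähler manifold, to $M_f=(M,J,g,D+S_f)$ for some $p,q\ge 0$ with $p+q=n$ equal to the complex dimension of the manifold, some open subset $M$ of the standard pseudo-Hermitian vector space $(V=\mathbb C^n,J,g)$ of complex signature $(p,q)$, and some holomorphic function $f$ on $M$ such that the pointwise support of $\partial^3f$ is isotropic).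
   Context: A (possibly indefinite) Kähler manifold is a (possibly indefinite) Riemannian manifold $(M,g)$ with a complex structure $J$, $DJ=0$ for the Levi-Civita connection $D$ of $g$, with $g$ Hermitian with respect to $J$; $\omega=g(J\cdot,\cdot)$. A special Kähler manifold $(M,g,J,\nabla)$ is a Kähler manifold with a torsionfree flat connection $\nabla$ such that $\nabla\omega=0$ and $(\nabla_XJ)Y=(\nabla_YJ)X$ for all vector fields $X,Y$; it is flat if $D$ is flat. Isomorphisms are diffeomorphisms preserving $g$, $J$ and $\nabla$. On $V$, $D$ is the canonical flat connection, $J$ the complex structure, $g$ the real part of the pseudo-Hermitian inner product. $V^{\mathbb C}=V\otimes\mathbb C=V^{1,0}\oplus V^{0,1}$ is the decomposition into $\pm i$-eigenspaces of $J$, and $\omega$ is extended complex bilinearly. $S^{3,0}V^*$ is the space of complex cubic forms on $V^{\mathbb C}$ that vanish whenever one argument is in $V^{0,1}$. $\partial^3f(X,Y,Z)=X^{1,0}Y^{1,0}Z^{1,0}f$ for constant vector fields $X,Y,Z$, where $X^{1,0}=\frac12(X-iJX)$. A cubic form $C\in S^3V^*$ is regarded as a linear map $X\mapsto C_X$ from $V$ to $\mathfrak{sp}(V)$ by $\omega(C_XY,Z)=C(X,Y,Z)$, and similarly over $\mathbb C$. Thus $S_f$ is an $\mathrm{End}(V)$-valued one-form and $D+S_f$ is a connection. The support of a complex cubic form $C$ is $\Sigma_C=\mathrm{span}_{\mathbb C}\{C_XY\mid X,Y\in V^{\mathbb C}\}$. For $C=\partial^3f$ at a point, $\Sigma_C\subset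 V^{0,1}$, and so $\Sigma_C=W^{0,1}:=(W\otimes\mathbb C)\cap V^{0,1}$ for a unique $J$-invariant subspace $W\subset V$. The support is called isotropic if $W$ is $\omega$-isotropic (equivalently $g$-isotropic), i.e. if $\omega(v,\overline w)=0$ for all $v,w\in\Sigma_C$. *)

theory Defs
  imports "HOL-Analysis.Analysis"
begin

section \<open>Smooth maps on open subsets of Euclidean spaces\<close>

primrec Ck_on :: "nat \<Rightarrow> 'a::euclidean_space set \<Rightarrow> ('a \<Rightarrow> 'b::real_normed_vector) \<Rightarrow> bool" where
  "Ck_on 0 W h \<longleftrightarrow> continuous_on W h"
| "Ck_on (Suc k) W h \<longleftrightarrow>
     (\<forall>z\<in>W. h differentiable (at z)) \<and> (\<forall>v. Ck_on k W (\<lambda>z. frechet_derivative h (at z) v))"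

text \<open>Used for open \<open>W\<close> only.\<close>

definition smooth_on :: "'a::euclidean_space set \<Rightarrow> ('a \<Rightarrow> 'b::real_normed_vector) \<Rightarrow> bool" where
  "smooth_on W h \<longleftrightarrow> (\<forall>k. Ck_on k W h)"

text \<open>\<open>dderiv v h z\<close> is the derivative of \<open>h\<close> at \<open>z\<close> in the direction of the constant vector field \<open>v\<close>.\<close>

definition dderiv :: "'a::real_normed_vector \<Rightarrow> ('a \<Rightarrow> 'b::real_normed_vector) \<Rightarrow> 'a \<Rightarrow> 'b" where
  "dderiv v h z = frechet_derivative h (at z) v"


section \<open>Tensor calculus on a coordinate domain\<close>

text \<open>
  On an open set \<open>W\<close> of a Euclidean space, vector fields are functions \<open>'e \<Rightarrow> 'e\<close>, and an affine
  connection is given by its Christoffel symbols \<open>G\<close>, i.e. it is \<open>\<nabla>\<^sub>X Y = dY(X) + G(X, Y)\<close>.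
\<close>

definition covd :: "('e::euclidean_space \<Rightarrow> 'e \<Rightarrow> 'e \<Rightarrow> 'e) \<Rightarrow> ('e \<Rightarrow> 'e) \<Rightarrow> ('e \<Rightarrow> 'e) \<Rightarrow> 'e \<Rightarrow> 'e" where
  "covd G X Y = (\<lambda>z. dderiv (X z) Y z + G z (X z) (Y z))"

definition lie_bracket :: "('e::euclidean_space \<Rightarrow> 'e) \<Rightarrow> ('e \<Rightarrow> 'e) \<Rightarrow> 'e \<Rightarrow> 'e" where
  "lie_bracket X Y = (\<lambda>z. dderiv (X z) Y z - dderiv (Y z) X z)"

definition torsion ::
    "('e::euclidean_space \<Rightarrow> 'e \<Rightarrow> 'e \<Rightarrow> 'e) \<Rightarrow> ('e \<Rightarrow> 'e) \<Rightarrow> ('e \<Rightarrow> 'e) \<Rightarrow> 'e \<Rightarrow> 'e" where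
  "torsion G X Y = (\<lambda>z. covd G X Y z - covd G Y X z - lie_bracket X Y z)"

definition curvature ::
    "('e::euclidean_space \<Rightarrow> 'e \<Rightarrow> 'e \<Rightarrow> 'e) \<Rightarrow> ('e \<Rightarrow> 'e) \<Rightarrow> ('e \<Rightarrow> 'e) \<Rightarrow> ('e \<Rightarrow> 'e) \<Rightarrow> 'e \<Rightarrow> 'e" where
  "curvature G X Y Z =
     (\<lambda>z. covd G X (covd G Y Z) z - covd G Y (covd G X Z) z - covd G (lie_bracket X Y) Z z)"

definition covd_endo ::
    "('e::euclidean_space \<Rightarrow> 'e \<Rightarrow> 'e \<Rightarrow> 'e) \<Rightarrow> ('e \<Rightarrow> 'e \<Rightarrow> 'e) \<Rightarrow> ('e \<Rightarrow> 'e) \<Rightarrow> ('e \<Rightarrow> 'e) \<Rightarrow> 'e \<Rightarrow> 'e" where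
  "covd_endo G A X Y = (\<lambda>z. covd G X (\<lambda>y. A y (Y y)) z - A z (covd G X Y z))"

definition covd_form ::
    "('e::euclidean_space \<Rightarrow> 'e \<Rightarrow> 'e \<Rightarrow> 'e) \<Rightarrow> ('e \<Rightarrow> 'e \<Rightarrow> 'e \<Rightarrow> real)
     \<Rightarrow> ('e \<Rightarrow> 'e) \<Rightarrow> ('e \<Rightarrow> 'e) \<Rightarrow> ('e \<Rightarrow> 'e) \<Rightarrow> 'e \<Rightarrow> real" where
  "covd_form G b X Y Z = (\<lambda>z. dderiv (X z) (\<lambda>y. b y (Y y) (Z y)) z
      - b z (covd G X Y z) (Z z) - b z (Y z) (covd G X Z z))"

definition nijenhuis ::
    "('e::euclidean_space \<Rightarrow> 'e \<Rightarrow> 'e) \<Rightarrow> ('e \<Rightarrow> 'e) \<Rightarrow> ('e \<Rightarrow> 'e) \<Rightarrow> 'e \<Rightarrow> 'e" where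
  "nijenhuis A X Y = (\<lambda>z. lie_bracket (\<lambda>y. A y (X y)) (\<lambda>y. A y (Y y)) z
      - A z (lie_bracket (\<lambda>y. A y (X y)) Y z) - A z (lie_bracket X (\<lambda>y. A y (Y y)) z)
      - lie_bracket X Y z)"


section \<open>Transformation laws\<close>

text \<open>
  \<open>t\<close> is a local diffeomorphism between coordinate domains. The last law expresses
  \<open>dt(\<nabla>\<^sub>X Y) = \<nabla>'\<^bsub>dt(X)\<^esub> dt(Y)\<close> in terms of Christoffel symbols.
\<close>

definition form_related ::
    "('e::euclidean_space \<Rightarrow> 'f::euclidean_space) \<Rightarrow> 'e
     \<Rightarrow> ('e \<Rightarrow> 'e \<Rightarrow> 'e \<Rightarrow> real) \<Rightarrow> ('f \<Rightarrow> 'f \<Rightarrow> 'f \<Rightarrow> real) \<Rightarrow> bool" where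
  "form_related t z b b' \<longleftrightarrow> (\<forall>u v. b z u v = b' (t z) (dderiv u t z) (dderiv v t z))"

definition endo_related ::
    "('e::euclidean_space \<Rightarrow> 'f::euclidean_space) \<Rightarrow> 'e
     \<Rightarrow> ('e \<Rightarrow> 'e \<Rightarrow> 'e) \<Rightarrow> ('f \<Rightarrow> 'f \<Rightarrow> 'f) \<Rightarrow> bool" where
  "endo_related t z A A' \<longleftrightarrow> (\<forall>u. dderiv (A z u) t z = A' (t z) (dderiv u t z))"

definition conn_related ::
    "('e::euclidean_space \<Rightarrow> 'f::euclidean_space) \<Rightarrow> 'e
     \<Rightarrow> ('e \<Rightarrow> 'e \<Rightarrow> 'e \<Rightarrow> 'e) \<Rightarrow> ('f \<Rightarrow> 'f \<Rightarrow> 'f \<Rightarrow> 'f) \<Rightarrow> bool" where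
  "conn_related t z G G' \<longleftrightarrow>
     (\<forall>u v. dderiv (G z u v) t z = dderiv u (dderiv v t) z + G' (t z) (dderiv u t z) (dderiv v t z))"


section \<open>Smooth manifolds, tensor fields and connections\<close>

text \<open>
  A chart is a pair of a domain and a coordinate map (whose values off the domain are irrelevant).
  Tensor fields and connections on a manifold are families of local coordinate expressions,
  one for each chart, which satisfy the transformation laws for the changes of charts.
\<close>

type_synonym ('a, 'e) chart = "'a set \<times> ('a \<Rightarrow> 'e)"

definition coord_dom :: "('a, 'e) chart \<Rightarrow> 'e set" where
  "coord_dom c = snd c ` fst c"

definition coord_inv :: "('a, 'e) chart \<Rightarrow> 'e \<Rightarrow> 'a" where
  "coord_inv c = inv_into (fst c) (snd c)"

definition transition :: "('a, 'e) chart \<Rightarrow> ('a, 'e) chart \<Rightarrow> 'e \<Rightarrow> 'e" where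
  "transition c d = snd d \<circ> coord_inv c"

definition overlap :: "('a, 'e) chart \<Rightarrow> ('a, 'e) chart \<Rightarrow> 'e set" where
  "overlap c d = snd c ` (fst c \<inter> fst d)"

definition smooth_manifold :: "'a topology \<Rightarrow> ('a, 'e::euclidean_space) chart set \<Rightarrow> bool" where
  "smooth_manifold T \<A> \<longleftrightarrow>
     Hausdorff_space T \<and> second_countable T \<and>
     (\<Union>c\<in>\<A>. fst c) = topspace T \<and>
     (\<forall>c\<in>\<A>. openin T (fst c) \<and> open (coord_dom c) \<and>
        homeomorphic_map (subtopology T (fst c)) (top_of_set (coord_dom c)) (snd c)) \<and>
     (\<forall>c\<in>\<A>. \<forall>d\<in>\<A>. smooth_on (overlap c d) (transition c d))"

definition form_field ::
    "('a, 'e::euclidean_space) chart set \<Rightarrow> (('a, 'e) chart \<Rightarrow> 'e \<Rightarrow> 'e \<Rightarrow> 'e \<Rightarrow> real) \<Rightarrow> bool" where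
  "form_field \<A> b \<longleftrightarrow>
     (\<forall>c\<in>\<A>. (\<forall>z\<in>coord_dom c. bilinear (b c z)) \<and> (\<forall>u v. smooth_on (coord_dom c) (\<lambda>z. b c z u v))) \<and>
     (\<forall>c\<in>\<A>. \<forall>d\<in>\<A>. \<forall>z\<in>overlap c d. form_related (transition c d) z (b c) (b d))"

definition endo_field ::
    "('a, 'e::euclidean_space) chart set \<Rightarrow> (('a, 'e) chart \<Rightarrow> 'e \<Rightarrow> 'e \<Rightarrow> 'e) \<Rightarrow> bool" where
  "endo_field \<A> A \<longleftrightarrow>
     (\<forall>c\<in>\<A>. (\<forall>z\<in>coord_dom c. linear (A c z)) \<and> (\<forall>u. smooth_on (coord_dom c) (\<lambda>z. A c z u))) \<and>
     (\<forall>c\<in>\<A>. \<forall>d\<in>\<A>. \<forall>z\<in>overlap c d. endo_related (transition c d) z (A c) (A d))"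

definition affine_connection ::
    "('a, 'e::euclidean_space) chart set \<Rightarrow> (('a, 'e) chart \<Rightarrow> 'e \<Rightarrow> 'e \<Rightarrow> 'e \<Rightarrow> 'e) \<Rightarrow> bool" where
  "affine_connection \<A> G \<longleftrightarrow>
     (\<forall>c\<in>\<A>. (\<forall>z\<in>coord_dom c. bilinear (G c z)) \<and> (\<forall>u v. smooth_on (coord_dom c) (\<lambda>z. G c z u v))) \<and>
     (\<forall>c\<in>\<A>. \<forall>d\<in>\<A>. \<forall>z\<in>overlap c d. conn_related (transition c d) z (G c) (G d))"

definition torsionfree ::
    "('a, 'e::euclidean_space) chart set \<Rightarrow> (('a, 'e) chart \<Rightarrow> 'e \<Rightarrow> 'e \<Rightarrow> 'e \<Rightarrow> 'e) \<Rightarrow> bool" where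
  "torsionfree \<A> G \<longleftrightarrow>
     (\<forall>c\<in>\<A>. \<forall>X Y. smooth_on (coord_dom c) X \<longrightarrow> smooth_on (coord_dom c) Y \<longrightarrow>
        (\<forall>z\<in>coord_dom c. torsion (G c) X Y z = 0))"

definition flat_connection ::
    "('a, 'e::euclidean_space) chart set \<Rightarrow> (('a, 'e) chart \<Rightarrow> 'e \<Rightarrow> 'e \<Rightarrow> 'e \<Rightarrow> 'e) \<Rightarrow> bool" where
  "flat_connection \<A> G \<longleftrightarrow>
     (\<forall>c\<in>\<A>. \<forall>X Y Z. smooth_on (coord_dom c) X \<longrightarrow> smooth_on (coord_dom c) Y \<longrightarrow>
        smooth_on (coord_dom c) Z \<longrightarrow> (\<forall>z\<in>coord_dom c. curvature (G c) X Y Z z = 0))"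

definition parallel_form ::
    "('a, 'e::euclidean_space) chart set \<Rightarrow> (('a, 'e) chart \<Rightarrow> 'e \<Rightarrow> 'e \<Rightarrow> 'e \<Rightarrow> 'e)
     \<Rightarrow> (('a, 'e) chart \<Rightarrow> 'e \<Rightarrow> 'e \<Rightarrow> 'e \<Rightarrow> real) \<Rightarrow> bool" where
  "parallel_form \<A> G b \<longleftrightarrow>
     (\<forall>c\<in>\<A>. \<forall>X Y Z. smooth_on (coord_dom c) X \<longrightarrow> smooth_on (coord_dom c) Y \<longrightarrow>
        smooth_on (coord_dom c) Z \<longrightarrow> (\<forall>z\<in>coord_dom c. covd_form (G c) (b c) X Y Z z = 0))"

definition parallel_endo ::
    "('a, 'e::euclidean_space) chart set \<Rightarrow> (('a, 'e) chart \<Rightarrow> 'e \<Rightarrow> 'e \<Rightarrow> 'e \<Rightarrow> 'e)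
     \<Rightarrow> (('a, 'e) chart \<Rightarrow> 'e \<Rightarrow> 'e \<Rightarrow> 'e) \<Rightarrow> bool" where
  "parallel_endo \<A> G A \<longleftrightarrow>
     (\<forall>c\<in>\<A>. \<forall>X Y. smooth_on (coord_dom c) X \<longrightarrow> smooth_on (coord_dom c) Y \<longrightarrow>
        (\<forall>z\<in>coord_dom c. covd_endo (G c) (A c) X Y z = 0))"

definition pseudo_riemannian ::
    "('a, 'e::euclidean_space) chart set \<Rightarrow> (('a, 'e) chart \<Rightarrow> 'e \<Rightarrow> 'e \<Rightarrow> 'e \<Rightarrow> real) \<Rightarrow> bool" where
  "pseudo_riemannian \<A> g \<longleftrightarrow> form_field \<A> g \<and>
     (\<forall>c\<in>\<A>. \<forall>z\<in>coord_dom c.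
        (\<forall>u v. g c z u v = g c z v u) \<and> (\<forall>u. (\<forall>v. g c z u v = 0) \<longrightarrow> u = 0))"

definition complex_structure ::
    "('a, 'e::euclidean_space) chart set \<Rightarrow> (('a, 'e) chart \<Rightarrow> 'e \<Rightarrow> 'e \<Rightarrow> 'e) \<Rightarrow> bool" where
  "complex_structure \<A> J \<longleftrightarrow> endo_field \<A> J \<and>
     (\<forall>c\<in>\<A>. \<forall>z\<in>coord_dom c. \<forall>u. J c z (J c z u) = - u) \<and>
     (\<forall>c\<in>\<A>. \<forall>X Y. smooth_on (coord_dom c) X \<longrightarrow> smooth_on (coord_dom c) Y \<longrightarrow>
        (\<forall>z\<in>coord_dom c. nijenhuis (J c) X Y z = 0))"

definition levi_civita ::
    "('a, 'e::euclidean_space) chart set \<Rightarrow> (('a, 'e) chart \<Rightarrow> 'e \<Rightarrow> 'e \<Rightarrow> 'e \<Rightarrow> real)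
     \<Rightarrow> (('a, 'e) chart \<Rightarrow> 'e \<Rightarrow> 'e \<Rightarrow> 'e \<Rightarrow> 'e) \<Rightarrow> bool" where
  "levi_civita \<A> g D \<longleftrightarrow> affine_connection \<A> D \<and> torsionfree \<A> D \<and> parallel_form \<A> D g"


section \<open>Special Kaehler manifolds\<close>

record ('a, 'e) sk_data =
  sk_top :: "'a topology"
  sk_atlas :: "('a, 'e) chart set"
  sk_g :: "('a, 'e) chart \<Rightarrow> 'e \<Rightarrow> 'e \<Rightarrow> 'e \<Rightarrow> real"
  sk_J :: "('a, 'e) chart \<Rightarrow> 'e \<Rightarrow> 'e \<Rightarrow> 'e"
  sk_nabla :: "('a, 'e) chart \<Rightarrow> 'e \<Rightarrow> 'e \<Rightarrow> 'e \<Rightarrow> 'e"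

definition kaehler_form :: "('a, 'e) sk_data \<Rightarrow> ('a, 'e) chart \<Rightarrow> 'e \<Rightarrow> 'e \<Rightarrow> 'e \<Rightarrow> real" where
  "kaehler_form S c z u v = sk_g S c z (sk_J S c z u) v"

definition kaehler_manifold :: "('a, 'e::euclidean_space) sk_data \<Rightarrow> bool" where
  "kaehler_manifold S \<longleftrightarrow>
     smooth_manifold (sk_top S) (sk_atlas S) \<and>
     pseudo_riemannian (sk_atlas S) (sk_g S) \<and>
     complex_structure (sk_atlas S) (sk_J S) \<and>
     (\<forall>c\<in>sk_atlas S. \<forall>z\<in>coord_dom c. \<forall>u v.
        sk_g S c z (sk_J S c z u) (sk_J S c z v) = sk_g S c z u v) \<and>
     (\<exists>D. levi_civita (sk_atlas S) (sk_g S) D \<and> parallel_endo (sk_atlas S) D (sk_J S))"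

definition special_kaehler_manifold :: "('a, 'e::euclidean_space) sk_data \<Rightarrow> bool" where
  "special_kaehler_manifold S \<longleftrightarrow>
     kaehler_manifold S \<and>
     affine_connection (sk_atlas S) (sk_nabla S) \<and>
     torsionfree (sk_atlas S) (sk_nabla S) \<and>
     flat_connection (sk_atlas S) (sk_nabla S) \<and>
     parallel_form (sk_atlas S) (sk_nabla S) (kaehler_form S) \<and>
     (\<forall>c\<in>sk_atlas S. \<forall>X Y. smooth_on (coord_dom c) X \<longrightarrow> smooth_on (coord_dom c) Y \<longrightarrow>
        (\<forall>z\<in>coord_dom c. covd_endo (sk_nabla S c) (sk_J S c) X Y z
                        = covd_endo (sk_nabla S c) (sk_J S c) Y X z))"

definition flat_special_kaehler_manifold :: "('a, 'e::euclidean_space) sk_data \<Rightarrow> bool" where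
  "flat_special_kaehler_manifold S \<longleftrightarrow>
     special_kaehler_manifold S \<and>
     (\<exists>D. levi_civita (sk_atlas S) (sk_g S) D \<and> flat_connection (sk_atlas S) D)"

text \<open>
  \<open>sk_isomorphism S U S' U' F\<close>: the map \<open>F\<close> is an isomorphism of the open submanifold \<open>U\<close> of \<open>S\<close>
  onto the open submanifold \<open>U'\<close> of \<open>S'\<close>, with the induced structures. The two open subsets of
  coordinate space are the domains of the coordinate expressions of \<open>F\<close> and of its inverse.
\<close>

definition sk_isomorphism ::
    "('a, 'e::euclidean_space) sk_data \<Rightarrow> 'a set \<Rightarrow> ('b, 'f::euclidean_space) sk_data \<Rightarrow> 'b set
     \<Rightarrow> ('a \<Rightarrow> 'b) \<Rightarrow> bool" where
  "sk_isomorphism S U S' U' F \<longleftrightarrow>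
     openin (sk_top S) U \<and> openin (sk_top S') U' \<and>
     homeomorphic_map (subtopology (sk_top S) U) (subtopology (sk_top S') U') F \<and>
     (\<forall>c\<in>sk_atlas S. \<forall>d\<in>sk_atlas S'.
        let W = {x \<in> U \<inter> fst c. F x \<in> fst d}; t = snd d \<circ> F \<circ> coord_inv c
        in smooth_on (snd c ` W) t \<and>
           smooth_on (snd d ` F ` W) (snd c \<circ> inv_into U F \<circ> coord_inv d) \<and>
           (\<forall>z \<in> snd c ` W.
              form_related t z (sk_g S c) (sk_g S' d) \<and>
              endo_related t z (sk_J S c) (sk_J S' d) \<and>
              conn_related t z (sk_nabla S c) (sk_nabla S' d)))"


section \<open>The standard pseudo-Hermitian vector space\<close>

text \<open>
  The pseudo-Hermitian inner product on \<open>complex ^ 'n\<close> is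
  \<open>\<Sum>i\<in>P. u\<^sub>i cnj v\<^sub>i - \<Sum>i\<notin>P. u\<^sub>i cnj v\<^sub>i\<close>, for a set \<open>P\<close> of coordinate indices; it has complex signature
  \<open>(card P, card (- P))\<close>.
\<close>

definition std_herm :: "'n set \<Rightarrow> complex ^ 'n \<Rightarrow> complex ^ 'n \<Rightarrow> complex" where
  "std_herm P u v = (\<Sum>i\<in>UNIV. (if i \<in> P then 1 else - 1) * (u $ i) * cnj (v $ i))"

definition std_g :: "'n::finite set \<Rightarrow> complex ^ 'n \<Rightarrow> complex ^ 'n \<Rightarrow> real" where
  "std_g P u v = Re (std_herm P u v)"

definition std_J :: "complex ^ 'n \<Rightarrow> complex ^ 'n" where
  "std_J u = \<i> *s u"

definition std_omega :: "'n::finite set \<Rightarrow> complex ^ 'n \<Rightarrow> complex ^ 'n \<Rightarrow> real" where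
  "std_omega P u v = std_g P (std_J u) v"

definition holomorphic_several_on ::
    "(complex ^ 'n \<Rightarrow> complex) \<Rightarrow> (complex ^ 'n::finite) set \<Rightarrow> bool" where
  "holomorphic_several_on f M \<longleftrightarrow>
     (\<forall>z\<in>M. \<exists>f'. (f has_derivative f') (at z) \<and> (\<forall>a v. f' (a *s v) = a * f' v))"


subsection \<open>Complexification\<close>

text \<open>
  An element \<open>x + \<i> y\<close> of the complexification of \<open>V = complex ^ 'n\<close> (regarded as a real vector
  space) is represented by the pair \<open>(x, y)\<close>; its complex scalar multiplication \<open>cscale\<close> is not to
  be confused with the one coming from \<open>V\<close>.
\<close>

type_synonym 'n cvec = "(complex ^ 'n) \<times> (complex ^ 'n)"
type_synonym 'n ccubic = "'n cvec \<Rightarrow> 'n cvec \<Rightarrow> 'n cvec \<Rightarrow> complex"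

definition cscale :: "complex \<Rightarrow> 'n::finite cvec \<Rightarrow> 'n cvec" where
  "cscale a X = (Re a *\<^sub>R fst X - Im a *\<^sub>R snd X, Re a *\<^sub>R snd X + Im a *\<^sub>R fst X)"

lemma vector_space_cscale: "vector_space (cscale :: complex \<Rightarrow> 'n::finite cvec \<Rightarrow> 'n cvec)"
  by unfold_locales (auto simp: cscale_def prod_eq_iff algebra_simps)

definition cembed :: "complex ^ 'n \<Rightarrow> 'n::finite cvec" where
  "cembed x = (x, 0)"

definition cconj :: "'n::finite cvec \<Rightarrow> 'n cvec" where
  "cconj X = (fst X, - snd X)"

definition J_C :: "'n::finite cvec \<Rightarrow> 'n cvec" where
  "J_C X = (std_J (fst X), std_J (snd X))"

definition omega_C :: "'n::finite set \<Rightarrow> 'n cvec \<Rightarrow> 'n cvec \<Rightarrow> complex" where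
  "omega_C P X Y =
     Complex (std_omega P (fst X) (fst Y) - std_omega P (snd X) (snd Y))
             (std_omega P (fst X) (snd Y) + std_omega P (snd X) (fst Y))"

definition proj10 :: "'n::finite cvec \<Rightarrow> 'n cvec" where
  "proj10 X = cscale (1 / 2) (X - cscale \<i> (J_C X))"


subsection \<open>The cubic form of third derivatives and its support\<close>

definition dderiv_C ::
    "'n::finite cvec \<Rightarrow> (complex ^ 'n \<Rightarrow> complex) \<Rightarrow> complex ^ 'n \<Rightarrow> complex" where
  "dderiv_C X h z = dderiv (fst X) h z + \<i> * dderiv (snd X) h z"

definition d3 :: "(complex ^ 'n::finite \<Rightarrow> complex) \<Rightarrow> complex ^ 'n \<Rightarrow> 'n ccubic" where
  "d3 f z X Y Z = dderiv_C (proj10 X) (dderiv_C (proj10 Y) (dderiv_C (proj10 Z) f)) z"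

text \<open>The endomorphism \<open>C\<^sub>X\<close>, applied to \<open>Y\<close>; the form \<open>omega_C P\<close> is nondegenerate.\<close>

definition cubic_endo_C :: "'n::finite set \<Rightarrow> 'n ccubic \<Rightarrow> 'n cvec \<Rightarrow> 'n cvec \<Rightarrow> 'n cvec" where
  "cubic_endo_C P C X Y = (THE W. \<forall>Z. omega_C P W Z = C X Y Z)"

definition cubic_support :: "'n::finite set \<Rightarrow> 'n ccubic \<Rightarrow> 'n cvec set" where
  "cubic_support P C = module.span cscale {cubic_endo_C P C X Y | X Y. True}"

definition isotropic_support :: "'n::finite set \<Rightarrow> 'n ccubic \<Rightarrow> bool" where
  "isotropic_support P C \<longleftrightarrow>
     (\<forall>v\<in>cubic_support P C. \<forall>w\<in>cubic_support P C. omega_C P v (cconj w) = 0)"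

definition cubic_conj :: "'n::finite ccubic \<Rightarrow> 'n ccubic" where
  "cubic_conj C X Y Z = cnj (C (cconj X) (cconj Y) (cconj Z))"

text \<open>
  \<open>C + cubic_conj C\<close> takes real values on \<open>V\<close>; \<open>S_cubic\<close> is the real cubic form obtained in this way
  from \<open>C = d3 f z\<close>, and \<open>S_endo\<close> the corresponding endomorphism-valued one-form.
\<close>

definition S_cubic ::
    "(complex ^ 'n::finite \<Rightarrow> complex) \<Rightarrow> complex ^ 'n \<Rightarrow> complex ^ 'n \<Rightarrow> complex ^ 'n \<Rightarrow> complex ^ 'n \<Rightarrow> real"
  where
  "S_cubic f z x y w = Re (d3 f z (cembed x) (cembed y) (cembed w)
                           + cubic_conj (d3 f z) (cembed x) (cembed y) (cembed w))"

definition S_endo ::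
    "'n::finite set \<Rightarrow> (complex ^ 'n \<Rightarrow> complex) \<Rightarrow> complex ^ 'n \<Rightarrow> complex ^ 'n \<Rightarrow> complex ^ 'n \<Rightarrow> complex ^ 'n"
  where
  "S_endo P f z x y = (THE u. \<forall>w. std_omega P u w = S_cubic f z x y w)"

text \<open>
  In the identity chart the canonical flat connection \<open>D\<close> has vanishing Christoffel symbols, so those
  of \<open>D + S\<^sub>f\<close> are given by \<open>S\<^sub>f\<close>.
\<close>

definition M_f ::
    "'n::finite set \<Rightarrow> (complex ^ 'n) set \<Rightarrow> (complex ^ 'n \<Rightarrow> complex) \<Rightarrow> (complex ^ 'n, complex ^ 'n) sk_data"
  where
  "M_f P M f = \<lparr> sk_top = top_of_set M, sk_atlas = {(M, \<lambda>z. z)},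
                 sk_g = (\<lambda>_ _. std_g P), sk_J = (\<lambda>_ _. std_J), sk_nabla = (\<lambda>_. S_endo P f) \<rparr>"

end

(*
  Part one. For holomorphic f one has d3 f (X, Y, Z) = D_x D_y D_z f with x, y, z the (1,0)-parts, so
  S_f is determined by omega(S_f x y, w) = 2 Re (D_x D_y D_w f). The covariant derivative of S_f is
  symmetric because fourth derivatives of f commute, and isotropy of the support says that
  S_f x (S_f y w) = 0; hence the curvature of D + S_f vanishes.

  Part two. The flat Levi-Civita connection D has local parallel frames (Picard iteration along rays for
  the total differential equation dP = A P), hence flat coordinates, in which g and J are constant and
  can be normalised. The tensor S = nabla - D is then totally symmetric and anticommutes with J.
  The flatness of nabla splits into a J-antilinear part, which makes S the real part of a
  holomorphic closed cubic form, i.e. of the third derivative of some f, and a J-linear part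
  [S x, S y] = 0, which forces S x (S y w) = 0 and thus isotropy.
*)
theory Submission
  imports Defs "HOL-Complex_Analysis.Cauchy_Integral_Formula"
begin

section \<open>Calculus of smooth maps\<close>

text \<open>Total symmetry gives omega (S x (S y w), v) = omega (S x v, S y w); this is why isotropy
  of the support and the vanishing of all products S x (S y w) are one condition. Conversely, S (J
  x) = - J (S x). Replacing x by J x in S x (S y w) = S y (S x w) therefore multiplies one side by -
  J and the other by J, and both must vanish.

  The curvature splits because J is constant in flat coordinates: derivatives of S in constant
  directions still anticommute with J, whereas a product of two S commutes with it.

  The equation dP = A P is the only source of existence besides the inverse function theorem. It
  yields the parallel frame, the dual coframe and, once a constant coordinate is adjoined, the
  Poincare lemma; the latter integrates the coframe to coordinates and the cubic form, in three
  steps, to f.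

  The definitions quantify over all smooth vector fields. Each condition is first turned into a
  pointwise identity for Christoffel symbols, which in the converse direction means inserting
  constant fields.\<close>

lemma dderiv_eq: "(h has_derivative h') (at z) \<Longrightarrow> dderiv v h z = h' v"
  unfolding dderiv_def using frechet_derivative_at by metis

lemma dderiv_works: "h differentiable (at z) \<Longrightarrow> (h has_derivative (\<lambda>v. dderiv v h z)) (at z)"
  unfolding dderiv_def using frechet_derivative_works by auto

lemma dderiv_cong:
  assumes "open W" "z \<in> W" "\<And>y. y \<in> W \<Longrightarrow> f y = g y"
  shows "dderiv v f z = dderiv v g z"
proof -
  \<comment> \<open>Off differentiability, \<open>frechet_derivative\<close> is an arbitrary choice.
    Showing that \<open>f\<close> and \<open>g\<close> have the same derivatives at \<open>z\<close>
    forces the same choice in every case.\<close>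
  have "(f has_derivative D) (at z) \<longleftrightarrow> (g has_derivative D) (at z)" for D
    using has_derivative_transform_within_open[of f D z UNIV W g]
      has_derivative_transform_within_open[of g D z UNIV W f] assms by auto
  then show ?thesis by (simp add: dderiv_def frechet_derivative_def)
qed

lemma differentiable_cong_open:
  assumes "open W" "z \<in> W" "\<And>y. y \<in> W \<Longrightarrow> f y = g y" "f differentiable (at z)"
  shows "g differentiable (at z)"
  using has_derivative_transform_within_open[of f _ z UNIV W g] assms
  by (auto simp: differentiable_def)

lemma Ck_on_Suc: "Ck_on (Suc k) W h \<longleftrightarrow> (\<forall>z\<in>W. h differentiable (at z)) \<and> (\<forall>v. Ck_on k W (dderiv v h))"
  by (simp add: dderiv_def[abs_def])

lemma Ck_on_cong:
  assumes "open W"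
  shows "(\<And>y. y \<in> W \<Longrightarrow> f y = g y) \<Longrightarrow> Ck_on k W f \<Longrightarrow> Ck_on k W g"
proof (induction k arbitrary: f g)
  case 0
  then show ?case by (auto cong: continuous_on_cong)
next
  case (Suc k)
  have "Ck_on k W (dderiv v g)" for v
  proof (rule Suc.IH)
    show "dderiv v f y = dderiv v g y" if "y \<in> W" for y
      using dderiv_cong[OF assms that Suc.prems(1)] .
    show "Ck_on k W (dderiv v f)" using Suc.prems(2) unfolding Ck_on_Suc by blast
  qed
  moreover have "g differentiable (at z)" if "z \<in> W" for z
    using differentiable_cong_open[OF assms that, of f g] Suc.prems that by (auto simp only: Ck_on_Suc)
  ultimately show ?case by (simp only: Ck_on_Suc) blast
qed

lemma Ck_on_subset: "Ck_on k W h \<Longrightarrow> W' \<subseteq> W \<Longrightarrow> Ck_on k W' h"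
proof (induction k arbitrary: h)
  case 0
  then show ?case using continuous_on_subset by auto
next
  case (Suc k)
  then show ?case unfolding Ck_on_Suc by blast
qed

lemma Ck_on_SucD: "Ck_on (Suc k) W h \<Longrightarrow> Ck_on k W h"
proof (induction k arbitrary: h)
  case 0
  then show ?case
    using differentiable_imp_continuous_on[of h W] differentiable_at_withinI
    unfolding differentiable_on_def Ck_on_Suc by auto
next
  case (Suc k)
  then show ?case using Ck_on_Suc by blast
qed

lemma Ck_on_const: "Ck_on k W (\<lambda>_. c)"
proof (induction k arbitrary: c)
  case (Suc k)
  have "dderiv v (\<lambda>_. c) = (\<lambda>_. 0)" for v :: 'a by (rule ext) (rule dderiv_eq, auto)
  then show ?case using Suc by (simp only: Ck_on_Suc) auto
qed auto

lemma Ck_on_linear: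
  assumes "bounded_linear L" "open W"
  shows "Ck_on k W f \<Longrightarrow> Ck_on k W (\<lambda>z. L (f z))"
proof (induction k arbitrary: f)
  case 0
  then show ?case by (auto intro: bounded_linear.continuous_on[OF assms(1)])
next
  case (Suc k)
  have d: "((\<lambda>z. L (f z)) has_derivative (\<lambda>v. L (dderiv v f z))) (at z)" if "z \<in> W" for z
    using Suc.prems that by (auto simp only: Ck_on_Suc intro!: bounded_linear.has_derivative[OF assms(1)] dderiv_works)
  have "Ck_on k W (dderiv v (\<lambda>z. L (f z)))" for v
  proof (rule Ck_on_cong[OF assms(2)])
    show "Ck_on k W (\<lambda>z. L (dderiv v f z))" using Suc.prems unfolding Ck_on_Suc by (intro Suc.IH) blast
  qed (simp only: dderiv_eq[OF d])
  then show ?case using d unfolding Ck_on_Suc differentiable_def by blast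
qed

lemma Ck_on_add:
  assumes "open W"
  shows "Ck_on k W f \<Longrightarrow> Ck_on k W g \<Longrightarrow> Ck_on k W (\<lambda>z. f z + g z)"
proof (induction k arbitrary: f g)
  case 0
  then show ?case by (simp add: continuous_on_add)
next
  case (Suc k)
  have d: "((\<lambda>z. f z + g z) has_derivative (\<lambda>v. dderiv v f z + dderiv v g z)) (at z)" if "z \<in> W" for z
    using Suc.prems that by (auto simp only: Ck_on_Suc intro!: has_derivative_add dderiv_works)
  have "Ck_on k W (dderiv v (\<lambda>z. f z + g z))" for v
  proof (rule Ck_on_cong[OF assms])
    show "Ck_on k W (\<lambda>z. dderiv v f z + dderiv v g z)" using Suc.prems unfolding Ck_on_Suc by (intro Suc.IH) blast+
  qed (simp only: dderiv_eq[OF d])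
  then show ?case using d unfolding Ck_on_Suc differentiable_def by blast
qed

lemma Ck_on_bilinear:
  assumes bl: "bounded_bilinear pr" and op: "open W"
  shows "Ck_on k W f \<Longrightarrow> Ck_on k W g \<Longrightarrow> Ck_on k W (\<lambda>z. pr (f z) (g z))"
proof (induction k arbitrary: f g)
  case 0
  then show ?case by (auto intro: bounded_bilinear.continuous_on[OF bl])
next
  case (Suc k)
  have d: "((\<lambda>z. pr (f z) (g z)) has_derivative (\<lambda>v. pr (f z) (dderiv v g z) + pr (dderiv v f z) (g z))) (at z)"
    if "z \<in> W" for z
    using Suc.prems that by (auto simp only: Ck_on_Suc intro!: bounded_bilinear.FDERIV[OF bl] dderiv_works)
  have f: "Ck_on k W f" and g: "Ck_on k W g" using Suc.prems Ck_on_SucD by auto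
  have "Ck_on k W (dderiv v (\<lambda>z. pr (f z) (g z)))" for v
  proof (rule Ck_on_cong[OF op])
    show "Ck_on k W (\<lambda>z. pr (f z) (dderiv v g z) + pr (dderiv v f z) (g z))"
      using Suc.prems f g by (intro Ck_on_add[OF op] Suc.IH) (auto simp only: Ck_on_Suc)
  qed (simp only: dderiv_eq[OF d])
  then show ?case using d unfolding Ck_on_Suc differentiable_def by blast
qed

lemma Ck_on_sum:
  assumes "open W" "\<And>i. i \<in> I \<Longrightarrow> Ck_on k W (f i)"
  shows "Ck_on k W (\<lambda>z. \<Sum>i\<in>I. f i z)"
  using assms(2) by (induction I rule: infinite_finite_induct) (auto intro: Ck_on_const Ck_on_add[OF assms(1)])

lemma Ck_on_compose:
  fixes f :: "'a::euclidean_space \<Rightarrow> 'b::euclidean_space"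
  assumes op: "open W" "open W'" and im: "f ` W \<subseteq> W'"
  shows "Ck_on k W f \<Longrightarrow> Ck_on k W' g \<Longrightarrow> Ck_on k W (\<lambda>z. g (f z))"
proof (induction k arbitrary: g)
  case 0
  then show ?case using im by (auto intro: continuous_on_compose2)
next
  case (Suc k)
  have dg: "(g has_derivative (\<lambda>v. dderiv v g (f z))) (at (f z))" if "z \<in> W" for z
    using Suc.prems that im by (auto simp only: Ck_on_Suc intro!: dderiv_works)
  have df: "(f has_derivative (\<lambda>v. dderiv v f z)) (at z)" if "z \<in> W" for z
    using Suc.prems that im by (auto simp only: Ck_on_Suc intro!: dderiv_works)
  have d: "((\<lambda>z. g (f z)) has_derivative (\<lambda>v. dderiv (dderiv v f z) g (f z))) (at z)" if "z \<in> W" for z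
    using has_derivative_compose[OF df[OF that] dg[OF that]] .
  \<comment> \<open>The direction \<open>dderiv v f z\<close> moves with \<open>z\<close>, whereas
    \<open>Ck_on\<close> speaks of fixed directions. In a basis it becomes scalar coefficients times
    \<open>dderiv b g (f z)\<close>, and the induction hypothesis applies to the latter.\<close>
  have e: "dderiv (dderiv v f z) g (f z) = (\<Sum>b\<in>Basis. (dderiv v f z \<bullet> b) *\<^sub>R dderiv b g (f z))" if "z \<in> W" for v z
  proof -
    interpret linear "\<lambda>v. dderiv v g (f z)" using dg[OF that] has_derivative_linear by blast
    show ?thesis by (subst euclidean_representation[of "dderiv v f z", symmetric]) (simp only: sum scaleR)
  qed
  have f: "Ck_on k W f" using Suc.prems Ck_on_SucD by auto
  have "Ck_on k W (dderiv v (\<lambda>z. g (f z)))" for v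
  proof (rule Ck_on_cong[OF op(1)])
    show "Ck_on k W (\<lambda>z. \<Sum>b\<in>Basis. (dderiv v f z \<bullet> b) *\<^sub>R dderiv b g (f z))"
      using Suc.prems
      by (intro Ck_on_sum[OF op(1)] Ck_on_bilinear[OF bounded_bilinear_scaleR op(1)] Suc.IH f
          Ck_on_linear[OF bounded_linear_inner_left op(1)]) (auto simp only: Ck_on_Suc)
  qed (simp only: dderiv_eq[OF d] e)
  then show ?case using d unfolding Ck_on_Suc differentiable_def by blast
qed

lemma smooth_on_differentiable: "smooth_on W h \<Longrightarrow> z \<in> W \<Longrightarrow> h differentiable (at z)"
  unfolding smooth_on_def using Ck_on_Suc by blast

lemma smooth_on_has_derivative: "smooth_on W h \<Longrightarrow> z \<in> W \<Longrightarrow> (h has_derivative (\<lambda>v. dderiv v h z)) (at z)"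
  using smooth_on_differentiable dderiv_works by blast

lemma smooth_on_dderiv: "smooth_on W h \<Longrightarrow> smooth_on W (dderiv v h)"
  unfolding smooth_on_def using Ck_on_Suc by blast

lemma smooth_on_continuous: "smooth_on W h \<Longrightarrow> continuous_on W h"
  unfolding smooth_on_def using Ck_on.simps(1) by blast

lemma smooth_on_cong:
  "smooth_on W f \<Longrightarrow> open W \<Longrightarrow> (\<And>y. y \<in> W \<Longrightarrow> f y = g y) \<Longrightarrow> smooth_on W g"
  unfolding smooth_on_def using Ck_on_cong by blast

lemma smooth_on_subset: "smooth_on W h \<Longrightarrow> W' \<subseteq> W \<Longrightarrow> smooth_on W' h"
  unfolding smooth_on_def using Ck_on_subset by blast

lemma smooth_on_const [simp]: "smooth_on W (\<lambda>_. c)"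
  unfolding smooth_on_def using Ck_on_const by blast

lemma smooth_on_linear: "bounded_linear L \<Longrightarrow> open W \<Longrightarrow> smooth_on W f \<Longrightarrow> smooth_on W (\<lambda>z. L (f z))"
  unfolding smooth_on_def using Ck_on_linear by blast

lemma smooth_on_add: "open W \<Longrightarrow> smooth_on W f \<Longrightarrow> smooth_on W g \<Longrightarrow> smooth_on W (\<lambda>z. f z + g z)"
  unfolding smooth_on_def using Ck_on_add by blast

lemma smooth_on_minus: "open W \<Longrightarrow> smooth_on W f \<Longrightarrow> smooth_on W (\<lambda>z. - f z)"
  using smooth_on_linear[of uminus] bounded_linear_minus[OF bounded_linear_ident] by auto

lemma smooth_on_diff: "open W \<Longrightarrow> smooth_on W f \<Longrightarrow> smooth_on W g \<Longrightarrow> smooth_on W (\<lambda>z. f z - g z)"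
  using smooth_on_add[of W f "\<lambda>z. - g z"] smooth_on_minus[of W g] by simp

lemma smooth_on_sum:
  "open W \<Longrightarrow> (\<And>i. i \<in> I \<Longrightarrow> smooth_on W (f i)) \<Longrightarrow> smooth_on W (\<lambda>z. \<Sum>i\<in>I. f i z)"
  unfolding smooth_on_def using Ck_on_sum[of W I _ f] by blast

lemma smooth_on_compose:
  fixes f :: "'a::euclidean_space \<Rightarrow> 'b::euclidean_space"
  shows "open W \<Longrightarrow> open W' \<Longrightarrow> f ` W \<subseteq> W' \<Longrightarrow> smooth_on W f \<Longrightarrow> smooth_on W' g \<Longrightarrow> smooth_on W (\<lambda>z. g (f z))"
  unfolding smooth_on_def using Ck_on_compose by blast

lemma smooth_onI:
  assumes "\<And>z. z \<in> W \<Longrightarrow> h differentiable (at z)" "\<And>v. smooth_on W (dderiv v h)"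
  shows "smooth_on W h"
  unfolding smooth_on_def
proof
  fix k
  have "Ck_on (Suc k) W h" using assms unfolding smooth_on_def Ck_on_Suc by blast
  then show "Ck_on k W h" by (rule Ck_on_SucD)
qed

lemma smooth_on_id: "smooth_on W (\<lambda>z. z)"
proof (rule smooth_onI)
  fix v :: 'a
  have "dderiv v (\<lambda>z. z) = (\<lambda>_. v)" by (rule ext) (rule dderiv_eq, auto)
  then show "smooth_on W (dderiv v (\<lambda>z. z))" by simp
qed auto

text \<open>The derivative is only known to be as regular as \<open>h\<close>, so each pass of the
  induction gains one order. This handles equations with the unknown on the right-hand side, such as
  dp = A p.\<close>

lemma smooth_on_bootstrap:
  assumes op: "open W" and d: "\<And>z. z \<in> W \<Longrightarrow> (h has_derivative (\<lambda>v. D z v)) (at z)"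
    and step: "\<And>k v. Ck_on k W h \<Longrightarrow> Ck_on k W (\<lambda>z. D z v)"
  shows "smooth_on W h"
  unfolding smooth_on_def
proof
  fix k
  show "Ck_on k W h"
  proof (induction k)
    case 0
    show ?case using has_derivative_continuous_on[of W h D] has_derivative_at_withinI[OF d] by auto
  next
    case (Suc k)
    have "Ck_on k W (dderiv v h)" for v
      by (rule Ck_on_cong[OF op _ step[OF Suc, of v]]) (simp only: dderiv_eq[OF d])
    then show ?case using d by (auto simp only: Ck_on_Suc differentiable_def)
  qed
qed

section \<open>Linear and bilinear maps depending on a point\<close>

lemma linear_basis_expand:
  fixes A :: "'e::euclidean_space \<Rightarrow> 'f::real_vector"
  assumes "linear A"
  shows "A x = (\<Sum>b\<in>Basis. (x \<bullet> b) *\<^sub>R A b)"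
proof -
  interpret linear A by fact
  show ?thesis by (subst euclidean_representation[of x, symmetric]) (simp only: sum scaleR)
qed

text \<open>Product rule for a field of linear maps applied to a vector field. Differentiability of
  \<open>A\<close> is required on fixed vectors only, as in the definition of smooth tensor fields;
  a basis expansion reduces the claim to scalar multiples.\<close>

lemma has_derivative_linear_family:
  fixes A :: "'e::real_normed_vector \<Rightarrow> 'f::euclidean_space \<Rightarrow> 'g::real_normed_vector"
  assumes op: "open W" and z: "z \<in> W" and lin: "\<And>y. y \<in> W \<Longrightarrow> linear (A y)"
    and dA: "\<And>u. (\<lambda>y. A y u) differentiable (at z)"
    and dX: "(X has_derivative X') (at z)"
  shows "((\<lambda>y. A y (X y)) has_derivative (\<lambda>h. dderiv h (\<lambda>y. A y (X z)) z + A z (X' h))) (at z)"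
proof -
  have "((\<lambda>y. \<Sum>b\<in>Basis. (X y \<bullet> b) *\<^sub>R A y b) has_derivative
     (\<lambda>h. \<Sum>b\<in>Basis. (X z \<bullet> b) *\<^sub>R dderiv h (\<lambda>y. A y b) z + (X' h \<bullet> b) *\<^sub>R A z b)) (at z)"
    by (intro has_derivative_sum has_derivative_scaleR dderiv_works dA has_derivative_inner_left dX)
  moreover have "(\<Sum>b\<in>Basis. (X z \<bullet> b) *\<^sub>R dderiv h (\<lambda>y. A y b) z + (X' h \<bullet> b) *\<^sub>R A z b)
      = dderiv h (\<lambda>y. A y (X z)) z + A z (X' h)" for h
  proof -
    have "((\<lambda>y. \<Sum>b\<in>Basis. (X z \<bullet> b) *\<^sub>R A y b) has_derivative
        (\<lambda>h. \<Sum>b\<in>Basis. (X z \<bullet> b) *\<^sub>R dderiv h (\<lambda>y. A y b) z)) (at z)"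
      by (intro has_derivative_sum has_derivative_scaleR_right dderiv_works dA)
    from has_derivative_transform_within_open[OF this op z] have
      "((\<lambda>y. A y (X z)) has_derivative
        (\<lambda>h. \<Sum>b\<in>Basis. (X z \<bullet> b) *\<^sub>R dderiv h (\<lambda>y. A y b) z)) (at z)"
      using linear_basis_expand[OF lin, of _ "X z"] by auto
    then show ?thesis using linear_basis_expand[OF lin[OF z], of "X' h"]
      by (simp add: dderiv_eq sum.distrib)
  qed
  ultimately have *: "((\<lambda>y. \<Sum>b\<in>Basis. (X y \<bullet> b) *\<^sub>R A y b) has_derivative
     (\<lambda>h. dderiv h (\<lambda>y. A y (X z)) z + A z (X' h))) (at z)" by simp
  show ?thesis
    by (rule has_derivative_transform_within_open[OF * op z]) (use linear_basis_expand[OF lin] in auto)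
qed

lemma Ck_on_linear_family:
  fixes A :: "'e::euclidean_space \<Rightarrow> 'f::euclidean_space \<Rightarrow> 'g::real_normed_vector"
  assumes op: "open W" and lin: "\<And>y. y \<in> W \<Longrightarrow> linear (A y)"
    and A: "\<And>u. Ck_on k W (\<lambda>y. A y u)" and X: "Ck_on k W X"
  shows "Ck_on k W (\<lambda>y. A y (X y))"
proof (rule Ck_on_cong[OF op])
  show "Ck_on k W (\<lambda>y. \<Sum>b\<in>Basis. (X y \<bullet> b) *\<^sub>R A y b)"
    by (intro Ck_on_sum[OF op] Ck_on_bilinear[OF bounded_bilinear_scaleR op] A
          Ck_on_linear[OF bounded_linear_inner_left op] X)
qed (use linear_basis_expand[OF lin] in auto)

lemma smooth_on_linear_family:
  fixes A :: "'e::euclidean_space \<Rightarrow> 'f::euclidean_space \<Rightarrow> 'g::real_normed_vector"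
  assumes "open W" "\<And>y. y \<in> W \<Longrightarrow> linear (A y)" "\<And>u. smooth_on W (\<lambda>y. A y u)" "smooth_on W X"
  shows "smooth_on W (\<lambda>y. A y (X y))"
  using assms Ck_on_linear_family[of W A _ X] unfolding smooth_on_def by blast

lemma bilinear_linear_left: "bilinear B \<Longrightarrow> linear (\<lambda>x. B x y)"
  and bilinear_linear_right: "bilinear B \<Longrightarrow> linear (B x)"
  unfolding bilinear_def by auto

lemma smooth_on_bilinear_family:
  fixes B :: "'e::euclidean_space \<Rightarrow> 'f::euclidean_space \<Rightarrow> 'g::euclidean_space \<Rightarrow> 'h::real_normed_vector"
  assumes op: "open W" and lin: "\<And>y. y \<in> W \<Longrightarrow> bilinear (B y)"
    and B: "\<And>u v. smooth_on W (\<lambda>y. B y u v)" and X: "smooth_on W X" and Y: "smooth_on W Y"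
  shows "smooth_on W (\<lambda>y. B y (X y) (Y y))"
proof -
  have 1: "smooth_on W (\<lambda>y. B y (X y) v)" for v
    by (rule smooth_on_linear_family[OF op, of "\<lambda>y x. B y x v"]) (use lin B X in \<open>auto simp: bilinear_def\<close>)
  show ?thesis
    by (rule smooth_on_linear_family[OF op, of "\<lambda>y. B y (X y)"]) (use 1 lin Y in \<open>auto simp: bilinear_def\<close>)
qed

lemma has_derivative_bilinear_family:
  fixes B :: "'e::real_normed_vector \<Rightarrow> 'f::euclidean_space \<Rightarrow> 'g::euclidean_space \<Rightarrow> 'h::real_normed_vector"
  assumes op: "open W" and z: "z \<in> W" and lin: "\<And>y. y \<in> W \<Longrightarrow> bilinear (B y)"
    and dB: "\<And>u v. (\<lambda>y. B y u v) differentiable (at z)"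
    and dX: "(X has_derivative X') (at z)" and dY: "(Y has_derivative Y') (at z)"
  shows "((\<lambda>y. B y (X y) (Y y)) has_derivative
    (\<lambda>h. dderiv h (\<lambda>y. B y (X z) (Y z)) z + B z (X' h) (Y z) + B z (X z) (Y' h))) (at z)"
proof -
  have 1: "((\<lambda>y. B y (X y) v) has_derivative (\<lambda>h. dderiv h (\<lambda>y. B y (X z) v) z + B z (X' h) v)) (at z)" for v
    by (rule has_derivative_linear_family[OF op z, of "\<lambda>y x. B y x v"]) (use lin dB dX in \<open>auto simp: bilinear_def\<close>)
  have "((\<lambda>y. B y (X y) (Y y)) has_derivative
    (\<lambda>h. dderiv h (\<lambda>y. B y (X y) (Y z)) z + B z (X z) (Y' h))) (at z)"
  proof (rule has_derivative_linear_family[OF op z, of "\<lambda>y. B y (X y)"])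
    show "(\<lambda>y. B y (X y) u) differentiable at z" for u using 1 unfolding differentiable_def by blast
  qed (use lin dY in \<open>auto simp: bilinear_def\<close>)
  then show ?thesis by (simp add: dderiv_eq[OF 1])
qed

section \<open>Parameter integrals, bounds on compact sets and symmetry of second
  derivatives\<close>

lemma has_derivative_integral_parameter:
  fixes f :: "'a::euclidean_space \<Rightarrow> real \<Rightarrow> 'b::banach"
  assumes cv: "convex U" and op: "open U" and x0: "x0 \<in> U"
    and d: "\<And>x t. x \<in> U \<Longrightarrow> t \<in> {a..b} \<Longrightarrow> ((\<lambda>x. f x t) has_derivative f' x t) (at x)"
    and c: "\<And>h. continuous_on (U \<times> {a..b}) (\<lambda>(x, t). f' x t h)"
    and int: "\<And>x. x \<in> U \<Longrightarrow> continuous_on {a..b} (f x)"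
  shows "((\<lambda>x. integral {a..b} (f x)) has_derivative (\<lambda>h. integral {a..b} (\<lambda>t. f' x0 t h))) (at x0)"
proof -
  \<comment> \<open>\<open>leibniz_rule\<close> asks for a continuous derivative with values in the
    bounded linear maps. The domain is finite-dimensional, so continuity in every fixed direction
    \<open>h\<close> is enough.\<close>
  define g where "g x t = Blinfun (f' x t)" for x t
  have g: "blinfun_apply (g x t) = f' x t" if "x \<in> U" "t \<in> {a..b}" for x t
    using d[OF that] by (simp add: g_def bounded_linear_Blinfun_apply has_derivative_bounded_linear)
  have cg: "continuous_on (U \<times> cbox a b) (\<lambda>(x, t). g x t)"
  proof (rule continuous_on_blinfun_componentwise)
    fix i :: 'a
    have "continuous_on (U \<times> {a..b}) (\<lambda>x. (case x of (x, t) \<Rightarrow> g x t) i) \<longleftrightarrow>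
      continuous_on (U \<times> {a..b}) (\<lambda>(x, t). f' x t i)"
      by (rule continuous_on_cong) (auto simp: g)
    then show "continuous_on (U \<times> cbox a b) (\<lambda>x. (case x of (x, t) \<Rightarrow> g x t) i)" using c by simp
  qed
  have "((\<lambda>x. integral (cbox a b) (f x)) has_derivative integral (cbox a b) (g x0)) (at x0 within U)"
  proof (rule leibniz_rule[OF _ _ cg x0 cv])
    show "((\<lambda>x. f x t) has_derivative g x t) (at x within U)" if "x \<in> U" "t \<in> cbox a b" for x t
      using d[of x t] g[of x t] that has_derivative_at_withinI by auto
    show "f x integrable_on cbox a b" if "x \<in> U" for x
      using int[OF that] integrable_continuous_real by auto
  qed
  moreover have "integral (cbox a b) (g x0) h = integral {a..b} (\<lambda>t. f' x0 t h)" for h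
  proof -
    have "continuous_on {a..b} (g x0)"
      using continuous_on_compose2[OF cg, of "{a..b}" "\<lambda>t. (x0, t)"] x0
      by (simp add: image_subset_iff continuous_on_Pair)
    then have "g x0 integrable_on {a..b}" using integrable_continuous_real by blast
    then have "integral {a..b} (g x0) h = integral {a..b} (\<lambda>t. g x0 t h)"
      using integral_linear[OF _ blinfun.bounded_linear_left, of "g x0" "{a..b}" h] by (simp add: o_def)
    then show ?thesis using g[OF x0] by (auto intro!: integral_cong)
  qed
  ultimately have "((\<lambda>x. integral {a..b} (f x)) has_derivative blinfun_apply (integral {a..b} (g x0))) (at x0)"
    and "blinfun_apply (integral {a..b} (g x0)) = (\<lambda>h. integral {a..b} (\<lambda>t. f' x0 t h))"
    using at_within_open[OF x0 op] by auto
  then show ?thesis by simp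
qed

lemma linear_dderiv_family:
  assumes op: "open W" and z: "z \<in> W" and lin: "\<And>y. y \<in> W \<Longrightarrow> linear (A y)"
    and dA: "\<And>u. (\<lambda>y. A y u) differentiable (at z)"
  shows "linear (\<lambda>u. dderiv h (\<lambda>y. A y u) z)"
proof
  fix u v
  have "((\<lambda>y. A y u + A y v) has_derivative (\<lambda>h. dderiv h (\<lambda>y. A y u) z + dderiv h (\<lambda>y. A y v) z)) (at z)"
    by (intro has_derivative_add dderiv_works dA)
  then show "dderiv h (\<lambda>y. A y (u + v)) z = dderiv h (\<lambda>y. A y u) z + dderiv h (\<lambda>y. A y v) z"
    using dderiv_cong[OF op z, of "\<lambda>y. A y (u + v)" "\<lambda>y. A y u + A y v"] by (simp add: dderiv_eq linear_add lin)
next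
  fix c u
  have "((\<lambda>y. c *\<^sub>R A y u) has_derivative (\<lambda>h. c *\<^sub>R dderiv h (\<lambda>y. A y u) z)) (at z)"
    by (intro has_derivative_scaleR_right dderiv_works dA)
  then show "dderiv h (\<lambda>y. A y (c *\<^sub>R u)) z = c *\<^sub>R dderiv h (\<lambda>y. A y u) z"
    using dderiv_cong[OF op z, of "\<lambda>y. A y (c *\<^sub>R u)" "\<lambda>y. c *\<^sub>R A y u"] by (simp add: dderiv_eq linear_scale lin)
qed

lemma bilinear_dderiv_family:
  assumes op: "open W" and z: "z \<in> W" and lin: "\<And>y. y \<in> W \<Longrightarrow> bilinear (B y)"
    and dB: "\<And>u v. (\<lambda>y. B y u v) differentiable (at z)"
  shows "bilinear (\<lambda>u v. dderiv h (\<lambda>y. B y u v) z)"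
  unfolding bilinear_def
  using linear_dderiv_family[OF op z, of "\<lambda>y. B y _" h] linear_dderiv_family[OF op z, of "\<lambda>y u. B y u _" h]
    lin dB by (auto simp: bilinear_def)

lemma continuous_on_linear_family:
  fixes A :: "'s::topological_space \<Rightarrow> 'f::euclidean_space \<Rightarrow> 'g::real_normed_vector"
  assumes lin: "\<And>y. y \<in> S \<Longrightarrow> linear (A y)"
    and A: "\<And>u. continuous_on S (\<lambda>y. A y u)" and X: "continuous_on S X"
  shows "continuous_on S (\<lambda>y. A y (X y))"
proof -
  have "continuous_on S (\<lambda>y. \<Sum>b\<in>Basis. (X y \<bullet> b) *\<^sub>R A y b)"
    by (intro continuous_intros A X)
  then show ?thesis by (rule continuous_on_eq) (simp add: linear_basis_expand[OF lin, symmetric])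
qed

lemma continuous_on_bilinear_family:
  fixes B :: "'s::topological_space \<Rightarrow> 'f::euclidean_space \<Rightarrow> 'g::euclidean_space \<Rightarrow> 'h::real_normed_vector"
  assumes lin: "\<And>y. y \<in> S \<Longrightarrow> bilinear (B y)"
    and B: "\<And>u v. continuous_on S (\<lambda>y. B y u v)" and X: "continuous_on S X" and Y: "continuous_on S Y"
  shows "continuous_on S (\<lambda>y. B y (X y) (Y y))"
proof -
  have 1: "continuous_on S (\<lambda>y. B y (X y) v)" for v
    by (rule continuous_on_linear_family[of S "\<lambda>y x. B y x v"]) (use lin B X in \<open>auto simp: bilinear_def\<close>)
  show ?thesis
    by (rule continuous_on_linear_family[of S "\<lambda>y. B y (X y)"]) (use 1 lin Y in \<open>auto simp: bilinear_def\<close>)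
qed

lemma bilinear_family_bound:
  fixes B :: "'s::topological_space \<Rightarrow> 'f::euclidean_space \<Rightarrow> 'g::euclidean_space \<Rightarrow> 'h::real_normed_vector"
  assumes S: "compact S" and lin: "\<And>y. y \<in> S \<Longrightarrow> bilinear (B y)"
    and B: "\<And>u v. continuous_on S (\<lambda>y. B y u v)"
  obtains C where "C \<ge> 0" "\<And>y u v. y \<in> S \<Longrightarrow> norm (B y u v) \<le> C * norm u * norm v"
proof -
  have "\<exists>K. \<forall>y\<in>S. norm (B y b c) \<le> K" for b c
    using compact_imp_bounded[OF compact_continuous_image[OF B S, of b c]] by (auto simp: bounded_iff)
  then obtain K where K: "\<And>b c y. y \<in> S \<Longrightarrow> norm (B y b c) \<le> K b c" by metis
  \<comment> \<open>The absolute values keep \<open>C\<close> nonnegative also for empty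
    \<open>S\<close>, where the numbers \<open>K b c\<close> are arbitrary.\<close>
  define C where "C = (\<Sum>b\<in>Basis. \<Sum>c\<in>Basis. \<bar>K b c\<bar>)"
  have "norm (B y u v) \<le> C * norm u * norm v" if y: "y \<in> S" for y u v
  proof -
    have "B y u v = (\<Sum>b\<in>Basis. (u \<bullet> b) *\<^sub>R (\<Sum>c\<in>Basis. (v \<bullet> c) *\<^sub>R B y b c))"
      using linear_basis_expand[OF bilinear_linear_left[OF lin[OF y]], of u v]
        linear_basis_expand[OF bilinear_linear_right[OF lin[OF y]], of _ v] by simp
    also have "norm \<dots> \<le> (\<Sum>b\<in>Basis. norm u * (\<Sum>c\<in>Basis. norm v * \<bar>K b c\<bar>))"
    proof (intro norm_sum[THEN order_trans] sum_mono)
      fix b :: 'f assume b: "b \<in> Basis"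
      have "norm (\<Sum>c\<in>Basis. (v \<bullet> c) *\<^sub>R B y b c) \<le> (\<Sum>c\<in>Basis. norm v * \<bar>K b c\<bar>)"
      proof (intro norm_sum[THEN order_trans] sum_mono)
        fix c :: 'g assume c: "c \<in> Basis"
        show "norm ((v \<bullet> c) *\<^sub>R B y b c) \<le> norm v * \<bar>K b c\<bar>"
          using Basis_le_norm[OF c, of v] order_trans[OF K[OF y, of b c] abs_ge_self] by (auto intro!: mult_mono)
      qed
      then show "norm ((u \<bullet> b) *\<^sub>R (\<Sum>c\<in>Basis. (v \<bullet> c) *\<^sub>R B y b c)) \<le> norm u * (\<Sum>c\<in>Basis. norm v * \<bar>K b c\<bar>)"
        using Basis_le_norm[OF b, of u] by (auto intro!: mult_mono)
    qed
    also have "\<dots> = C * norm u * norm v"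
      by (simp add: C_def sum_distrib_left sum_distrib_right mult_ac)
    finally show ?thesis .
  qed
  moreover have "C \<ge> 0" by (auto simp: C_def intro!: sum_nonneg)
  ultimately show ?thesis using that by blast
qed

text \<open>The increment of \<open>f\<close> along \<open>\<tau> *\<^sub>R v\<close> is the
  integral of \<open>dderiv v f\<close> over the segment. Differentiating it under the integral in
  direction \<open>u\<close>, and then in \<open>\<tau>\<close> at 0, produces both mixed
  derivatives.\<close>

lemma dderiv_commute:
  fixes f :: "'a::euclidean_space \<Rightarrow> 'b::banach"
  assumes op: "open W" and z: "z \<in> W" and f: "smooth_on W f"
  shows "dderiv u (dderiv v f) z = dderiv v (dderiv u f) z"
proof -
  obtain e where e: "e > 0" "ball z e \<subseteq> W" using op z open_contains_ball by blast
  \<comment> \<open>Segments starting in \<open>ball z r\<close> have to stay in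
    \<open>ball z e\<close>, so half of \<open>e\<close> is left for the displacement along
    \<open>v\<close>. The 1 in the denominator of \<open>a\<close> covers
    \<open>v = 0\<close>.\<close>
  define r where "r = e / 2"
  define a where "a = r / (norm v + 1)"
  have pos: "r > 0" "a > 0" using e by (auto simp: r_def a_def add_nonneg_pos)
  have "norm v + 1 > 0" by (simp add: add_nonneg_pos)
  then have av: "a * norm v \<le> r" using pos by (simp add: a_def pos_divide_le_eq algebra_simps)
  have inW: "x + s *\<^sub>R v \<in> W" if "x \<in> ball z r" "s \<in> {0..a}" for x s
  proof -
    have "norm (s *\<^sub>R v) \<le> r" using that av mult_right_mono[of s a "norm v"] by auto
    moreover have "norm (z - (x + s *\<^sub>R v)) \<le> norm (z - x) + norm (s *\<^sub>R v)"
      using norm_triangle_ineq4[of "z - x" "s *\<^sub>R v"] by (simp add: algebra_simps)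
    ultimately have "x + s *\<^sub>R v \<in> ball z e" using that unfolding mem_ball dist_norm r_def by linarith
    then show ?thesis using e by auto
  qed
  have ray: "((\<lambda>s. x + s *\<^sub>R v) has_derivative (\<lambda>h. h *\<^sub>R v)) (at s within T)" for x s T
    by (auto intro!: derivative_eq_intros)
  have shift: "((\<lambda>x. x + w) has_derivative (\<lambda>h. h)) (at x)" for x w :: 'a
    by (auto intro!: derivative_eq_intros)
  have line: "((\<lambda>s. g (x + s *\<^sub>R v)) has_vector_derivative dderiv v g (x + s *\<^sub>R v)) (at s within T)"
    if "smooth_on W g" "x \<in> ball z r" "s \<in> {0..a}" for g :: "'a \<Rightarrow> 'b" and x s T
  proof -
    have d: "(g has_derivative (\<lambda>h. dderiv h g (x + s *\<^sub>R v))) (at (x + s *\<^sub>R v))"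
      using smooth_on_has_derivative[OF that(1) inW[OF that(2,3)]] .
    have "((\<lambda>s. g (x + s *\<^sub>R v)) has_derivative (\<lambda>h. dderiv (h *\<^sub>R v) g (x + s *\<^sub>R v))) (at s within T)"
      by (rule has_derivative_compose[OF ray d])
    moreover have "dderiv (h *\<^sub>R v) g (x + s *\<^sub>R v) = h *\<^sub>R dderiv v g (x + s *\<^sub>R v)" for h
      using linear_scale[OF has_derivative_linear[OF d]] .
    ultimately show ?thesis by (simp add: has_vector_derivative_def)
  qed
  have cont: "continuous_on (ball z r \<times> {0..a}) (\<lambda>(x, s). g (x + s *\<^sub>R v))" if "continuous_on W g" for g :: "'a \<Rightarrow> 'b"
    unfolding case_prod_unfold
    by (rule continuous_on_compose2[OF that]) (auto intro!: continuous_intros inW)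
  have cont1: "continuous_on {0..\<tau>} (\<lambda>s. g (x + s *\<^sub>R v))"
    if "continuous_on W g" "x \<in> ball z r" "\<tau> \<in> {0..a}" for g :: "'a \<Rightarrow> 'b" and x \<tau>
    by (rule continuous_on_compose2[OF that(1)]) (use that inW in \<open>auto intro!: continuous_intros\<close>)
  have sv: "smooth_on W (dderiv v f)" and su: "smooth_on W (dderiv u f)" using smooth_on_dderiv[OF f] by auto
  have zr: "z \<in> ball z r" using pos by simp
  have eq: "dderiv u f (z + \<tau> *\<^sub>R v) - dderiv u f z = integral {0..\<tau>} (\<lambda>s. dderiv u (dderiv v f) (z + s *\<^sub>R v))"
    if t: "\<tau> \<in> {0..a}" for \<tau>
  proof -
    have sub: "{0..\<tau>} \<subseteq> {0..a}" using t by auto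
    have "((\<lambda>x. integral {0..\<tau>} (\<lambda>s. dderiv v f (x + s *\<^sub>R v))) has_derivative
      (\<lambda>h. integral {0..\<tau>} (\<lambda>s. dderiv h (dderiv v f) (z + s *\<^sub>R v)))) (at z)"
    proof (rule has_derivative_integral_parameter[of "ball z r"])
      fix x s assume x: "x \<in> ball z r" and s: "s \<in> {0..\<tau>}"
      have d: "(dderiv v f has_derivative (\<lambda>h. dderiv h (dderiv v f) (x + s *\<^sub>R v))) (at (x + s *\<^sub>R v))"
        using smooth_on_has_derivative[OF sv inW[OF x]] s sub by auto
      show "((\<lambda>x. dderiv v f (x + s *\<^sub>R v)) has_derivative (\<lambda>h. dderiv h (dderiv v f) (x + s *\<^sub>R v))) (at x)"
        by (rule has_derivative_compose[OF shift d])
    next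
      fix h
      show "continuous_on (ball z r \<times> {0..\<tau>}) (\<lambda>(x, s). dderiv h (dderiv v f) (x + s *\<^sub>R v))"
        by (rule continuous_on_subset[OF cont[OF smooth_on_continuous[OF smooth_on_dderiv[OF sv]]]]) (use sub in auto)
    next
      fix x assume "x \<in> ball z r"
      then show "continuous_on {0..\<tau>} (\<lambda>s. dderiv v f (x + s *\<^sub>R v))"
        using cont1[OF smooth_on_continuous[OF sv]] t by auto
    qed (use zr in auto)
    moreover have "integral {0..\<tau>} (\<lambda>s. dderiv v f (x + s *\<^sub>R v)) = f (x + \<tau> *\<^sub>R v) - f x" if "x \<in> ball z r" for x
    proof -
      have "((\<lambda>s. dderiv v f (x + s *\<^sub>R v)) has_integral (f (x + \<tau> *\<^sub>R v) - f (x + 0 *\<^sub>R v))) {0..\<tau>}"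
        by (rule fundamental_theorem_of_calculus) (use t sub line[OF f that] in auto)
      then show ?thesis by (simp add: integral_unique)
    qed
    ultimately have 1: "((\<lambda>x. f (x + \<tau> *\<^sub>R v) - f x) has_derivative
      (\<lambda>h. integral {0..\<tau>} (\<lambda>s. dderiv h (dderiv v f) (z + s *\<^sub>R v)))) (at z)"
      by (rule has_derivative_transform_within_open[OF _ open_ball zr])
    have d: "(f has_derivative (\<lambda>h. dderiv h f (z + \<tau> *\<^sub>R v))) (at (z + \<tau> *\<^sub>R v))"
      using smooth_on_has_derivative[OF f inW[OF zr]] t by auto
    have "((\<lambda>x. f (x + \<tau> *\<^sub>R v) - f x) has_derivative (\<lambda>h. dderiv h f (z + \<tau> *\<^sub>R v) - dderiv h f z)) (at z)"
      by (intro has_derivative_diff has_derivative_compose[OF shift d] smooth_on_has_derivative[OF f z])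
    from has_derivative_unique[OF 1 this] show ?thesis by (simp add: fun_eq_iff)
  qed
  \<comment> \<open>The integral formula holds for nonnegative \<open>\<tau>\<close> only, so both
    derivatives at 0 are one-sided, within \<open>{0..a}\<close>. They are unique there because
    \<open>a\<close> is positive.\<close>
  have "((\<lambda>\<tau>. dderiv u f (z + \<tau> *\<^sub>R v) - dderiv u f z) has_vector_derivative dderiv v (dderiv u f) z) (at 0 within {0..a})"
    using has_vector_derivative_diff[OF line[OF su zr, of 0 "{0..a}"] has_vector_derivative_const, of "dderiv u f z"] pos by simp
  moreover have "((\<lambda>\<tau>. dderiv u f (z + \<tau> *\<^sub>R v) - dderiv u f z) has_vector_derivative dderiv u (dderiv v f) z) (at 0 within {0..a})"
  proof -
    have "((\<lambda>\<tau>. integral {0..\<tau>} (\<lambda>s. dderiv u (dderiv v f) (z + s *\<^sub>R v))) has_vector_derivative dderiv u (dderiv v f) (z + 0 *\<^sub>R v)) (at 0 within {0..a})"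
      by (rule integral_has_vector_derivative[OF cont1[OF smooth_on_continuous[OF smooth_on_dderiv[OF sv]] zr]]) (use pos in auto)
    then show ?thesis
      using has_vector_derivative_transform[of 0 "{0..a}"
        "\<lambda>\<tau>. dderiv u f (z + \<tau> *\<^sub>R v) - dderiv u f z"
        "\<lambda>\<tau>. integral {0..\<tau>} (\<lambda>s. dderiv u (dderiv v f) (z + s *\<^sub>R v))"] eq pos by auto
  qed
  ultimately show ?thesis
    using vector_derivative_unique_within_closed_interval[of 0 a 0] pos by (auto simp: cbox_interval)
qed

section \<open>Total differential equations\<close>

lemma smooth_on_dderiv_bilinear_family:
  fixes B :: "'e::euclidean_space \<Rightarrow> 'f::euclidean_space \<Rightarrow> 'g::euclidean_space \<Rightarrow> 'h::real_normed_vector"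
  assumes "open W" "\<And>y. y \<in> W \<Longrightarrow> bilinear (B y)" "\<And>u v. smooth_on W (\<lambda>y. B y u v)" "z \<in> W"
  shows "bilinear (\<lambda>u v. dderiv h (\<lambda>y. B y u v) z)"
  using bilinear_dderiv_family[OF assms(1,4), of B] assms smooth_on_differentiable by blast

lemma Ck_on_Suc_has_derivative:
  "Ck_on (Suc k) W h \<Longrightarrow> z \<in> W \<Longrightarrow> (h has_derivative (\<lambda>v. dderiv v h z)) (at z)"
  unfolding Ck_on_Suc by (rule dderiv_works) blast

text \<open>
  Picard iteration along the rays emanating from \<open>z0\<close>. Let \<open>Q n z v\<close> be the defect
  \<open>dP\<^sub>n(v) - A(v) P\<^sub>n\<close> of the iterate \<open>P\<^sub>n\<close>. By integrability, \<open>Q (n + 1)\<close> is an integral over the ray of terms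
  linear in \<open>Q n\<close>, up to the error \<open>A(v) (P\<^sub>n - P\<^bsub>n+1\<^esub>)\<close>. On a small ball it therefore tends to \<open>0\<close>
  uniformly, so that no regularity of the limit has to be known in advance.
\<close>

theorem total_differential_equation:
  fixes A :: "'e::euclidean_space \<Rightarrow> 'e \<Rightarrow> 'f::euclidean_space \<Rightarrow> 'f"
  assumes op: "open W" and z0: "z0 \<in> W"
    and bil: "\<And>z. z \<in> W \<Longrightarrow> bilinear (A z)"
    and sm: "\<And>v x. smooth_on W (\<lambda>z. A z v x)"
    and integrable: "\<And>z u v x. z \<in> W \<Longrightarrow>
      dderiv u (\<lambda>y. A y v x) z + A z v (A z u x) = dderiv v (\<lambda>y. A y u x) z + A z u (A z v x)"
  obtains r where "r > 0" "ball z0 r \<subseteq> W"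
    "\<And>p0. \<exists>p. p z0 = p0 \<and> smooth_on (ball z0 r) p \<and>
       (\<forall>z\<in>ball z0 r. (p has_derivative (\<lambda>v. A z v (p z))) (at z))"
proof -
  obtain r0 where r0: "r0 > 0" "cball z0 r0 \<subseteq> W" using op z0 open_contains_cball by blast
  obtain C where C: "C \<ge> 0" "\<And>y u v. y \<in> cball z0 r0 \<Longrightarrow> norm (A y u v) \<le> C * norm u * norm v"
  proof (rule bilinear_family_bound[of "cball z0 r0" A])
    show "continuous_on (cball z0 r0) (\<lambda>y. A y u v)" for u v
      using smooth_on_continuous[OF sm] continuous_on_subset r0 by blast
  qed (use r0 bil that in auto)
  \<comment> \<open>One integration along a ray multiplies a bound by at most \<open>C * r\<close>,
    and the radius makes this at most 1/4. \<open>C + 1\<close> avoids division by zero.\<close>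
  define r where "r = min r0 (1 / (4 * (C + 1)))"
  define B where "B = ball z0 r"
  have r: "r > 0" "r \<le> r0" using r0 C by (auto simp: r_def)
  have Cr: "C * r \<le> 1 / 4"
  proof -
    have "C * r \<le> C * (1 / (4 * (C + 1)))" using C(1) by (intro mult_left_mono) (auto simp: r_def)
    also have "\<dots> \<le> 1 / 4" using C(1) by (simp add: field_simps)
    finally show ?thesis .
  qed
  have BW: "B \<subseteq> W" and opB: "open B" and cvB: "convex B" and z0B: "z0 \<in> B" using r r0 by (auto simp: B_def)
  have bilB: "bilinear (A z)" if "z \<in> B" for z using bil BW that by blast
  have linr: "linear (A z v)" and linl: "linear (\<lambda>v. A z v x)" if "z \<in> B" for z v x
    using bilB[OF that] by (auto simp: bilinear_def)
  have bnd: "norm (A y u v) \<le> C * norm u * norm v" if "y \<in> B" for y u v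
    using C(2)[of y] that r by (auto simp: B_def)
  have smB: "smooth_on B (\<lambda>z. A z v x)" for v x using smooth_on_subset[OF sm BW] .
  define dA where "dA w h u x = dderiv h (\<lambda>y. A y u x) w" for w h u x
  have bildA: "bilinear (dA w h)" if "w \<in> B" for w h
    using smooth_on_dderiv_bilinear_family[OF opB bilB smB that, of h] by (simp add: dA_def[abs_def])
  have smdA: "smooth_on B (\<lambda>w. dA w h u x)" for h u x
    using smooth_on_dderiv[OF smB] by (simp add: dA_def[abs_def] eta_contract_eq)
  have lindA: "linear (\<lambda>h. dA w h u x)" if "w \<in> B" for w u x
    using has_derivative_linear[OF smooth_on_has_derivative[OF smB that]] by (simp add: dA_def)
  have curl: "dA z u v x - dA z v u x = A z u (A z v x) - A z v (A z u x)" if "z \<in> B" for z u v x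
    using integrable[of z u v x] that BW by (auto simp: dA_def algebra_simps)
  define l where "l z t = z0 + t *\<^sub>R (z - z0)" for z and t :: real
  have lB: "l z t \<in> B" if "z \<in> B" "t \<in> {0..1}" for z t
  proof -
    have "l z t = (1 - t) *\<^sub>R z0 + t *\<^sub>R z" by (simp add: l_def algebra_simps)
    then show ?thesis using convexD_alt[OF cvB z0B that(1), of t] that(2) by simp
  qed
  have dl: "((\<lambda>z. l z t) has_derivative (\<lambda>h. t *\<^sub>R h)) (at z within T)" for z t T
    unfolding l_def by (auto intro!: derivative_eq_intros)
  have dlt: "(l z has_derivative (\<lambda>s. s *\<^sub>R (z - z0))) (at t within T)" for z t T
    unfolding l_def by (auto intro!: derivative_eq_intros)
  have l1: "l z 1 = z" for z by (simp add: l_def)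
  have cl: "continuous_on (B \<times> {0..1}) (\<lambda>(x, t). l x t)" "continuous_on {0..1} (l z)" for z
    unfolding l_def case_prod_unfold by (auto intro!: continuous_intros)
  have nz: "norm (z - z0) \<le> r" if "z \<in> B" for z
    using that by (simp add: B_def dist_norm norm_minus_commute)

  have ex: "\<exists>p. p z0 = p0 \<and> smooth_on B p \<and> (\<forall>z\<in>B. (p has_derivative (\<lambda>v. A z v (p z))) (at z))" for p0
  proof -
    define P where "P = rec_nat (\<lambda>_. p0) (\<lambda>_ q z. p0 + integral {0..1} (\<lambda>t. A (l z t) (z - z0) (q (l z t))))"
    have P0: "P 0 = (\<lambda>_. p0)" and PS: "P (Suc n) = (\<lambda>z. p0 + integral {0..1} (\<lambda>t. A (l z t) (z - z0) (P n (l z t))))" for n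
      by (simp_all add: P_def)
    \<comment> \<open>The derivative at \<open>x\<close> in direction \<open>v\<close> of the
      integrand that defines \<open>P (Suc n)\<close>. The factors \<open>t\<close> come from
      differentiating the point \<open>l x t\<close> of the ray.\<close>
    define F where "F n x t v = t *\<^sub>R dA (l x t) v (x - z0) (P n (l x t)) + A (l x t) v (P n (l x t))
         + A (l x t) (x - z0) (t *\<^sub>R dderiv v (P n) (l x t))" for n x t v
    have cont2: "continuous_on (B \<times> {0..1}) (\<lambda>(x, t). g (l x t))" if "continuous_on B g" for g :: "'e \<Rightarrow> 'f"
      unfolding case_prod_unfold
      by (rule continuous_on_compose2[OF that cl(1)[unfolded case_prod_unfold]]) (auto intro: lB)
    have cont1: "continuous_on {0..1} (\<lambda>t. g (l x t))" if "continuous_on B g" "x \<in> B" for g :: "'e \<Rightarrow> 'f" and x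
      by (rule continuous_on_compose2[OF that(1) cl(2)]) (use that in \<open>auto intro: lB\<close>)
    have contbil: "continuous_on {0..1} (\<lambda>t. G (l x t) (X t) (Y t))"
      if "x \<in> B" "\<And>w. w \<in> B \<Longrightarrow> bilinear (G w)" "\<And>u v. smooth_on B (\<lambda>w. G w u v)"
        "continuous_on {0..1} X" "continuous_on {0..1} Y" for G :: "'e \<Rightarrow> 'e \<Rightarrow> 'f \<Rightarrow> 'f" and X Y x
      by (rule continuous_on_bilinear_family[of _ "\<lambda>t. G (l x t)"])
         (use that lB cont1[OF smooth_on_continuous[OF that(3)]] in auto)
    have contbil2: "continuous_on (B \<times> {0..1}) (\<lambda>s. G (l (fst s) (snd s)) (X s) (Y s))"
      if "\<And>w. w \<in> B \<Longrightarrow> bilinear (G w)" "\<And>u v. smooth_on B (\<lambda>w. G w u v)"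
        "continuous_on (B \<times> {0..1}) X" "continuous_on (B \<times> {0..1}) Y" for G :: "'e \<Rightarrow> 'e \<Rightarrow> 'f \<Rightarrow> 'f" and X Y
      by (rule continuous_on_bilinear_family[of _ "\<lambda>s. G (l (fst s) (snd s))"])
         (use that lB cont2[OF smooth_on_continuous[OF that(2)], unfolded case_prod_unfold] in auto)
    note cA1 = contbil[where G = A, OF _ bilB smB] and cA2 = contbil2[where G = A, OF bilB smB]
      and cdA1 = contbil[where G = "\<lambda>w. dA w v" for v, OF _ bildA smdA]
      and cdA2 = contbil2[where G = "\<lambda>w. dA w v" for v, OF bildA smdA]
    have cz1: "continuous_on {0..1} (\<lambda>t::real. z - z0)" and cv1: "continuous_on {0..1} (\<lambda>t::real. v)"
      and ct1: "continuous_on {0..1} (\<lambda>t::real. t)" for z v :: 'e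
      by (auto intro!: continuous_intros)
    have cz2: "continuous_on (B \<times> {0..1}) (\<lambda>s. fst s - z0)" and cv2: "continuous_on (B \<times> {0..1}) (\<lambda>s. v)"
      and ct2: "continuous_on (B \<times> {0..1}) (\<lambda>s. snd s)" for v :: 'e
      by (auto intro!: continuous_intros)
    \<comment> \<open>The iteration preserves this class: continuous first derivatives of
      \<open>P n\<close> make \<open>F n\<close> continuous, which both permits differentiation
      under the integral and makes the resulting derivative continuous.\<close>
    have C1: "Ck_on (Suc 0) B (P n)"
      and dP: "\<And>z. z \<in> B \<Longrightarrow> (P (Suc n) has_derivative (\<lambda>v. integral {0..1} (\<lambda>t. F n z t v))) (at z)" for n
    proof -
      have step: "(P (Suc n) has_derivative (\<lambda>v. integral {0..1} (\<lambda>t. F n z t v))) (at z)"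
        "continuous_on (B \<times> {0..1}) (\<lambda>(x, t). F n x t v)"
        if c1: "Ck_on (Suc 0) B (P n)" and z: "z \<in> B" for n z v
      proof -
        have cP: "continuous_on B (P n)" using Ck_on_SucD[OF c1] by simp
        have cdP: "continuous_on B (dderiv v (P n))" for v using c1 unfolding Ck_on_Suc Ck_on.simps(1) by blast
        have dPn: "(P n has_derivative (\<lambda>v. dderiv v (P n) w)) (at w)" if "w \<in> B" for w
          using Ck_on_Suc_has_derivative[OF c1 that] .
        have contF: "continuous_on (B \<times> {0..1}) (\<lambda>(x, t). F n x t v)" for v
          unfolding F_def case_prod_unfold
          by (intro continuous_on_add continuous_on_scaleR cA2 cdA2 cz2 cv2 ct2
              cont2[OF cP, unfolded case_prod_unfold] cont2[OF cdP, unfolded case_prod_unfold])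
        show "continuous_on (B \<times> {0..1}) (\<lambda>(x, t). F n x t v)" by (rule contF)
        have "((\<lambda>x. integral {0..1} (\<lambda>t. A (l x t) (x - z0) (P n (l x t)))) has_derivative
            (\<lambda>v. integral {0..1} (\<lambda>t. F n z t v))) (at z)"
        proof (rule has_derivative_integral_parameter[OF cvB opB z _ contF])
          show "continuous_on {0..1} (\<lambda>t. A (l x t) (x - z0) (P n (l x t)))" if "x \<in> B" for x
            by (intro cA1 that cz1 cont1[OF cP])
          fix x t assume x: "x \<in> B" and t: "t \<in> {0..1::real}"
          define N where "N = (\<lambda>x. l x t) -` B"
          have opN: "open N" unfolding N_def
            by (rule open_vimage[OF opB]) (auto simp: l_def intro!: continuous_intros)
          have xN: "x \<in> N" using lB[OF x t] by (simp add: N_def)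
          have d1: "((\<lambda>y. A (l y t) u v) has_derivative (\<lambda>h. t *\<^sub>R dA (l x t) h u v)) (at x)" for u v
          proof -
            have "((\<lambda>y. A (l y t) u v) has_derivative (\<lambda>h. dA (l x t) (t *\<^sub>R h) u v)) (at x)"
              unfolding dA_def by (rule has_derivative_compose[OF dl smooth_on_has_derivative[OF smB lB[OF x t]]])
            then show ?thesis by (simp add: linear_scale[OF lindA[OF lB[OF x t]]])
          qed
          have d2: "((\<lambda>y. P n (l y t)) has_derivative (\<lambda>h. t *\<^sub>R dderiv h (P n) (l x t))) (at x)"
          proof -
            have "((\<lambda>y. P n (l y t)) has_derivative (\<lambda>h. dderiv (t *\<^sub>R h) (P n) (l x t))) (at x)"
              by (rule has_derivative_compose[OF dl dPn[OF lB[OF x t]]])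
            then show ?thesis by (simp add: linear_scale[OF has_derivative_linear[OF dPn[OF lB[OF x t]]]])
          qed
          have d3: "((\<lambda>y. y - z0) has_derivative (\<lambda>h. h)) (at x)" by (auto intro!: derivative_eq_intros)
          have "((\<lambda>y. A (l y t) (y - z0) (P n (l y t))) has_derivative (\<lambda>h.
             dderiv h (\<lambda>y. A (l y t) (x - z0) (P n (l x t))) x + A (l x t) h (P n (l x t))
                + A (l x t) (x - z0) (t *\<^sub>R dderiv h (P n) (l x t)))) (at x)"
          proof (rule has_derivative_bilinear_family[OF opN xN _ _ d3 d2])
            show "bilinear (A (l y t))" if "y \<in> N" for y using that bilB by (simp add: N_def)
            show "(\<lambda>y. A (l y t) u v) differentiable at x" for u v using d1 unfolding differentiable_def by blast
          qed
          then show "((\<lambda>x. A (l x t) (x - z0) (P n (l x t))) has_derivative F n x t) (at x)"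
            by (simp add: dderiv_eq[OF d1] F_def[abs_def])
        qed
        then show "(P (Suc n) has_derivative (\<lambda>v. integral {0..1} (\<lambda>t. F n z t v))) (at z)"
          unfolding PS using has_derivative_add[OF has_derivative_const[of p0]] by force
      qed
      have C1: "Ck_on (Suc 0) B (P n)" for n
      proof (induction n)
        case 0
        show ?case unfolding P0 by (rule Ck_on_const)
      next
        case (Suc n)
        have "continuous_on B (dderiv v (P (Suc n)))" for v
        proof -
          have "continuous_on B (\<lambda>z. integral (cbox 0 1) (\<lambda>t. F n z t v))"
            by (rule integral_continuous_on_param) (use step(2)[OF Suc z0B, of v] in \<open>simp add: cbox_interval\<close>)
          then show ?thesis
            by (rule continuous_on_eq) (simp add: dderiv_eq[OF step(1)[OF Suc]] cbox_interval)
        qed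
        then show ?case using step(1)[OF Suc] unfolding Ck_on_Suc differentiable_def Ck_on.simps(1) by blast
      qed
      then show "Ck_on (Suc 0) B (P n)" .
      show "\<And>z. z \<in> B \<Longrightarrow> (P (Suc n) has_derivative (\<lambda>v. integral {0..1} (\<lambda>t. F n z t v))) (at z)"
        by (rule step(1)[OF C1])
    qed
    have cP: "continuous_on B (P n)" for n using Ck_on_SucD[OF C1] by simp
    have cdP: "continuous_on B (dderiv v (P n))" for n v using C1[of n] unfolding Ck_on_Suc Ck_on.simps(1) by blast
    have dPn: "(P n has_derivative (\<lambda>v. dderiv v (P n) w)) (at w)" if "w \<in> B" for n w
      using Ck_on_Suc_has_derivative[OF C1 that] .
    have cbil: "continuous_on {0..1} (\<lambda>t. A (l z t) (z - z0) (P n (l z t)))" if "z \<in> B" for n z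
      by (intro cA1 that cz1 cont1[OF cP])
    define K where "K = norm p0"
    have K: "K \<ge> 0" by (simp add: K_def)
    have diffP: "norm (P (Suc n) z - P n z) \<le> K * (1/4) ^ n" if "z \<in> B" for n z
      using that
    proof (induction n arbitrary: z)
      case 0
      have "norm (A (l z t) (z - z0) p0) \<le> K" if t: "t \<in> {0..1}" for t
      proof -
        have "norm (A (l z t) (z - z0) p0) \<le> C * norm (z - z0) * K"
          using bnd[OF lB[OF 0 t]] by (simp add: K_def)
        also have "\<dots> \<le> C * r * K" using nz[OF 0] C(1) K by (intro mult_right_mono mult_left_mono)
        also have "\<dots> \<le> 1 / 4 * K" using Cr K by (intro mult_right_mono)
        finally show ?thesis using K by simp
      qed
      then show ?case
        using integral_bound[of 0 1 "\<lambda>t. A (l z t) (z - z0) p0" K] cbil[OF 0, of 0] by (simp add: PS P0)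
    next
      case (Suc n)
      have eq: "P (Suc (Suc n)) z - P (Suc n) z
          = integral {0..1} (\<lambda>t. A (l z t) (z - z0) (P (Suc n) (l z t) - P n (l z t)))"
      proof -
        have "integral {0..1} (\<lambda>t. A (l z t) (z - z0) (P (Suc n) (l z t) - P n (l z t)))
          = integral {0..1} (\<lambda>t. A (l z t) (z - z0) (P (Suc n) (l z t)) - A (l z t) (z - z0) (P n (l z t)))"
          by (intro integral_cong) (simp add: linear_diff[OF linr[OF lB[OF Suc.prems]]])
        also have "\<dots> = integral {0..1} (\<lambda>t. A (l z t) (z - z0) (P (Suc n) (l z t))) - integral {0..1} (\<lambda>t. A (l z t) (z - z0) (P n (l z t)))"
          by (intro integral_diff integrable_continuous_real cA1 cz1 cont1[OF cP] Suc.prems)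
        finally show ?thesis by (simp only: PS[of "Suc n"] PS[of n]) simp
      qed
      have "norm (A (l z t) (z - z0) (P (Suc n) (l z t) - P n (l z t))) \<le> K * (1/4) ^ Suc n" if t: "t \<in> {0..1}" for t
      proof -
        have "norm (A (l z t) (z - z0) (P (Suc n) (l z t) - P n (l z t)))
          \<le> C * norm (z - z0) * norm (P (Suc n) (l z t) - P n (l z t))" using bnd[OF lB[OF Suc.prems t]] .
        also have "\<dots> \<le> (C * r) * (K * (1/4) ^ n)"
          using nz[OF Suc.prems] C(1) r Suc.IH[OF lB[OF Suc.prems t]] by (intro mult_mono) auto
        also have "\<dots> \<le> 1 / 4 * (K * (1/4) ^ n)" using Cr K by (intro mult_right_mono) auto
        finally show ?thesis by simp
      qed
      moreover have "continuous_on {0..1} (\<lambda>t. A (l z t) (z - z0) (P (Suc n) (l z t) - P n (l z t)))"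
        by (intro cA1 Suc.prems cz1 continuous_on_diff cont1[OF cP])
      ultimately have "norm (P (Suc (Suc n)) z - P (Suc n) z) \<le> K * (1/4) ^ Suc n * (1 - 0)"
        unfolding eq by (intro integral_bound) simp_all
      then show ?case by simp
    qed
    define Q where "Q n z v = dderiv v (P n) z - A z v (P n z)" for n z v
    have cQ: "continuous_on {0..1} (\<lambda>t. Q n (l z t) v)" if "z \<in> B" for n z v
      unfolding Q_def by (intro continuous_on_diff cont1[OF cdP] cA1 that cv1 cont1[OF cP])
    have QS: "Q (Suc n) z v = integral {0..1} (\<lambda>t. t *\<^sub>R (A (l z t) (z - z0) (Q n (l z t) v) - A (l z t) v (Q n (l z t) (z - z0))))
       + A z v (P n z - P (Suc n) z)" if z: "z \<in> B" for n z v
    proof -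
      \<comment> \<open>\<open>G\<close> is the \<open>t\<close>-derivative of
        \<open>t *\<^sub>R A (l z t) v (P n (l z t))\<close> and so integrates to
        \<open>A z v (P n z)\<close>. In \<open>F n z t v - G t\<close> the derivatives of
        \<open>A\<close> occur only antisymmetrised; \<open>curl\<close> replaces them by products
        of two \<open>A\<close>, and these complete the derivatives of \<open>P n\<close> to the
        defects \<open>Q n\<close>.\<close>
      define G where "G t = A (l z t) v (P n (l z t)) + t *\<^sub>R (dA (l z t) (z - z0) v (P n (l z t))
          + A (l z t) v (dderiv (z - z0) (P n) (l z t)))" for t
      have dG: "((\<lambda>t. t *\<^sub>R A (l z t) v (P n (l z t))) has_vector_derivative G t) (at t within {0..1})" if t: "t \<in> {0..1}" for t
      proof -
        have d0: "((\<lambda>y. A y v (P n y)) has_derivative (\<lambda>h. dA (l z t) h v (P n (l z t)) + A (l z t) v (dderiv h (P n) (l z t)))) (at (l z t))"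
          unfolding dA_def
          by (rule has_derivative_linear_family[OF opB lB[OF z t] linr _ dPn[OF lB[OF z t]]])
             (use smooth_on_differentiable[OF smB lB[OF z t]] in auto)
        have "((\<lambda>t. A (l z t) v (P n (l z t))) has_derivative
          (\<lambda>s. dA (l z t) (s *\<^sub>R (z - z0)) v (P n (l z t)) + A (l z t) v (dderiv (s *\<^sub>R (z - z0)) (P n) (l z t)))) (at t within {0..1})"
          by (rule has_derivative_compose[OF dlt d0])
        then have "((\<lambda>t. A (l z t) v (P n (l z t))) has_vector_derivative
          (dA (l z t) (z - z0) v (P n (l z t)) + A (l z t) v (dderiv (z - z0) (P n) (l z t)))) (at t within {0..1})"
          by (simp add: has_vector_derivative_def linear_scale[OF lindA[OF lB[OF z t]]] linear_scale[OF linr[OF lB[OF z t]]]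
              linear_scale[OF has_derivative_linear[OF dPn[OF lB[OF z t]]]] scaleR_add_right)
        from has_vector_derivative_scaleR[OF _ this, of "\<lambda>t. t" 1] show ?thesis
          unfolding G_def by (simp add: add.commute)
      qed
      have "(G has_integral (1 *\<^sub>R A (l z 1) v (P n (l z 1)) - 0 *\<^sub>R A (l z 0) v (P n (l z 0)))) {0..1}"
        by (rule fundamental_theorem_of_calculus) (use dG in auto)
      then have iG: "(G has_integral A z v (P n z)) {0..1}" by (simp add: l1)
      have "continuous_on {0..1} (\<lambda>t. F n z t v)"
        unfolding F_def
        by (intro continuous_on_add continuous_on_scaleR cA1 cdA1 z cz1 cv1 ct1 cont1[OF cP] cont1[OF cdP])
      then have iF: "((\<lambda>t. F n z t v) has_integral dderiv v (P (Suc n)) z) {0..1}"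
        unfolding dderiv_eq[OF dP[OF z, of n]] by (rule integrable_integral[OF integrable_continuous_real])
      have "((\<lambda>t. F n z t v - G t) has_integral (dderiv v (P (Suc n)) z - A z v (P n z))) {0..1}"
        by (rule has_integral_diff[OF iF iG])
      moreover have "F n z t v - G t = t *\<^sub>R (A (l z t) (z - z0) (Q n (l z t) v) - A (l z t) v (Q n (l z t) (z - z0)))"
        if t: "t \<in> {0..1}" for t
      proof -
        have "F n z t v - G t = t *\<^sub>R ((dA (l z t) v (z - z0) (P n (l z t)) - dA (l z t) (z - z0) v (P n (l z t)))
            + (A (l z t) (z - z0) (dderiv v (P n) (l z t)) - A (l z t) v (dderiv (z - z0) (P n) (l z t))))"
          by (simp add: F_def G_def linear_scale[OF linr[OF lB[OF z t]]] scaleR_add_right scaleR_diff_right)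
        also have "\<dots> = t *\<^sub>R (A (l z t) (z - z0) (Q n (l z t) v) - A (l z t) v (Q n (l z t) (z - z0)))"
          by (simp add: curl[OF lB[OF z t]] Q_def linear_diff[OF linr[OF lB[OF z t]]])
        finally show ?thesis .
      qed
      ultimately have "((\<lambda>t. t *\<^sub>R (A (l z t) (z - z0) (Q n (l z t) v) - A (l z t) v (Q n (l z t) (z - z0))))
          has_integral (dderiv v (P (Suc n)) z - A z v (P n z))) {0..1}"
        by (rule has_integral_eq[rotated]) simp
      then show ?thesis by (simp add: integral_unique Q_def linear_diff[OF linr[OF z]])
    qed
    \<comment> \<open>Calibrated for the next induction: each of the two ray terms contributes 1/4
      of the old bound. The error term is at most \<open>C * K * (3/4) ^ n * norm v\<close>, which
      is another 1/4 of it by this choice. The rate is therefore 3/4.\<close>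
    define L where "L = 4 * C * K"
    have L: "L \<ge> 0" using C(1) K by (simp add: L_def)
    have Qbound: "norm (Q n z v) \<le> L * (3/4) ^ n * norm v" if "z \<in> B" for n z v
      using that
    proof (induction n arbitrary: z v)
      case 0
      have "dderiv v (P 0) z = 0" unfolding P0 by (rule dderiv_eq) auto
      then have "norm (Q 0 z v) \<le> C * norm v * K" using bnd[OF 0, of v p0] by (simp add: Q_def P0 K_def)
      also have "\<dots> \<le> L * norm v" using C(1) K by (simp add: L_def)
      finally show ?case by simp
    next
      case (Suc n)
      have "norm (t *\<^sub>R (A (l z t) (z - z0) (Q n (l z t) v) - A (l z t) v (Q n (l z t) (z - z0)))) \<le> L * (3/4) ^ n * norm v / 2"
        if t: "t \<in> {0..1}" for t
      proof -
        have 1: "norm (A (l z t) (z - z0) (Q n (l z t) v)) \<le> (C * r) * (L * (3/4) ^ n * norm v)"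
        proof -
          have "norm (A (l z t) (z - z0) (Q n (l z t) v)) \<le> C * norm (z - z0) * norm (Q n (l z t) v)"
            using bnd[OF lB[OF Suc.prems t]] .
          also have "\<dots> \<le> (C * r) * (L * (3/4) ^ n * norm v)"
            using Suc.IH[OF lB[OF Suc.prems t]] nz[OF Suc.prems] C(1) r by (intro mult_mono) auto
          finally show ?thesis .
        qed
        have 2: "norm (A (l z t) v (Q n (l z t) (z - z0))) \<le> (C * r) * (L * (3/4) ^ n * norm v)"
        proof -
          have "norm (A (l z t) v (Q n (l z t) (z - z0))) \<le> C * norm v * norm (Q n (l z t) (z - z0))"
            using bnd[OF lB[OF Suc.prems t]] .
          also have "\<dots> \<le> C * norm v * (L * (3/4) ^ n * r)"
            using order_trans[OF Suc.IH[OF lB[OF Suc.prems t], of "z - z0"] mult_left_mono[OF nz[OF Suc.prems], of "L * (3/4) ^ n"]] C(1) L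
            by (intro mult_left_mono) auto
          finally show ?thesis by (simp add: mult_ac)
        qed
        have 3: "(C * r) * (L * (3/4) ^ n * norm v) \<le> 1 / 4 * (L * (3/4) ^ n * norm v)"
          using Cr L by (intro mult_right_mono) auto
        have "norm (t *\<^sub>R (A (l z t) (z - z0) (Q n (l z t) v) - A (l z t) v (Q n (l z t) (z - z0))))
          \<le> 1 * norm (A (l z t) (z - z0) (Q n (l z t) v) - A (l z t) v (Q n (l z t) (z - z0)))"
          using t by (simp only: norm_scaleR) (intro mult_right_mono, auto)
        also have "\<dots> \<le> norm (A (l z t) (z - z0) (Q n (l z t) v)) + norm (A (l z t) v (Q n (l z t) (z - z0)))"
          using norm_triangle_ineq4 by simp
        finally show ?thesis using 1 2 3 by simp
      qed
      then have "norm (integral {0..1} (\<lambda>t. t *\<^sub>R (A (l z t) (z - z0) (Q n (l z t) v) - A (l z t) v (Q n (l z t) (z - z0)))))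
          \<le> L * (3/4) ^ n * norm v / 2 * (1 - 0)"
        by (intro integral_bound) (auto intro!: continuous_on_scaleR continuous_on_diff cA1 Suc.prems cz1 cv1 ct1 cQ)
      moreover have "norm (A z v (P n z - P (Suc n) z)) \<le> L * (3/4) ^ n * norm v / 4"
      proof -
        have "norm (A z v (P n z - P (Suc n) z)) \<le> C * norm v * norm (P (Suc n) z - P n z)"
          using bnd[OF Suc.prems] by (simp add: norm_minus_commute)
        also have "\<dots> \<le> C * norm v * (K * (3/4) ^ n)"
          using diffP[OF Suc.prems, of n] mult_left_mono[OF power_mono[of "1/4" "3/4::real" n] K] C(1)
          by (intro mult_left_mono) auto
        finally show ?thesis by (simp add: L_def mult_ac)
      qed
      ultimately show ?case unfolding QS[OF Suc.prems]
        by (intro norm_triangle_le) (simp add: field_simps)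
    qed
    \<comment> \<open>The geometric sum is bounded by a difference, so that adding one more
      increment keeps its form.\<close>
    have tail: "norm (P (n + k) z - P n z) \<le> 2 * K * (1/4) ^ n - 2 * K * (1/4) ^ (n + k)" if "z \<in> B" for n k z
    proof (induction k)
      case (Suc k)
      have "norm (P (n + Suc k) z - P n z) \<le> norm (P (Suc (n + k)) z - P (n + k) z) + norm (P (n + k) z - P n z)"
        using norm_triangle_ineq[of "P (Suc (n + k)) z - P (n + k) z" "P (n + k) z - P n z"] by simp
      also have "\<dots> \<le> K * (1/4) ^ (n + k) + (2 * K * (1/4) ^ n - 2 * K * (1/4) ^ (n + k))"
        using Suc diffP[OF that, of "n + k"] by linarith
      also have "\<dots> \<le> 2 * K * (1/4) ^ n - 2 * K * (1/4) ^ (n + Suc k)" using K by simp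
      finally show ?case .
    qed simp
    have tail': "norm (P m z - P n z) \<le> 2 * K * (1/4) ^ n" if "z \<in> B" "n \<le> m" for n m z
      using tail[OF that(1), of n "m - n"] that(2) K zero_le_power[of "1/4::real" m]
      by (auto intro: order_trans)
    have geo: "(\<lambda>n. 2 * K * (1/4) ^ n) \<longlonglongrightarrow> 0"
      using tendsto_mult_right_zero[OF LIMSEQ_realpow_zero[of "1/4"]] by simp
    have "convergent (\<lambda>n. P n z)" if z: "z \<in> B" for z
    proof (rule Cauchy_convergent, rule CauchyI)
      fix e :: real assume "e > 0"
      then obtain n where n: "2 * K * (1/4) ^ n < e / 2"
        using order_tendstoD(2)[OF geo, of "e / 2"] eventually_happens[of _ sequentially] by fastforce
      have "norm (P m z - P m' z) < e" if "m \<ge> n" "m' \<ge> n" for m m'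
      proof -
        have "norm (P m z - P m' z) \<le> norm (P m z - P n z) + norm (P m' z - P n z)"
          using norm_triangle_ineq4[of "P m z - P n z" "P m' z - P n z"] by simp
        then show ?thesis using tail'[OF z that(1)] tail'[OF z that(2)] n by linarith
      qed
      then show "\<exists>M. \<forall>m\<ge>M. \<forall>n\<ge>M. norm (P m z - P n z) < e" by blast
    qed
    then have "\<exists>p. \<forall>z\<in>B. (\<lambda>n. P n z) \<longlonglongrightarrow> p z" unfolding convergent_def by metis
    then obtain p where p: "\<And>z. z \<in> B \<Longrightarrow> (\<lambda>n. P n z) \<longlonglongrightarrow> p z" by blast
    have Pp: "norm (P n z - p z) \<le> 2 * K * (1/4) ^ n" if z: "z \<in> B" for n z
    proof -
      have "(\<lambda>m. norm (P m z - P n z)) \<longlonglongrightarrow> norm (p z - P n z)" by (intro tendsto_intros p z)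
      moreover have "\<forall>\<^sub>F m in sequentially. norm (P m z - P n z) \<le> 2 * K * (1/4) ^ n"
        using tail'[OF z] eventually_sequentially by blast
      ultimately have "norm (p z - P n z) \<le> 2 * K * (1/4) ^ n"
        by (intro tendsto_upperbound[OF _ _ sequentially_bot])
      then show ?thesis by (simp add: norm_minus_commute)
    qed
    \<comment> \<open>The derivatives of the iterates are \<open>Q n x h + A x h (P n x)\<close>. By
      the two geometric bounds they tend to \<open>A x h (p x)\<close> uniformly in
      \<open>x\<close>, relative to \<open>norm h\<close>, so differentiability of the limit comes
      out of the convergence.\<close>
    have "\<exists>g. \<forall>x\<in>B. (\<lambda>n. P n x) \<longlonglongrightarrow> g x \<and> (g has_derivative (\<lambda>h. A x h (p x))) (at x within B)"
    proof (rule has_derivative_sequence[where f = P, OF cvB _ _ z0B p[OF z0B]])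
      show "(P n has_derivative (\<lambda>v. dderiv v (P n) x)) (at x within B)" if "x \<in> B" for n x
        using dPn[OF that] by (rule has_derivative_at_withinI)
    next
      fix e :: real assume e: "e > 0"
      have "(\<lambda>n. L * (3/4) ^ n + C * (2 * K * (1/4) ^ n)) \<longlonglongrightarrow> 0"
        using tendsto_add[OF tendsto_mult_right_zero[OF LIMSEQ_realpow_zero[of "3/4"], of L] tendsto_mult_right_zero[OF geo, of C]] by simp
      then have ev: "\<forall>\<^sub>F n in sequentially. L * (3/4) ^ n + C * (2 * K * (1/4) ^ n) < e"
        using order_tendstoD(2) e by blast
      show "\<forall>\<^sub>F n in sequentially. \<forall>x\<in>B. \<forall>h. norm (dderiv h (P n) x - A x h (p x)) \<le> e * norm h"
        using ev
      proof (eventually_elim, intro ballI allI)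
        fix n x h assume n: "L * (3/4) ^ n + C * (2 * K * (1/4) ^ n) < e" and x: "x \<in> B"
        have "dderiv h (P n) x - A x h (p x) = Q n x h + A x h (P n x - p x)"
          by (simp add: Q_def linear_diff[OF linr[OF x]])
        also have "norm \<dots> \<le> L * (3/4) ^ n * norm h + C * norm h * (2 * K * (1/4) ^ n)"
          using Qbound[OF x, of n h] bnd[OF x, of h "P n x - p x"] mult_left_mono[OF Pp[OF x, of n], of "C * norm h"] C(1)
          by (intro norm_triangle_le add_mono) auto
        also have "\<dots> = (L * (3/4) ^ n + C * (2 * K * (1/4) ^ n)) * norm h" by (simp add: algebra_simps)
        also have "\<dots> \<le> e * norm h" using n by (intro mult_right_mono) auto
        finally show "norm (dderiv h (P n) x - A x h (p x)) \<le> e * norm h" .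
      qed
    qed
    then obtain g where g: "\<And>x. x \<in> B \<Longrightarrow> (\<lambda>n. P n x) \<longlonglongrightarrow> g x"
      "\<And>x. x \<in> B \<Longrightarrow> (g has_derivative (\<lambda>h. A x h (p x))) (at x within B)" by blast
    have gp: "g x = p x" if "x \<in> B" for x using LIMSEQ_unique[OF g(1)[OF that] p[OF that]] .
    have dg: "(g has_derivative (\<lambda>h. A x h (g x))) (at x)" if "x \<in> B" for x
      using g(2)[OF that] gp[OF that] at_within_open[OF that opB] by simp
    have "P n z0 = p0" for n
    proof (cases n)
      case (Suc m)
      have "integral {0..1} (\<lambda>t. A (l z0 t) (z0 - z0) (P m (l z0 t))) = integral {0..1} (\<lambda>t::real. 0)"
        by (intro integral_cong) (simp add: linear_0[OF linl[OF lB[OF z0B]]])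
      then show ?thesis unfolding Suc PS by simp
    qed (simp add: P0)
    then have "g z0 = p0" using g(1)[OF z0B] LIMSEQ_unique tendsto_const by fastforce
    moreover have "smooth_on B g"
    proof (rule smooth_on_bootstrap[OF opB dg])
      fix k v assume k: "Ck_on k B g"
      have "Ck_on k B (\<lambda>y. A y v u)" for u using smB[of v u] by (simp add: smooth_on_def)
      from Ck_on_linear_family[OF opB linr this k] show "Ck_on k B (\<lambda>z. A z v (g z))" .
    qed
    ultimately show ?thesis using dg by blast
  qed
  show ?thesis by (rule that[of r]) (use r BW ex in \<open>auto simp: B_def\<close>)
qed

text \<open>The inhomogeneous equation dh = w becomes homogeneous for pairs (h, c) with a real
  constant c: dh = c w, dc = 0. Products of two coefficient maps vanish, so integrability is exactly
  closedness of \<open>w\<close>. The solution starting at (0, 1) keeps c = 1.\<close>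

corollary poincare_lemma:
  fixes w :: "'e::euclidean_space \<Rightarrow> 'e \<Rightarrow> 'f::euclidean_space"
  assumes op: "open W" and z0: "z0 \<in> W"
    and lin: "\<And>z. z \<in> W \<Longrightarrow> linear (w z)"
    and sm: "\<And>v. smooth_on W (\<lambda>z. w z v)"
    and closed: "\<And>z u v. z \<in> W \<Longrightarrow> dderiv u (\<lambda>y. w y v) z = dderiv v (\<lambda>y. w y u) z"
  obtains r h where "r > 0" "ball z0 r \<subseteq> W" "smooth_on (ball z0 r) h"
    "\<And>z. z \<in> ball z0 r \<Longrightarrow> (h has_derivative w z) (at z)"
proof -
  define A where "A z v x = (snd x *\<^sub>R w z v, 0 :: real)" for z v and x :: "'f \<times> real"
  have bl: "bounded_linear (\<lambda>h :: 'f. (c *\<^sub>R h, 0 :: real))" for c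
    by (intro bounded_linear_Pair bounded_linear_scaleR_right bounded_linear_zero)
  have d: "dderiv u (\<lambda>y. A y v x) z = (snd x *\<^sub>R dderiv u (\<lambda>y. w y v) z, 0)" if "z \<in> W" for u v x z
    unfolding A_def by (rule dderiv_eq) (rule bounded_linear.has_derivative[OF bl smooth_on_has_derivative[OF sm that]])
  obtain r where r: "r > 0" "ball z0 r \<subseteq> W"
    "\<And>p0. \<exists>p. p z0 = p0 \<and> smooth_on (ball z0 r) p \<and>
       (\<forall>z\<in>ball z0 r. (p has_derivative (\<lambda>v. A z v (p z))) (at z))"
  proof (rule total_differential_equation[OF op z0, of A])
    show "bilinear (A z)" if "z \<in> W" for z
      using lin[OF that] unfolding bilinear_def A_def
      by (auto intro!: linearI simp: linear_add linear_scale algebra_simps)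
    show "smooth_on W (\<lambda>z. A z v x)" for v x unfolding A_def by (rule smooth_on_linear[OF bl op sm])
    show "dderiv u (\<lambda>y. A y v x) z + A z v (A z u x) = dderiv v (\<lambda>y. A y u x) z + A z u (A z v x)"
      if "z \<in> W" for z u v x using closed[OF that, of u v] by (simp add: d[OF that]) (simp add: A_def)
  qed (use that in blast)
  obtain p where p: "p z0 = (0, 1)" "smooth_on (ball z0 r) p"
    "\<And>z. z \<in> ball z0 r \<Longrightarrow> (p has_derivative (\<lambda>v. A z v (p z))) (at z)" using r(3)[of "(0, 1)"] by blast
  have "((\<lambda>z. snd (p z)) has_derivative (\<lambda>v. 0)) (at z within ball z0 r)" if "z \<in> ball z0 r" for z
    using has_derivative_at_withinI[OF bounded_linear.has_derivative[OF bounded_linear_snd p(3)[OF that]]] by (simp add: A_def)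
  then obtain c where "\<And>z. z \<in> ball z0 r \<Longrightarrow> snd (p z) = c"
    using has_derivative_zero_constant[OF convex_ball] by blast
  then have c: "snd (p z) = 1" if "z \<in> ball z0 r" for z using that p(1) r(1) by (metis centre_in_ball snd_conv)
  show ?thesis
  proof (rule that[OF r(1,2)])
    show "smooth_on (ball z0 r) (\<lambda>z. fst (p z))" by (rule smooth_on_linear[OF bounded_linear_fst open_ball p(2)])
    show "((\<lambda>z. fst (p z)) has_derivative w z) (at z)" if "z \<in> ball z0 r" for z
      using bounded_linear.has_derivative[OF bounded_linear_fst p(3)[OF that]] c[OF that] by (simp add: A_def)
  qed
qed

section \<open>Holomorphic functions of several variables\<close>

lemma norm_vector_smult: "norm (a *s v) = norm a * norm (v :: complex ^ 'n::finite)"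
  by (simp add: norm_vec_def norm_mult L2_set_right_distrib)

lemma scaleR_eq_smult: "c *\<^sub>R v = complex_of_real c *s (v :: complex ^ 'n::finite)"
  by (simp add: vec_eq_iff) (simp add: scaleR_conv_of_real)

lemma bounded_linear_smult_left: "bounded_linear (\<lambda>a. a *s (v :: complex ^ 'n::finite))"
  by (rule bounded_linear_intro[of _ "norm v"])
    (auto simp: norm_vector_smult vec_eq_iff algebra_simps)

lemma holomorphic_several_has_derivative:
  assumes "holomorphic_several_on f M" "z \<in> M"
  shows "(f has_derivative (\<lambda>v. dderiv v f z)) (at z)"
  using assms unfolding holomorphic_several_on_def differentiable_def
  by (intro dderiv_works) (auto simp: differentiable_def)

lemma holomorphic_several_smult:
  assumes "holomorphic_several_on f M" "z \<in> M"
  shows "dderiv (a *s v) f z = a * dderiv v f z"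
  using assms unfolding holomorphic_several_on_def by (metis dderiv_eq)

lemma holomorphic_severalI:
  assumes "\<And>z. z \<in> M \<Longrightarrow> (f has_derivative f' z) (at z)" "\<And>z a v. z \<in> M \<Longrightarrow> f' z (a *s v) = a * f' z v"
  shows "holomorphic_several_on f M"
  using assms unfolding holomorphic_several_on_def by blast

lemma holomorphic_several_continuous: "holomorphic_several_on f M \<Longrightarrow> continuous_on M f"
  by (rule has_derivative_continuous_on) (rule has_derivative_at_withinI[OF holomorphic_several_has_derivative])

section \<open>Cauchy's formula on complex lines and regularity of holomorphic functions\<close>

lemma norm_circlepath_0: "0 \<le> \<rho> \<Longrightarrow> norm (circlepath 0 \<rho> t) = \<rho>"
  by (simp add: circlepath norm_mult)

text \<open>Cauchy's formula for the derivative of the one-variable function obtained by restricting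
  \<open>f\<close> to the complex line through \<open>z\<close> in direction \<open>v\<close>. On
  the circle about 0, du / (2 pi i u^2) equals dt / u, which leaves an integral over
  \<open>{0..1}\<close>.\<close>

lemma dderiv_Cauchy:
  assumes f: "holomorphic_several_on f M" and \<rho>: "\<rho> > 0"
    and sub: "\<And>\<zeta>. norm \<zeta> \<le> \<rho> \<Longrightarrow> z + \<zeta> *s v \<in> M"
  shows "dderiv v f z = integral {0..1} (\<lambda>t. f (z + circlepath 0 \<rho> t *s v) / circlepath 0 \<rho> t)"
proof -
  define h where "h \<zeta> = f (z + \<zeta> *s v)" for \<zeta>
  have line: "((\<lambda>\<zeta>. z + \<zeta> *s v) has_derivative (\<lambda>\<xi>. \<xi> *s v)) (at \<zeta>)" for \<zeta>
    using has_derivative_add[OF has_derivative_const bounded_linear.has_derivative[OF bounded_linear_smult_left has_derivative_ident]]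
    by auto
  have dh: "(h has_field_derivative dderiv v f (z + \<zeta> *s v)) (at \<zeta>)" if "z + \<zeta> *s v \<in> M" for \<zeta>
  proof -
    have "(h has_derivative (\<lambda>\<xi>. dderiv (\<xi> *s v) f (z + \<zeta> *s v))) (at \<zeta>)"
      unfolding h_def by (rule has_derivative_compose[OF line holomorphic_several_has_derivative[OF f that]])
    then show ?thesis
      by (simp add: holomorphic_several_smult[OF f that] has_field_derivative_def mult_commute_abs)
  qed
  have "h holomorphic_on cball 0 \<rho>"
    using dh sub has_field_derivative_at_within unfolding holomorphic_on_def field_differentiable_def by (metis mem_cball_0)
  then have cont: "continuous_on (cball 0 \<rho>) h" and hol: "h holomorphic_on ball 0 \<rho>"
    using holomorphic_on_imp_continuous_on holomorphic_on_subset ball_subset_cball by blast+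
  have "(h has_field_derivative (1 / (2 * of_real pi * \<i>) * contour_integral (circlepath 0 \<rho>) (\<lambda>u. h u / (u - 0)^2))) (at 0)"
    using Cauchy_derivative_integral_circlepath(2)[OF cont hol, of 0] \<rho> by simp
  moreover have "(h has_field_derivative dderiv v f z) (at 0)" using dh[of 0] sub[of 0] \<rho> by simp
  ultimately have "dderiv v f z = 1 / (2 * of_real pi * \<i>) * contour_integral (circlepath 0 \<rho>) (\<lambda>u. h u / (u - 0)^2)"
    using DERIV_unique by blast
  also have "\<dots> = integral {0..1} (\<lambda>t. 1 / (2 * of_real pi * \<i>) * (h (circlepath 0 \<rho> t) / (circlepath 0 \<rho> t - 0)\<^sup>2
      * vector_derivative (circlepath 0 \<rho>) (at t)))"
    by (simp only: contour_integral_integral integral_mult_right)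
  also have "\<dots> = integral {0..1} (\<lambda>t. f (z + circlepath 0 \<rho> t *s v) / circlepath 0 \<rho> t)"
  proof (rule integral_cong)
    fix t :: real
    have "circlepath 0 \<rho> t \<noteq> 0" using norm_circlepath_0[of \<rho> t] \<rho> by auto
    moreover have "vector_derivative (circlepath 0 \<rho>) (at t) = 2 * of_real pi * \<i> * circlepath 0 \<rho> t"
      unfolding vector_derivative_circlepath by (simp add: circlepath)
    ultimately show "1 / (2 * of_real pi * \<i>) * (h (circlepath 0 \<rho> t) / (circlepath 0 \<rho> t - 0)\<^sup>2
      * vector_derivative (circlepath 0 \<rho>) (at t)) = f (z + circlepath 0 \<rho> t *s v) / circlepath 0 \<rho> t"
      by (simp add: h_def power2_eq_square)
  qed
  finally show ?thesis .
qed

text \<open>The Cauchy integral first yields the continuity of the derivative, and then its holomorphy.\<close>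

lemma holomorphic_several_dderiv:
  assumes f: "holomorphic_several_on f M" and op: "open M"
  shows "holomorphic_several_on (dderiv v f) M"
proof -
  \<comment> \<open>One radius \<open>\<rho>\<close> has to serve all centres \<open>x\<close> near
    \<open>z\<close>, since the Cauchy integral will be differentiated in its centre.\<close>
  have loc: "\<exists>r \<rho>. r > 0 \<and> \<rho> > 0 \<and> (\<forall>x\<in>ball z r. \<forall>\<zeta>. norm \<zeta> \<le> \<rho> \<longrightarrow> x + \<zeta> *s w \<in> M)" if z: "z \<in> M" for z w
  proof -
    obtain e where e: "e > 0" "ball z e \<subseteq> M" using op z open_contains_ball by blast
    define \<rho> where "\<rho> = (e / 2) / (norm w + 1)"
    have "norm w + 1 > 0" by (simp add: add_nonneg_pos)
    then have \<rho>: "\<rho> > 0" "\<rho> * norm w \<le> e / 2" using e by (auto simp: \<rho>_def pos_divide_le_eq algebra_simps)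
    have "x + \<zeta> *s w \<in> M" if "x \<in> ball z (e/2)" "norm \<zeta> \<le> \<rho>" for x \<zeta>
    proof -
      have "norm (\<zeta> *s w) \<le> e / 2" unfolding norm_vector_smult
        using mult_right_mono[OF that(2), of "norm w"] \<rho> by simp
      moreover have "norm (z - (x + \<zeta> *s w)) \<le> norm (z - x) + norm (\<zeta> *s w)"
        using norm_triangle_ineq4[of "z - x" "\<zeta> *s w"] by (simp add: algebra_simps)
      ultimately have "x + \<zeta> *s w \<in> ball z e" using that(1) unfolding mem_ball dist_norm by linarith
      then show ?thesis using e by auto
    qed
    then show ?thesis using e \<rho>(1) by (intro exI[of _ "e/2"] exI[of _ \<rho>]) auto
  qed
  have comp: "continuous_on (ball z r \<times> {0..1}) (\<lambda>(x, t). g (x + circlepath 0 \<rho> t *s w) / circlepath 0 \<rho> t)"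
    if g: "continuous_on M g" and \<rho>: "\<rho> > 0" and sub: "\<forall>x\<in>ball z r. \<forall>\<zeta>. norm \<zeta> \<le> \<rho> \<longrightarrow> x + \<zeta> *s w \<in> M" for g z r \<rho> w
  proof -
    have cc: "continuous_on (ball z r \<times> {0..1}) (\<lambda>p. circlepath 0 \<rho> (snd p))"
      unfolding circlepath by (intro continuous_intros)
    have cs: "continuous_on (ball z r \<times> {0..1}) (\<lambda>p. circlepath 0 \<rho> (snd p) *s w)"
      by (rule bounded_linear.continuous_on[OF bounded_linear_smult_left cc])
    have "continuous_on (ball z r \<times> {0..1}) (\<lambda>p. g (fst p + circlepath 0 \<rho> (snd p) *s w))"
      by (rule continuous_on_compose2[OF g]) (use sub \<rho> norm_circlepath_0 in \<open>auto intro!: continuous_intros cs\<close>)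
    moreover have "circlepath 0 \<rho> t \<noteq> 0" for t using norm_circlepath_0[of \<rho> t] \<rho> by auto
    ultimately show ?thesis unfolding case_prod_unfold by (intro continuous_on_divide cc) auto
  qed
  \<comment> \<open>Needed for every direction: differentiating the Cauchy integral of
    \<open>dderiv v f\<close> puts \<open>dderiv h f\<close> under the integral sign.\<close>
  have cont: "continuous_on M (dderiv w f)" for w
  proof (rule continuous_at_imp_continuous_on, rule ballI)
    fix z assume "z \<in> M"
    then obtain r \<rho> where r: "r > 0" "\<rho> > 0" and sub: "\<forall>x\<in>ball z r. \<forall>\<zeta>. norm \<zeta> \<le> \<rho> \<longrightarrow> x + \<zeta> *s w \<in> M" using loc by blast
    have "continuous_on (ball z r) (\<lambda>x. integral (cbox 0 1) (\<lambda>t. f (x + circlepath 0 \<rho> t *s w) / circlepath 0 \<rho> t))"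
      by (rule integral_continuous_on_param)
         (use comp[OF holomorphic_several_continuous[OF f] r(2) sub] in \<open>simp add: cbox_interval\<close>)
    then have "continuous_on (ball z r) (dderiv w f)"
      by (rule continuous_on_eq) (use sub in \<open>auto simp: cbox_interval dderiv_Cauchy[OF f r(2)]\<close>)
    then show "isCont (dderiv w f) z" using r(1) by (simp add: continuous_on_eq_continuous_at)
  qed
  show ?thesis unfolding holomorphic_several_on_def
  proof
    fix z assume "z \<in> M"
    then obtain r \<rho> where r: "r > 0" "\<rho> > 0" and sub: "\<forall>x\<in>ball z r. \<forall>\<zeta>. norm \<zeta> \<le> \<rho> \<longrightarrow> x + \<zeta> *s v \<in> M" using loc by blast
    define D where "D h = integral {0..1} (\<lambda>t. dderiv h f (z + circlepath 0 \<rho> t *s v) / circlepath 0 \<rho> t)" for h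
    have inM: "x + circlepath 0 \<rho> t *s v \<in> M" if "x \<in> ball z r" for x t
      using sub that norm_circlepath_0[of \<rho> t] r by auto
    have "((\<lambda>x. integral {0..1} (\<lambda>t. f (x + circlepath 0 \<rho> t *s v) / circlepath 0 \<rho> t)) has_derivative D) (at z)"
      unfolding D_def
    proof (rule has_derivative_integral_parameter[of "ball z r"])
      fix x t assume x: "x \<in> ball z r"
      have sh: "((\<lambda>x. x + c) has_derivative (\<lambda>h. h)) (at x)" for c :: "complex ^ 'a" by (auto intro!: derivative_eq_intros)
      show "((\<lambda>x. f (x + circlepath 0 \<rho> t *s v) / circlepath 0 \<rho> t) has_derivative
          (\<lambda>h. dderiv h f (x + circlepath 0 \<rho> t *s v) / circlepath 0 \<rho> t)) (at x)"
        by (intro bounded_linear.has_derivative[OF bounded_linear_divide]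
            has_derivative_compose[OF sh holomorphic_several_has_derivative[OF f inM[OF x]]])
    next
      fix h
      show "continuous_on (ball z r \<times> {0..1}) (\<lambda>(x, t). dderiv h f (x + circlepath 0 \<rho> t *s v) / circlepath 0 \<rho> t)"
        by (rule comp[OF cont r(2) sub])
    next
      fix x assume "x \<in> ball z r"
      then show "continuous_on {0..1} (\<lambda>t. f (x + circlepath 0 \<rho> t *s v) / circlepath 0 \<rho> t)"
        using continuous_on_compose2[OF comp[OF holomorphic_several_continuous[OF f] r(2) sub], of "{0..1}" "\<lambda>t. (x, t)"]
        by (simp add: continuous_on_Pair image_subset_iff)
    qed (use r in auto)
    then have "(dderiv v f has_derivative D) (at z)"
      by (rule has_derivative_transform_within_open[OF _ open_ball[of z r]])
         (use sub r in \<open>auto simp: dderiv_Cauchy[OF f r(2)]\<close>)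
    moreover have "D (a *s h) = a * D h" for a h
    proof -
      have "D (a *s h) = integral {0..1} (\<lambda>t. a * (dderiv h f (z + circlepath 0 \<rho> t *s v) / circlepath 0 \<rho> t))"
        unfolding D_def using inM[of z] r by (intro integral_cong) (simp add: holomorphic_several_smult[OF f])
      also have "\<dots> = a * D h" unfolding D_def by (rule integral_mult_right)
      finally show ?thesis .
    qed
    ultimately show "\<exists>f'. (dderiv v f has_derivative f') (at z) \<and> (\<forall>a v. f' (a *s v) = a * f' v)" by blast
  qed
qed

lemma holomorphic_several_smooth:
  assumes "holomorphic_several_on f M" "open M"
  shows "smooth_on M f"
proof -
  have "holomorphic_several_on f M \<Longrightarrow> Ck_on k M f" for k f
  proof (induction k arbitrary: f)
    case 0
    then show ?case by (simp add: holomorphic_several_continuous)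
  next
    case (Suc k)
    then show ?case
      unfolding Ck_on_Suc differentiable_def
      using holomorphic_several_dderiv[OF _ assms(2)] holomorphic_several_has_derivative by blast
  qed
  then show ?thesis using assms by (simp add: smooth_on_def)
qed

subsection \<open>The standard pseudo-Hermitian space\<close>

lemma std_herm_simps:
  "std_herm P (u + u') v = std_herm P u v + std_herm P u' v"
  "std_herm P u (v + v') = std_herm P u v + std_herm P u v'"
  "std_herm P (a *s u) v = a * std_herm P u v"
  "std_herm P u (a *s v) = cnj a * std_herm P u v"
  "std_herm P (- u) v = - std_herm P u v"
  "std_herm P u (- v) = - std_herm P u v"
  "std_herm P (r *\<^sub>R u) v = r *\<^sub>R std_herm P u v"
  "std_herm P u (r *\<^sub>R v) = r *\<^sub>R std_herm P u v"
  by (simp_all add: scaleR_eq_smult)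
    (simp_all add: std_herm_def sum.distrib sum_distrib_left sum_negf algebra_simps scaleR_conv_of_real)

lemma std_herm_cnj: "cnj (std_herm P u v) = std_herm P v u"
  by (auto simp: std_herm_def intro!: sum.cong)

lemma std_omega_eq: "std_omega P u v = - Im (std_herm P u v)"
  by (simp add: std_omega_def std_g_def std_J_def std_herm_simps)

lemma bilinear_std_g: "bilinear (std_g P)"
  unfolding bilinear_def std_g_def by (auto intro!: linearI simp: std_herm_simps)

lemma bilinear_std_omega: "bilinear (std_omega P)"
  unfolding bilinear_def std_omega_eq by (auto intro!: linearI simp: std_herm_simps)

lemma std_g_commute: "std_g P u v = std_g P v u"
  unfolding std_g_def std_herm_cnj[of P v u, symmetric] by simp

lemma std_g_nondegenerate:
  assumes "\<And>v. std_g P u v = 0"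
  shows "u = 0"
proof -
  \<comment> \<open>Inserting the signs of the form into the test vector turns the pairing with
    \<open>u\<close> into the sum of the squares of the moduli.\<close>
  define v where "v = (\<chi> i. (if i \<in> P then 1 else - 1) * u $ i)"
  have "std_herm P u v = (\<Sum>i\<in>UNIV. complex_of_real ((norm (u $ i))\<^sup>2))"
    unfolding std_herm_def v_def
    by (intro sum.cong) (simp_all add: complex_norm_square del: of_real_power)
  then have "(\<Sum>i\<in>UNIV. (norm (u $ i))\<^sup>2) = 0" using assms[of v] by (simp add: std_g_def flip: of_real_power)
  then have "u $ i = 0" for i by (subst (asm) sum_nonneg_eq_0_iff) auto
  then show ?thesis by (simp add: vec_eq_iff)
qed

lemma std_J_J: "std_J (std_J u) = - u"
  by (simp add: std_J_def vec_eq_iff)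

lemma std_g_J: "std_g P (std_J u) (std_J v) = std_g P u v"
  by (simp add: std_g_def std_J_def std_herm_simps)

lemma std_omega_commute: "std_omega P u v = - std_omega P v u"
  unfolding std_omega_eq std_herm_cnj[of P v u, symmetric] by simp

text \<open>Nondegeneracy of omega, inherited from \<open>std_g\<close> because \<open>std_J\<close>
  is invertible. It identifies the vectors defined by \<open>THE\<close> and allows vector
  identities to be proved by pairing.\<close>

lemma std_omega_ext:
  assumes "\<And>w. std_omega P u w = std_omega P v w"
  shows "u = v"
proof -
  have "std_J (u - v) = 0"
  proof (rule std_g_nondegenerate)
    show "std_g P (std_J (u - v)) w = 0" for w
      using assms[of w] linear_diff[OF bilinear_linear_left[OF bilinear_std_omega[of P]], of u v w]
      by (simp add: std_omega_def)
  qed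
  then have "- (u - v) = std_J 0" using std_J_J[of "u - v"] by simp
  then show ?thesis by (simp add: std_J_def)
qed

text \<open>The vector that represents the real functional 2 Re T through omega. The coordinates
  solve \<open>\<i> * std_herm P u w = 2 * cnj (T w)\<close>, the form being antilinear in
  \<open>w\<close>.\<close>

definition omega_dual :: "'n::finite set \<Rightarrow> (complex ^ 'n \<Rightarrow> complex) \<Rightarrow> complex ^ 'n" where
  "omega_dual P T = (\<chi> i. - 2 * \<i> * (if i \<in> P then 1 else - 1) * cnj (T (axis i 1)))"

definition complex_linear :: "(complex ^ 'n \<Rightarrow> complex) \<Rightarrow> bool" where
  "complex_linear T \<longleftrightarrow> (\<forall>u v. T (u + v) = T u + T v) \<and> (\<forall>a v. T (a *s v) = a * T v)"

lemma complex_linear_expand: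
  fixes T :: "complex ^ 'n::finite \<Rightarrow> complex"
  assumes "complex_linear T"
  shows "T w = (\<Sum>i\<in>UNIV. w $ i * T (axis i 1))"
proof -
  have "T 0 = 0" using assms unfolding complex_linear_def by (metis vector_smult_lzero mult_zero_left)
  then have sum: "T (\<Sum>i\<in>I. g i) = (\<Sum>i\<in>I. T (g i))" for I and g :: "'n \<Rightarrow> complex ^ 'n"
    using assms unfolding complex_linear_def by (induction I rule: infinite_finite_induct) auto
  have "w = (\<Sum>i\<in>UNIV. w $ i *s axis i 1)" by (simp add: basis_expansion)
  then have "T w = T (\<Sum>i\<in>UNIV. w $ i *s axis i 1)" by simp
  also have "\<dots> = (\<Sum>i\<in>UNIV. w $ i * T (axis i 1))" using assms by (simp add: sum complex_linear_def)
  finally show ?thesis .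
qed

lemma std_omega_dual:
  assumes "complex_linear T"
  shows "std_omega P (omega_dual P T) w = 2 * Re (T w)"
proof -
  have "\<i> * std_herm P (omega_dual P T) w = (\<Sum>i\<in>UNIV. 2 * cnj (w $ i * T (axis i 1)))"
    unfolding std_herm_def sum_distrib_left omega_dual_def by (intro sum.cong) auto
  also have "\<dots> = 2 * cnj (T w)" by (simp add: complex_linear_expand[OF assms, of w] sum_distrib_left)
  finally have "Re (\<i> * std_herm P (omega_dual P T) w) = 2 * Re (T w)" by simp
  then show ?thesis by (simp add: std_omega_eq)
qed

subsection \<open>Third derivatives\<close>

text \<open>In the outermost direction, complex linearity is holomorphy of the second derivative.
  Symmetry of the derivatives carries it to the other two.\<close>

lemma third_derivative_complex_linear:
  assumes f: "holomorphic_several_on f M" and op: "open M" and z: "z \<in> M"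
  shows "complex_linear (\<lambda>x. dderiv x (dderiv y (dderiv w f)) z)"
    "complex_linear (\<lambda>y. dderiv x (dderiv y (dderiv w f)) z)"
    "complex_linear (\<lambda>w. dderiv x (dderiv y (dderiv w f)) z)"
    and third_derivative_commute:
    "dderiv x (dderiv y (dderiv w f)) z = dderiv y (dderiv x (dderiv w f)) z"
    "dderiv x (dderiv y (dderiv w f)) z = dderiv x (dderiv w (dderiv y f)) z"
proof -
  have hol: "holomorphic_several_on (dderiv v f) M" "holomorphic_several_on (dderiv u (dderiv v f)) M" for u v
    using holomorphic_several_dderiv f op by blast+
  have sm: "smooth_on M f" "smooth_on M (dderiv v f)" for v
    using holomorphic_several_smooth[OF f op] smooth_on_dderiv by blast+
  show 1: "dderiv x (dderiv y (dderiv w f)) z = dderiv y (dderiv x (dderiv w f)) z" for x y w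
    by (rule dderiv_commute[OF op z sm(2)])
  show 2: "dderiv x (dderiv y (dderiv w f)) z = dderiv x (dderiv w (dderiv y f)) z" for x y w
    by (rule dderiv_cong[OF op z dderiv_commute[OF op _ sm(1)]])
  show 3: "complex_linear (\<lambda>x. dderiv x (dderiv y (dderiv w f)) z)" for y w
    using linear_add[OF has_derivative_linear[OF holomorphic_several_has_derivative[OF hol(2) z]]]
      holomorphic_several_smult[OF hol(2) z] by (simp add: complex_linear_def)
  show 4: "complex_linear (\<lambda>y. dderiv x (dderiv y (dderiv w f)) z)" for x w
    using 3[of x w] 1[of x _ w] by simp
  show "complex_linear (\<lambda>w. dderiv x (dderiv y (dderiv w f)) z)"
    using 4[of x y] 2[of x y] by simp
qed

text \<open>The vector x + J y of V belonging to x + i y in the complexification. It identifies the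
  (1,0)-part of \<open>X\<close> with a vector of V, since \<open>proj10 X\<close> is the (1,0)-part
  of \<open>cembed (cproj X)\<close>.\<close>

definition cproj :: "'n::finite cvec \<Rightarrow> complex ^ 'n" where
  "cproj X = fst X + \<i> *s snd X"

text \<open>The two components of \<open>proj10 X\<close> are 1/2 and - i/2 times
  \<open>cproj X\<close>. By holomorphy the second contributes i (- i/2) = 1/2 of the same
  derivative as the first.\<close>

lemma dderiv_C_proj10:
  assumes h: "holomorphic_several_on h M" and z: "z \<in> M"
  shows "dderiv_C (proj10 X) h z = dderiv (cproj X) h z"
proof -
  have p: "fst (proj10 X) = (1 / 2 :: complex) *s cproj X" "snd (proj10 X) = (- \<i> / 2) *s cproj X"
    by (simp_all add: proj10_def cscale_def J_C_def std_J_def cproj_def scaleR_eq_smult vec_eq_iff algebra_simps)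
  show ?thesis unfolding dderiv_C_def p holomorphic_several_smult[OF h z] by simp
qed

lemma dderiv_C_cong:
  assumes "open W" "z \<in> W" "\<And>y. y \<in> W \<Longrightarrow> f y = g y"
  shows "dderiv_C X f z = dderiv_C X g z"
  unfolding dderiv_C_def using dderiv_cong[OF assms(1,2), of f g] assms(3) by simp

lemma d3_eq:
  assumes f: "holomorphic_several_on f M" and op: "open M" and z: "z \<in> M"
  shows "d3 f z X Y Z = dderiv (cproj X) (dderiv (cproj Y) (dderiv (cproj Z) f)) z"
proof -
  have hol: "holomorphic_several_on (dderiv v f) M" "holomorphic_several_on (dderiv u (dderiv v f)) M" for u v
    using holomorphic_several_dderiv f op by blast+
  have 1: "dderiv_C (proj10 Y) (dderiv_C (proj10 Z) f) y = dderiv (cproj Y) (dderiv (cproj Z) f) y" if y: "y \<in> M" for y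
  proof -
    have "dderiv_C (proj10 Y) (dderiv_C (proj10 Z) f) y = dderiv_C (proj10 Y) (dderiv (cproj Z) f) y"
      by (rule dderiv_C_cong[OF op y dderiv_C_proj10[OF f]])
    then show ?thesis by (simp add: dderiv_C_proj10[OF hol(1) y])
  qed
  have "d3 f z X Y Z = dderiv_C (proj10 X) (dderiv (cproj Y) (dderiv (cproj Z) f)) z"
    unfolding d3_def by (rule dderiv_C_cong[OF op z 1])
  then show ?thesis by (simp add: dderiv_C_proj10[OF hol(2) z])
qed

lemma S_cubic_eq:
  assumes f: "holomorphic_several_on f M" and op: "open M" and z: "z \<in> M"
  shows "S_cubic f z x y w = 2 * Re (dderiv x (dderiv y (dderiv w f)) z)"
  by (simp add: S_cubic_def cubic_conj_def d3_eq[OF assms] cembed_def cconj_def cproj_def vector_smult_rzero)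

lemma S_endo_unique:
  assumes "holomorphic_several_on f M" "open M" "z \<in> M"
    and "\<And>w. std_omega P u w = 2 * Re (dderiv x (dderiv y (dderiv w f)) z)"
  shows "S_endo P f z x y = u"
  unfolding S_endo_def S_cubic_eq[OF assms(1-3)]
  by (rule the_equality) (use assms(4) std_omega_ext in metis)+

lemma S_endo_eq:
  assumes f: "holomorphic_several_on f M" and op: "open M" and z: "z \<in> M"
  shows "S_endo P f z x y = omega_dual P (\<lambda>w. dderiv x (dderiv y (dderiv w f)) z)"
  by (rule S_endo_unique[OF assms]) (rule std_omega_dual[OF third_derivative_complex_linear(3)[OF assms]])

lemma std_omega_S_endo:
  assumes f: "holomorphic_several_on f M" and op: "open M" and z: "z \<in> M"
  shows "std_omega P (S_endo P f z x y) w = 2 * Re (dderiv x (dderiv y (dderiv w f)) z)"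
  unfolding S_endo_eq[OF assms] by (rule std_omega_dual[OF third_derivative_complex_linear(3)[OF assms]])

text \<open>The conjugation in \<open>omega_dual\<close> turns complex linearity of the third
  derivative into antilinearity of \<open>S_endo\<close>. This is the source of its anticommutation
  with \<open>std_J\<close>.\<close>

lemma bilinear_S_endo:
  assumes f: "holomorphic_several_on f M" and op: "open M" and z: "z \<in> M"
  shows "S_endo P f z (x + x') y = S_endo P f z x y + S_endo P f z x' y"
    "S_endo P f z (a *s x) y = cnj a *s S_endo P f z x y"
    "S_endo P f z x y = S_endo P f z y x"
  using third_derivative_complex_linear(1)[OF assms] third_derivative_commute(1)[OF assms]
  unfolding S_endo_eq[OF assms] omega_dual_def complex_linear_def
  by (simp_all add: vec_eq_iff algebra_simps)

lemma smooth_on_S_endo: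
  assumes f: "holomorphic_several_on f M" and op: "open M"
  shows "smooth_on M (\<lambda>z. S_endo P f z x y)"
proof (rule smooth_on_cong[OF _ op])
  have bl: "bounded_linear (\<lambda>c. (- 2 * \<i> * (if i \<in> P then 1 else - 1) * cnj c) *s axis i (1 :: complex))" for i
    using bounded_linear_compose[OF bounded_linear_smult_left
        bounded_linear_compose[OF bounded_linear_mult_right bounded_linear_cnj]] by blast
  show "smooth_on M (\<lambda>z. \<Sum>i\<in>UNIV. (- 2 * \<i> * (if i \<in> P then 1 else - 1) *
      cnj (dderiv x (dderiv y (dderiv (axis i 1) f)) z)) *s axis i 1)"
    by (intro smooth_on_sum[OF op] smooth_on_linear[OF bl op] smooth_on_dderiv holomorphic_several_smooth[OF f op])
  fix z assume z: "z \<in> M"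
  show "(\<Sum>i\<in>UNIV. (- 2 * \<i> * (if i \<in> P then 1 else - 1) *
      cnj (dderiv x (dderiv y (dderiv (axis i 1) f)) z)) *s axis i 1) = S_endo P f z x y"
    unfolding S_endo_eq[OF f op z] omega_dual_def
    using basis_expansion[of "\<chi> i. - 2 * \<i> * (if i \<in> P then 1 else - 1) * cnj (dderiv x (dderiv y (dderiv (axis i 1) f)) z)"]
    by simp
qed

lemma dderiv_S_endo:
  assumes f: "holomorphic_several_on f M" and op: "open M" and z: "z \<in> M"
  shows "dderiv u (\<lambda>z. S_endo P f z v w) z = dderiv v (\<lambda>z. S_endo P f z u w) z"
proof (rule std_omega_ext)
  fix y
  interpret bounded_linear "\<lambda>s. std_omega P s y"
    using bilinear_linear_left[OF bilinear_std_omega] linear_conv_bounded_linear by blast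
  have d: "std_omega P (dderiv u (\<lambda>z. S_endo P f z v w) z) y = 2 * Re (dderiv u (dderiv v (dderiv w (dderiv y f))) z)" for u v
  proof -
    have "((\<lambda>z. std_omega P (S_endo P f z v w) y) has_derivative
        (\<lambda>u. std_omega P (dderiv u (\<lambda>z. S_endo P f z v w) z) y)) (at z)"
      by (rule has_derivative[OF smooth_on_has_derivative[OF smooth_on_S_endo[OF f op] z]])
    moreover have "((\<lambda>z. 2 * Re (dderiv v (dderiv w (dderiv y f)) z)) has_derivative
        (\<lambda>u. 2 * Re (dderiv u (dderiv v (dderiv w (dderiv y f))) z))) (at z)"
      by (intro has_derivative_mult_right bounded_linear.has_derivative[OF bounded_linear_Re]
          smooth_on_has_derivative[OF _ z] smooth_on_dderiv holomorphic_several_smooth[OF f op])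
    then have "((\<lambda>z. std_omega P (S_endo P f z v w) y) has_derivative
        (\<lambda>u. 2 * Re (dderiv u (dderiv v (dderiv w (dderiv y f))) z))) (at z)"
      by (rule has_derivative_transform_within_open[OF _ op z]) (simp add: std_omega_S_endo[OF f op])
    ultimately show ?thesis using has_derivative_unique by metis
  qed
  show "std_omega P (dderiv u (\<lambda>z. S_endo P f z v w) z) y = std_omega P (dderiv v (\<lambda>z. S_endo P f z u w) z) y"
    unfolding d by (subst dderiv_commute[OF op z]) (auto intro!: smooth_on_dderiv holomorphic_several_smooth[OF f op])
qed

subsection \<open>Isotropy of the support\<close>

lemma std_omega_simps:
  "std_omega P (u + u') v = std_omega P u v + std_omega P u' v"
  "std_omega P u (v + v') = std_omega P u v + std_omega P u v'"
  "std_omega P (u - u') v = std_omega P u v - std_omega P u' v"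
  "std_omega P u (v - v') = std_omega P u v - std_omega P u v'"
  "std_omega P (r *\<^sub>R u) v = r * std_omega P u v"
  "std_omega P u (r *\<^sub>R v) = r * std_omega P u v"
  "std_omega P (- u) v = - std_omega P u v"
  "std_omega P u (- v) = - std_omega P u v"
  "std_omega P 0 v = 0" "std_omega P u 0 = 0"
  using bilinear_std_omega[of P]
  by (simp_all add: bilinear_ladd bilinear_radd bilinear_lsub bilinear_rsub bilinear_lmul bilinear_rmul
      bilinear_lneg bilinear_rneg bilinear_lzero bilinear_rzero)

lemma omega_C_simps:
  "omega_C P (X + X') Y = omega_C P X Y + omega_C P X' Y"
  "omega_C P X (Y + Y') = omega_C P X Y + omega_C P X Y'"
  "omega_C P (cscale a X) Y = a * omega_C P X Y"
  "omega_C P X (cscale a Y) = a * omega_C P X Y"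
  "omega_C P 0 Y = 0" "omega_C P X 0 = 0"
  by (simp_all add: omega_C_def cscale_def std_omega_simps complex_eq_iff algebra_simps)

text \<open>Pairs (s, J s) are the vectors on which \<open>J_C\<close> acts as - i, so the values
  lie in the (0,1)-space. Up to the factor 1/2 they are the (0,1)-lifts of values of
  \<open>S_endo\<close>, which translates the complex support into real data.\<close>

lemma cubic_endo_C_eq:
  fixes P :: "'n::finite set"
  assumes f: "holomorphic_several_on f M" and op: "open M" and z: "z \<in> M"
  defines "s \<equiv> \<lambda>X Y. (1 / 2 :: complex) *s S_endo P f z (cproj X) (cproj Y)"
  shows "cubic_endo_C P (d3 f z) X Y = (s X Y, \<i> *s s X Y)"
  unfolding cubic_endo_C_def
proof (rule the_equality)
  define T where "T w = dderiv (cproj X) (dderiv (cproj Y) (dderiv w f)) z" for w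
  have T: "complex_linear T" unfolding T_def by (rule third_derivative_complex_linear(3)[OF f op z])
  have w1: "std_omega P (s X Y) w = Re (T w)" for w
    using std_omega_S_endo[OF f op z, of P "cproj X" "cproj Y" w]
    by (simp add: s_def T_def std_omega_eq std_herm_simps)
  have w2: "std_omega P (\<i> *s s X Y) w = Im (T w)" for w
  proof -
    \<comment> \<open>Moving the factor i to the second argument conjugates it. Then T ((- i) w) = -
      i T w, whose real part is the imaginary part of T w.\<close>
    have "std_omega P (\<i> *s s X Y) w = std_omega P (s X Y) ((- \<i>) *s w)"
      by (simp only: std_omega_eq std_herm_simps) simp
    also have "\<dots> = Im (T w)" using T by (simp only: w1 complex_linear_def) simp
    finally show ?thesis .
  qed
  show "\<forall>Z. omega_C P (s X Y, \<i> *s s X Y) Z = d3 f z X Y Z"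
  proof
    fix Z
    have "T (cproj Z) = T (fst Z) + \<i> * T (snd Z)" using T by (simp add: cproj_def complex_linear_def)
    then show "omega_C P (s X Y, \<i> *s s X Y) Z = d3 f z X Y Z"
      unfolding d3_eq[OF f op z] T_def[symmetric] by (simp add: omega_C_def w1 w2 complex_eq_iff)
  qed
  fix W assume W: "\<forall>Z. omega_C P W Z = d3 f z X Y Z"
  have eq: "omega_C P W Z = omega_C P (s X Y, \<i> *s s X Y) Z" for Z
    using spec[OF W, of Z] spec[OF \<open>\<forall>Z. omega_C P (s X Y, \<i> *s s X Y) Z = d3 f z X Y Z\<close>, of Z] by (rule trans[OF _ sym])
  have "std_omega P (fst W) w = std_omega P (s X Y) w" "std_omega P (snd W) w = std_omega P (\<i> *s s X Y) w" for w
    using eq[of "(w, 0)"] by (simp_all add: omega_C_def std_omega_simps complex_eq_iff)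
  then show "W = (s X Y, \<i> *s s X Y)" using std_omega_ext by (metis prod.collapse)
qed

text \<open>Pairing two generators of the support, the second conjugated, gives the Hermitian
  product of the underlying values of \<open>S_endo\<close> up to conjugation and a nonzero factor.
  This passes to the span by sesquilinearity.\<close>

lemma isotropic_support_iff:
  fixes f :: "complex ^ 'n::finite \<Rightarrow> complex"
  assumes f: "holomorphic_several_on f M" and op: "open M" and z: "z \<in> M"
  shows "isotropic_support P (d3 f z) \<longleftrightarrow>
    (\<forall>x y x' y'. std_herm P (S_endo P f z x y) (S_endo P f z x' y') = 0)"
proof -
  define G where "G = {cubic_endo_C P (d3 f z) X Y | X Y. True}"
  have cp: "cproj (cembed x) = x" for x :: "complex ^ 'n" by (simp add: cproj_def cembed_def vector_smult_rzero)
  \<comment> \<open>Real arguments already produce all generators, because \<open>cproj\<close> maps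
    \<open>cembed x\<close> back to \<open>x\<close>.\<close>
  have G: "G = {((1 / 2 :: complex) *s s, \<i> *s ((1 / 2 :: complex) *s s)) | s. \<exists>x y. s = S_endo P f z x y}"
    unfolding G_def cubic_endo_C_eq[OF assms] by auto (metis cp prod.collapse)
  have pair: "omega_C P ((1 / 2 :: complex) *s s, \<i> *s ((1 / 2 :: complex) *s s)) (cconj ((1 / 2 :: complex) *s s', \<i> *s ((1 / 2 :: complex) *s s')))
    = - (\<i> / 2) * cnj (std_herm P s s')" for s s'
    by (simp add: omega_C_def cconj_def std_omega_eq std_herm_simps complex_eq_iff)
  interpret vector_space "cscale :: complex \<Rightarrow> 'n cvec \<Rightarrow> 'n cvec" by (rule vector_space_cscale)
  have "isotropic_support P (d3 f z) \<longleftrightarrow> (\<forall>v\<in>G. \<forall>w\<in>G. omega_C P v (cconj w) = 0)"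
  proof
    assume "isotropic_support P (d3 f z)"
    then show "\<forall>v\<in>G. \<forall>w\<in>G. omega_C P v (cconj w) = 0"
      unfolding isotropic_support_def cubic_support_def G_def[symmetric] using span_base by blast
  next
    assume *: "\<forall>v\<in>G. \<forall>w\<in>G. omega_C P v (cconj w) = 0"
    have cc: "cconj (X + Y) = cconj X + cconj Y" "cconj (cscale a X) = cscale (cnj a) (cconj X)" "cconj 0 = 0" for a and X Y :: "'n cvec"
      by (simp_all add: cconj_def cscale_def prod_eq_iff)
    \<comment> \<open>Vanishing is extended from generators to the span one argument at a time;
      \<open>cconj\<close> is additive and conjugate-homogeneous.\<close>
    have 1: "omega_C P v (cconj w) = 0" if "v \<in> span G" "w \<in> G" for v w
    proof -
      have "span G \<subseteq> {v. omega_C P v (cconj w) = 0}"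
        using * that(2) by (intro span_minimal subspaceI) (blast | simp add: omega_C_simps)+
      then show ?thesis using that(1) by blast
    qed
    have "omega_C P v (cconj w) = 0" if "v \<in> span G" "w \<in> span G" for v w
    proof -
      have "span G \<subseteq> {w. omega_C P v (cconj w) = 0}"
        using 1 that(1) by (intro span_minimal subspaceI) (blast | simp add: omega_C_simps cc)+
      then show ?thesis using that(2) by blast
    qed
    then show "isotropic_support P (d3 f z)"
      unfolding isotropic_support_def cubic_support_def G_def[symmetric] by blast
  qed
  also have "\<dots> \<longleftrightarrow> (\<forall>x y x' y'. std_herm P (S_endo P f z x y) (S_endo P f z x' y') = 0)"
  proof (intro iffI allI ballI)
    fix x y x' y'
    assume *: "\<forall>v\<in>G. \<forall>w\<in>G. omega_C P v (cconj w) = 0"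
    define s where "s = S_endo P f z x y"
    define s' where "s' = S_endo P f z x' y'"
    have "((1 / 2 :: complex) *s s, \<i> *s ((1 / 2 :: complex) *s s)) \<in> G"
      "((1 / 2 :: complex) *s s', \<i> *s ((1 / 2 :: complex) *s s')) \<in> G"
      unfolding G s_def s'_def by blast+
    then have "- (\<i> / 2) * cnj (std_herm P s s') = 0" using * pair by metis
    then show "std_herm P s s' = 0" by simp
  next
    fix v w
    assume *: "\<forall>x y x' y'. std_herm P (S_endo P f z x y) (S_endo P f z x' y') = 0" and "v \<in> G" "w \<in> G"
    then obtain x y x' y' where "v = ((1 / 2 :: complex) *s S_endo P f z x y, \<i> *s ((1 / 2 :: complex) *s S_endo P f z x y))"
      "w = ((1 / 2 :: complex) *s S_endo P f z x' y', \<i> *s ((1 / 2 :: complex) *s S_endo P f z x' y'))"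
      unfolding G by blast
    then show "omega_C P v (cconj w) = 0" by (simp only: pair *) simp
  qed
  finally show ?thesis .
qed

section \<open>Tensor formulas\<close>

lemma torsion_eq: "torsion G X Y z = G z (X z) (Y z) - G z (Y z) (X z)"
  by (simp add: torsion_def covd_def lie_bracket_def)

lemma covd_endo_eq:
  assumes op: "open W" and z: "z \<in> W" and A: "\<And>y. y \<in> W \<Longrightarrow> linear (A y)"
    and dA: "\<And>u. (\<lambda>y. A y u) differentiable (at z)" and Y: "Y differentiable (at z)"
  shows "covd_endo G A X Y z
    = dderiv (X z) (\<lambda>y. A y (Y z)) z + G z (X z) (A z (Y z)) - A z (G z (X z) (Y z))"
  using dderiv_eq[OF has_derivative_linear_family[OF op z A dA dderiv_works[OF Y]]]
  by (simp add: covd_endo_def covd_def linear_add[OF A[OF z]])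

lemma covd_form_eq:
  assumes op: "open W" and z: "z \<in> W" and b: "\<And>y. y \<in> W \<Longrightarrow> bilinear (b y)"
    and db: "\<And>u v. (\<lambda>y. b y u v) differentiable (at z)"
    and Y: "Y differentiable (at z)" and Z: "Z differentiable (at z)"
  shows "covd_form G b X Y Z z
    = dderiv (X z) (\<lambda>y. b y (Y z) (Z z)) z - b z (G z (X z) (Y z)) (Z z) - b z (Y z) (G z (X z) (Z z))"
  using dderiv_eq[OF has_derivative_bilinear_family[OF op z b db dderiv_works[OF Y] dderiv_works[OF Z]]]
  by (simp add: covd_form_def covd_def bilinear_ladd[OF b[OF z]] bilinear_radd[OF b[OF z]])

text \<open>Tensoriality: second derivatives of \<open>Z\<close> cancel by symmetry, first
  derivatives of \<open>X\<close> and \<open>Y\<close> cancel against the Lie bracket, and those of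
  \<open>Z\<close> against the exchanged term. Only values of the fields at \<open>z\<close> remain,
  so constant fields test flatness.\<close>

lemma curvature_eq:
  fixes G :: "'e::euclidean_space \<Rightarrow> 'e \<Rightarrow> 'e \<Rightarrow> 'e"
  assumes op: "open W" and z: "z \<in> W" and G: "\<And>y. y \<in> W \<Longrightarrow> bilinear (G y)"
    and sG: "\<And>u v. smooth_on W (\<lambda>y. G y u v)"
    and sm: "smooth_on W X" "smooth_on W Y" "smooth_on W Z"
  shows "curvature G X Y Z z = dderiv (X z) (\<lambda>y. G y (Y z) (Z z)) z - dderiv (Y z) (\<lambda>y. G y (X z) (Z z)) z
     + G z (X z) (G z (Y z) (Z z)) - G z (Y z) (G z (X z) (Z z))"
proof -
  note lin = bilinear_ladd[OF G[OF z]] bilinear_radd[OF G[OF z]] bilinear_lsub[OF G[OF z]]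
  have dZ: "linear (\<lambda>v. dderiv v Z y)" if "y \<in> W" for y
    using has_derivative_linear[OF smooth_on_has_derivative[OF sm(3) that]] .
  have d: "dderiv h (covd G X Z) z = dderiv h (dderiv (X z) Z) z + dderiv (dderiv h X z) Z z
      + (dderiv h (\<lambda>y. G y (X z) (Z z)) z + G z (dderiv h X z) (Z z) + G z (X z) (dderiv h Z z))"
    if X: "smooth_on W X" for X h
  proof -
    have "((\<lambda>y. dderiv (X y) Z y) has_derivative
        (\<lambda>h. dderiv h (\<lambda>y. dderiv (X z) Z y) z + dderiv (dderiv h X z) Z z)) (at z)"
      by (rule has_derivative_linear_family[OF op z dZ])
        (use smooth_on_differentiable[OF smooth_on_dderiv[OF sm(3)] z] smooth_on_has_derivative[OF X z] in auto)
    moreover have "((\<lambda>y. G y (X y) (Z y)) has_derivative (\<lambda>h. dderiv h (\<lambda>y. G y (X z) (Z z)) z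
        + G z (dderiv h X z) (Z z) + G z (X z) (dderiv h Z z))) (at z)"
      by (rule has_derivative_bilinear_family[OF op z G])
        (use smooth_on_differentiable[OF sG z] smooth_on_has_derivative[OF X z] smooth_on_has_derivative[OF sm(3) z] in auto)
    ultimately show ?thesis
      unfolding covd_def by (intro dderiv_eq[OF has_derivative_add]) (simp_all add: eta_contract_eq)
  qed
  have "dderiv (X z) (dderiv (Y z) Z) z = dderiv (Y z) (dderiv (X z) Z) z"
    by (rule dderiv_commute[OF op z sm(3)])
  then show ?thesis
    unfolding curvature_def covd_def[of G X "covd G Y Z"] covd_def[of G Y "covd G X Z"]
      covd_def[of G "lie_bracket X Y"] d[OF sm(1)] d[OF sm(2)]
    by (simp add: covd_def lie_bracket_def lin linear_diff[OF dZ[OF z]])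
qed

lemma nijenhuis_const:
  assumes J: "bounded_linear J" "\<And>u. J (J u) = - u"
    and X: "X differentiable (at z)" and Y: "Y differentiable (at z)"
  shows "nijenhuis (\<lambda>_. J) X Y z = 0"
proof -
  interpret J: bounded_linear J by fact
  have d: "dderiv v (\<lambda>y. J (X y)) z = J (dderiv v X z)" if "X differentiable (at z)" for v X
    by (rule dderiv_eq) (rule J.has_derivative[OF dderiv_works[OF that]])
  have m: "dderiv (- v) X z = - dderiv v X z" if "X differentiable (at z)" for v X
    using linear_neg[OF has_derivative_linear[OF dderiv_works[OF that]]] .
  show ?thesis
    by (simp add: nijenhuis_def lie_bracket_def d[OF X] d[OF Y] J.diff J(2) J.add J.neg m[OF X] m[OF Y])
qed

lemma dderiv_const [simp]: "dderiv v (\<lambda>_. c) z = 0"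
  by (rule dderiv_eq) simp

section \<open>The manifold associated with a holomorphic function\<close>

lemma second_countable_euclidean: "second_countable (euclidean :: 'a::second_countable_topology topology)"
proof -
  obtain B :: "'a set set" where B: "countable B" "topological_basis B" using ex_countable_basis by blast
  show ?thesis unfolding second_countable_def
    using B topological_basis_open[OF B(2)] topological_basisE[OF B(2)] by (intro exI[of _ B]) (metis open_openin)
qed

lemma chart_id_simps [simp]: "coord_dom (M, \<lambda>z. z) = M" "overlap (M, \<lambda>z. z) (M, \<lambda>z. z) = M"
  by (simp_all add: coord_dom_def overlap_def)

lemma coord_inv_id: "z \<in> M \<Longrightarrow> coord_inv (M, \<lambda>z. z) z = z"
  by (simp add: coord_inv_def inv_into_f_eq inj_on_def)

lemma transition_id: "z \<in> M \<Longrightarrow> transition (M, \<lambda>z. z) (M, \<lambda>z. z) z = z"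
  by (simp add: transition_def coord_inv_id)

context
  fixes M :: "'e::euclidean_space set"
  assumes op: "open M"
begin

lemma dderiv_transition_id: "z \<in> M \<Longrightarrow> dderiv v (transition (M, \<lambda>z. z) (M, \<lambda>z. z)) z = v"
  using dderiv_cong[OF op, of z _ "\<lambda>z. z"] transition_id dderiv_eq[OF has_derivative_ident] by metis

lemma dderiv2_transition_id: "z \<in> M \<Longrightarrow> dderiv u (dderiv v (transition (M, \<lambda>z. z) (M, \<lambda>z. z))) z = 0"
  using dderiv_cong[OF op, of z "dderiv v (transition (M, \<lambda>z. z) (M, \<lambda>z. z))" "\<lambda>_. v"] dderiv_transition_id by simp

lemma smooth_manifold_id: "smooth_manifold (top_of_set M) {(M, \<lambda>z. z)}"
proof -
  have "smooth_on M (transition (M, \<lambda>z. z) (M, \<lambda>z. z))"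
    by (rule smooth_on_cong[OF smooth_on_id op]) (simp add: transition_id)
  moreover have "homeomorphic_map (top_of_set M) (top_of_set M) (\<lambda>z. z)"
    using homeomorphic_map_id[of "top_of_set M" "top_of_set M"] by (simp add: id_def)
  ultimately show ?thesis
    using op unfolding smooth_manifold_def
    by (simp add: Hausdorff_space_subtopology Hausdorff_space_euclidean
        second_countable_subtopology second_countable_euclidean subtopology_subtopology)
qed

lemma related_id:
  assumes "z \<in> M"
  shows "form_related (transition (M, \<lambda>z. z) (M, \<lambda>z. z)) z b b"
    "endo_related (transition (M, \<lambda>z. z) (M, \<lambda>z. z)) z A A"
    "conn_related (transition (M, \<lambda>z. z) (M, \<lambda>z. z)) z G G"
  using assms by (simp_all add: form_related_def endo_related_def conn_related_def
      dderiv_transition_id dderiv2_transition_id transition_id)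

end

lemma linear_std_J: "linear std_J"
  unfolding std_J_def by (auto intro!: linearI simp: vec_eq_iff algebra_simps)

lemma flat_special_kaehler_M_f:
  fixes f :: "complex ^ 'n::finite \<Rightarrow> complex"
  assumes op: "open M" and f: "holomorphic_several_on f M" and iso: "\<And>z. z \<in> M \<Longrightarrow> isotropic_support P (d3 f z)"
  shows "flat_special_kaehler_manifold (M_f P M f)"
proof -
  define \<A> where "\<A> = {(M, \<lambda>z :: complex ^ 'n. z)}"
  let ?S = "S_endo P f"
  \<comment> \<open>Zero Christoffel symbols: the canonical flat connection, which is the
    Levi-Civita connection because \<open>std_g\<close> has constant coefficients.\<close>
  define D where "D = (\<lambda>(_ :: (complex ^ 'n, complex ^ 'n) chart) (_ :: complex ^ 'n) (_ :: complex ^ 'n) (_ :: complex ^ 'n). 0 :: complex ^ 'n)"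
  have bilS: "bilinear (?S z)" if "z \<in> M" for z
    unfolding bilinear_def
    using bilinear_S_endo[OF f op that, of P] by (auto intro!: linearI simp: scaleR_eq_smult)
  have smS: "smooth_on M (\<lambda>z. ?S z u v)" for u v by (rule smooth_on_S_endo[OF f op])
  have symS: "?S z u v = ?S z v u" if "z \<in> M" for z u v using bilinear_S_endo(3)[OF f op that] .
  have SJ: "?S z u (std_J v) = - std_J (?S z u v)" if "z \<in> M" for z u v
    using bilinear_S_endo(2)[OF f op that, of P \<i> v u] symS[OF that] by (simp add: std_J_def)
  \<comment> \<open>Total symmetry exchanges the vectors \<open>?S z v w\<close> and
    \<open>y\<close> in omega (S u (S v w), y). The result pairs two vectors of the isotropic
    support.\<close>
  have SS: "?S z u (?S z v w) = 0" if z: "z \<in> M" for z u v w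
  proof (rule std_omega_ext)
    fix y
    have T: "std_omega P (?S z a b) c = std_omega P (?S z a c) b" for a b c
      using std_omega_S_endo[OF f op z, of P] third_derivative_commute(2)[OF f op z] by metis
    have "std_omega P (?S z u (?S z v w)) y = std_omega P (?S z u y) (?S z v w)" by (rule T)
    also have "\<dots> = 0" using iso[OF z] unfolding isotropic_support_iff[OF f op z] std_omega_eq by simp
    finally show "std_omega P (?S z u (?S z v w)) y = std_omega P 0 y" by (simp add: std_omega_simps)
  qed
  have diff: "X differentiable (at z)" if "smooth_on M X" "z \<in> M" for X :: "complex ^ 'n \<Rightarrow> complex ^ 'n" and z
    using smooth_on_differentiable that by blast
  have nij: "nijenhuis (\<lambda>_. std_J) X Y z = 0" if "smooth_on M X" "smooth_on M Y" "z \<in> M"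
    for X Y :: "complex ^ 'n \<Rightarrow> complex ^ 'n" and z
    by (rule nijenhuis_const[OF _ std_J_J]) (use that diff linear_conv_bounded_linear linear_std_J in auto)
  have affD: "affine_connection \<A> D"
    using related_id(3)[OF op] by (auto simp: affine_connection_def \<A>_def D_def bilinear_def intro!: linearI)
  have LC: "levi_civita \<A> (\<lambda>_ _. std_g P) D"
    using affD unfolding levi_civita_def torsionfree_def parallel_form_def \<A>_def
    by (auto simp: torsion_eq D_def covd_form_eq[OF op _ bilinear_std_g] diff bilinear_lzero[OF bilinear_std_g] bilinear_rzero[OF bilinear_std_g])
  have flatD: "flat_connection \<A> D"
    unfolding flat_connection_def \<A>_def
    by (auto simp: D_def bilinear_def intro!: linearI trans[OF curvature_eq[OF op]])
  have Jpar: "parallel_endo \<A> D (\<lambda>_ _. std_J)"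
    unfolding parallel_endo_def \<A>_def
    by (auto simp: D_def covd_endo_eq[OF op _ linear_std_J] diff linear_0[OF linear_std_J])
  have kaehler: "kaehler_manifold (M_f P M f)"
    unfolding kaehler_manifold_def
  proof (intro conjI)
    show "smooth_manifold (sk_top (M_f P M f)) (sk_atlas (M_f P M f))"
      using smooth_manifold_id[OF op] by (simp add: M_f_def)
    show "pseudo_riemannian (sk_atlas (M_f P M f)) (sk_g (M_f P M f))"
      using related_id(1)[OF op] std_g_commute
      by (auto simp: M_f_def pseudo_riemannian_def form_field_def bilinear_std_g intro: std_g_nondegenerate)
    show "complex_structure (sk_atlas (M_f P M f)) (sk_J (M_f P M f))"
      using related_id(2)[OF op] nij by (auto simp: M_f_def complex_structure_def endo_field_def linear_std_J std_J_J)
    show "\<exists>D. levi_civita (sk_atlas (M_f P M f)) (sk_g (M_f P M f)) D \<and> parallel_endo (sk_atlas (M_f P M f)) D (sk_J (M_f P M f))"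
      using LC Jpar by (auto simp: M_f_def \<A>_def)
  qed (simp add: M_f_def std_g_J)
  have "special_kaehler_manifold (M_f P M f)"
    unfolding special_kaehler_manifold_def
  proof (intro conjI kaehler)
    show "affine_connection (sk_atlas (M_f P M f)) (sk_nabla (M_f P M f))"
      using related_id(3)[OF op] by (simp add: affine_connection_def M_f_def bilS smS)
    show "torsionfree (sk_atlas (M_f P M f)) (sk_nabla (M_f P M f))"
      using symS by (simp add: torsionfree_def M_f_def torsion_eq)
    show "flat_connection (sk_atlas (M_f P M f)) (sk_nabla (M_f P M f))"
      unfolding flat_connection_def
      by (simp add: M_f_def curvature_eq[OF op _ bilS smS] SS) (simp add: dderiv_S_endo[OF f op])
    show "parallel_form (sk_atlas (M_f P M f)) (sk_nabla (M_f P M f)) (kaehler_form (M_f P M f))"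
    proof -
      have om: "kaehler_form (M_f P M f) c = (\<lambda>_. std_omega P)" for c
        by (rule ext)+ (simp add: kaehler_form_def M_f_def std_omega_def)
      have "std_omega P (?S z x y) w = - std_omega P y (?S z x w)" if "z \<in> M" for z x y w
        using std_omega_S_endo[OF f op that, of P x] third_derivative_commute(2)[OF f op that, of x y w]
          std_omega_commute[of P y] by simp
      then show ?thesis
        unfolding parallel_form_def om
        by (simp add: M_f_def covd_form_eq[OF op _ bilinear_std_omega] diff)
    qed
    show "\<forall>c\<in>sk_atlas (M_f P M f). \<forall>X Y. smooth_on (coord_dom c) X \<longrightarrow> smooth_on (coord_dom c) Y \<longrightarrow>
        (\<forall>z\<in>coord_dom c. covd_endo (sk_nabla (M_f P M f) c) (sk_J (M_f P M f) c) X Y z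
                        = covd_endo (sk_nabla (M_f P M f) c) (sk_J (M_f P M f) c) Y X z)"
      \<comment> \<open>\<open>std_J\<close> is constant and anticommutes with S, so the covariant
        derivative of J is - 2 J S, symmetric because S is.\<close>
      using symS by (simp add: M_f_def covd_endo_eq[OF op _ linear_std_J] diff SJ)
  qed
  then show ?thesis
    unfolding flat_special_kaehler_manifold_def using LC flatD by (auto simp: M_f_def \<A>_def)
qed

section \<open>Hermitian normal form\<close>

text \<open>Gram-Schmidt for an indefinite form, one J-invariant plane at a time. Null vectors
  cannot be normalised, so each new vector must be chosen with nonzero square in the orthogonal
  complement of the planes already found. Squaring \<open>g (e i) (e i)\<close> leaves the sign
  open.\<close>

lemma orthonormal_system_exists:
  fixes g :: "'e::euclidean_space \<Rightarrow> 'e \<Rightarrow> real" and I :: "'n::finite set"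
  assumes g: "bilinear g" "\<And>u v. g u v = g v u" and nd: "\<And>u. (\<And>v. g u v = 0) \<Longrightarrow> u = 0"
    and J: "linear J" "\<And>u. J (J u) = - u" "\<And>u v. g (J u) (J v) = g u v"
    and dim: "DIM('e) = 2 * CARD('n)"
  shows "\<exists>e. \<forall>i\<in>I. (g (e i) (e i))\<^sup>2 = 1 \<and> (\<forall>j\<in>I. (i \<noteq> j \<longrightarrow> g (e i) (e j) = 0) \<and> g (J (e i)) (e j) = 0)"
  using finite[of I]
proof (induction I rule: finite_induct)
  case empty
  show ?case by simp
next
  case (insert i0 I)
  then obtain e where sq: "\<And>i. i \<in> I \<Longrightarrow> g (e i) (e i) * g (e i) (e i) = 1"
    and orth: "\<And>i j. i \<in> I \<Longrightarrow> j \<in> I \<Longrightarrow> i \<noteq> j \<Longrightarrow> g (e i) (e j) = 0"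
    and Jorth: "\<And>i j. i \<in> I \<Longrightarrow> j \<in> I \<Longrightarrow> g (J (e i)) (e j) = 0"
    by (auto simp: power2_eq_square)
  note bl = bilinear_ladd[OF g(1)] bilinear_radd[OF g(1)] bilinear_lmul[OF g(1)] bilinear_rmul[OF g(1)]
    bilinear_lneg[OF g(1)] bilinear_rneg[OF g(1)] bilinear_lsub[OF g(1)] bilinear_rsub[OF g(1)]
  have gJ: "g (J u) v = - g u (J v)" for u v
    using J(3)[of u "J v"] by (simp add: J(2) bl)
  have gJv: "g (J v) v = 0" for v using gJ[of v v] g(2)[of v "J v"] by simp
  have sum: "g (sum h I) v = (\<Sum>i\<in>I. g (h i) v)" for h v
    using linear_sum[OF bilinear_linear_left[OF g(1)]] by blast
  define E where "E = e ` I \<union> (\<lambda>i. J (e i)) ` I"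
  \<comment> \<open>The planes found so far number fewer than \<open>CARD('n)\<close>, so they leave
    a vector \<open>v0\<close> outside their span.\<close>
  have "dim (span E) < DIM('e)"
  proof -
    have "dim (span E) \<le> card E" using dim_le_card'[of E] by (simp add: E_def dim_span)
    also have "\<dots> \<le> card I + card I"
      unfolding E_def using card_Un_le card_image_le[OF finite[of I]] add_mono order_trans by metis
    also have "card I < CARD('n)" using insert.hyps by (intro psubset_card_mono) auto
    finally show ?thesis using dim by simp
  qed
  then have "span E \<noteq> UNIV" using dim_UNIV by (metis less_irrefl)
  then obtain v0 where v0: "v0 \<notin> span E" by blast
  \<comment> \<open>Orthogonal projection onto the complement \<open>N\<close>. The numbers
    \<open>g (e i) (e i)\<close> are 1 or -1, hence their own inverses, and equal the squares of
    \<open>J (e i)\<close> since J is an isometry.\<close>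
  define proj where "proj v = v - (\<Sum>i\<in>I. g (e i) (e i) *\<^sub>R (g v (e i) *\<^sub>R e i + g v (J (e i)) *\<^sub>R J (e i)))" for v
  have projE: "v - proj v \<in> span E" for v
  proof -
    have "v - proj v = (\<Sum>i\<in>I. g (e i) (e i) *\<^sub>R (g v (e i) *\<^sub>R e i + g v (J (e i)) *\<^sub>R J (e i)))"
      by (simp add: proj_def)
    moreover have "e i \<in> E" "J (e i) \<in> E" if "i \<in> I" for i using that by (auto simp: E_def)
    ultimately show ?thesis by (simp only:) (intro span_sum span_scale span_add span_base)
  qed
  define N where "N = {v. \<forall>i\<in>I. g v (e i) = 0 \<and> g v (J (e i)) = 0}"
  have projN: "proj v \<in> N" for v
    unfolding N_def
  proof (intro CollectI ballI conjI)
    fix j assume j: "j \<in> I"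
    have aba: "a * (b * a) = b * (a * a)" for a b :: real by simp
    have e4: "g (e i) (J (e j)) = 0" if "i \<in> I" for i using Jorth[OF j that] g(2)[of "e i" "J (e j)"] by simp
    have "g (e i) (e i) * (g v (e i) * g (e i) (e j) + g v (J (e i)) * g (J (e i)) (e j)) = (if i = j then g v (e j) else 0)"
      if "i \<in> I" for i
      using orth[OF that j] Jorth[OF that j] sq[OF j] by (auto simp: aba)
    then have "g (proj v) (e j) = g v (e j) - (\<Sum>i\<in>I. if i = j then g v (e j) else 0)"
      unfolding proj_def bl sum real_scaleR_def by simp
    then show "g (proj v) (e j) = 0" using j by (simp add: sum.delta)
    have "g (e i) (e i) * (g v (e i) * g (e i) (J (e j)) + g v (J (e i)) * g (J (e i)) (J (e j))) = (if i = j then g v (J (e j)) else 0)"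
      if "i \<in> I" for i
      using orth[OF that j] e4[OF that] sq[OF j] by (auto simp: aba J(3))
    then have "g (proj v) (J (e j)) = g v (J (e j)) - (\<Sum>i\<in>I. if i = j then g v (J (e j)) else 0)"
      unfolding proj_def bl sum real_scaleR_def by simp
    then show "g (proj v) (J (e j)) = 0" using j by (simp add: sum.delta)
  qed
  have NE: "g u w = 0" if "u \<in> N" "w \<in> span E" for u w
    using that(2) by (induction rule: span_induct_alt) (use that(1) in \<open>auto simp: bl bilinear_rzero[OF g(1)] N_def E_def\<close>)
  \<comment> \<open>If all of \<open>N\<close> were null, polarisation would make \<open>g\<close>
    vanish on \<open>N\<close>. Then \<open>proj v0\<close> would be orthogonal to \<open>N\<close>
    and to \<open>span E\<close>, hence to everything, and would be 0, which puts \<open>v0\<close>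
    into the span.\<close>
  have "\<exists>v\<in>N. g v v \<noteq> 0"
  proof (rule ccontr)
    assume "\<not> ?thesis"
    then have z: "g v v = 0" if "v \<in> N" for v using that by blast
    have "g u v = 0" if "u \<in> N" "v \<in> N" for u v
    proof -
      have "u + v \<in> N" using that by (auto simp: N_def bl)
      from z[OF this] show ?thesis using z[OF that(1)] z[OF that(2)] g(2)[of v u] by (simp add: bl)
    qed
    then have "g (proj v0) y = 0" for y
      using NE[OF projN projE, of v0 y] projN[of v0] projN[of y] by (simp add: bl)
    then have "proj v0 = 0" by (rule nd)
    then show False using projE[of v0] v0 by simp
  qed
  then obtain v where v: "v \<in> N" "g v v \<noteq> 0" by blast
  define a where "a = 1 / sqrt \<bar>g v v\<bar>"
  define e' where "e' = e(i0 := a *\<^sub>R v)"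
  have a: "a * a = 1 / \<bar>g v v\<bar>" by (simp add: a_def real_sqrt_mult_self)
  have "(g (a *\<^sub>R v) (a *\<^sub>R v))\<^sup>2 = 1"
  proof -
    have "g (a *\<^sub>R v) (a *\<^sub>R v) = (a * a) * g v v" by (simp add: bl)
    also have "\<dots> = sgn (g v v)" unfolding a by (simp add: sgn_div_norm divide_inverse)
    finally show ?thesis using v(2) by (simp add: sgn_if)
  qed
  moreover have "g (a *\<^sub>R v) (e i) = 0" "g (e i) (a *\<^sub>R v) = 0" "g (J (a *\<^sub>R v)) (e i) = 0" "g (J (e i)) (a *\<^sub>R v) = 0"
    if "i \<in> I" for i
    using v(1) that g(2)[of "J (e i)" "a *\<^sub>R v"] g(2)[of "e i" "a *\<^sub>R v"] by (simp_all add: N_def bl gJ[of "a *\<^sub>R v"])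
  moreover have "g (J (a *\<^sub>R v)) (a *\<^sub>R v) = 0" by (rule gJv)
  ultimately show ?case
    using insert.hyps sq orth Jorth by (intro exI[of _ e']) (auto simp: e'_def power2_eq_square)
qed

text \<open>The orthonormal system serves as a complex basis, with i acting as J; \<open>P\<close>
  records its vectors of positive square. Injectivity follows from nondegeneracy of
  \<open>std_g\<close>, and bijectivity from the dimension.\<close>

lemma hermitian_normal_form:
  fixes g :: "'e::euclidean_space \<Rightarrow> 'e \<Rightarrow> real"
  assumes g: "bilinear g" "\<And>u v. g u v = g v u" and nd: "\<And>u. (\<And>v. g u v = 0) \<Longrightarrow> u = 0"
    and J: "linear J" "\<And>u. J (J u) = - u" "\<And>u v. g (J u) (J v) = g u v"
    and dim: "DIM('e) = 2 * CARD('n)"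
  obtains P :: "'n::finite set" and \<Psi> :: "complex ^ 'n \<Rightarrow> 'e"
  where "linear \<Psi>" "bij \<Psi>" "\<And>w. \<Psi> (\<i> *s w) = J (\<Psi> w)" "\<And>u v. g (\<Psi> u) (\<Psi> v) = std_g P u v"
proof -
  obtain e :: "'n \<Rightarrow> 'e" where e: "\<And>i. (g (e i) (e i))\<^sup>2 = 1"
    "\<And>i j. i \<noteq> j \<Longrightarrow> g (e i) (e j) = 0" "\<And>i j. g (J (e i)) (e j) = 0"
    using orthonormal_system_exists[OF g nd J dim, of UNIV] by auto
  define P where "P = {i. g (e i) (e i) = 1}"
  define \<Psi> where "\<Psi> w = (\<Sum>i\<in>UNIV. Re (w $ i) *\<^sub>R e i + Im (w $ i) *\<^sub>R J (e i))" for w :: "complex ^ 'n"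
  have lin: "linear \<Psi>"
    by (auto intro!: linearI simp: \<Psi>_def sum.distrib[symmetric] scaleR_sum_right algebra_simps intro!: sum.cong)
  have J\<Psi>: "\<Psi> (\<i> *s w) = J (\<Psi> w)" for w
    by (simp add: \<Psi>_def linear_sum[OF J(1)] linear_add[OF J(1)] linear_scale[OF J(1)] J(2) add.commute)
  have g\<Psi>: "g (\<Psi> u) (\<Psi> v) = std_g P u v" for u v
  proof -
    have s: "g (e i) (e i) = (if i \<in> P then 1 else - 1)" for i
      using e(1)[of i] by (auto simp: P_def power2_eq_1_iff)
    have ee: "g (e i) (e j) = (if i = j then (if i \<in> P then 1 else - 1) else 0)" for i j using s e(2) by auto
    have e4: "g (e i) (J (e j)) = 0" for i j using g(2)[of "e i" "J (e j)"] e(3) by simp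
    have gterm: "g (a *\<^sub>R e i + b *\<^sub>R J (e i)) (c *\<^sub>R e j + d *\<^sub>R J (e j))
        = (if i = j then (if i \<in> P then 1 else - 1) * (a * c + b * d) else 0)" for a b c d i j
      by (simp add: bilinear_ladd[OF g(1)] bilinear_radd[OF g(1)] bilinear_lmul[OF g(1)] bilinear_rmul[OF g(1)] J(3) ee e(3) e4
          algebra_simps)
    have "g (\<Psi> u) (\<Psi> v) = (\<Sum>i\<in>UNIV. \<Sum>j\<in>UNIV. if i = j then (if i \<in> P then 1 else - 1) * (Re (u $ i) * Re (v $ j) + Im (u $ i) * Im (v $ j)) else 0)"
      unfolding \<Psi>_def linear_sum[OF bilinear_linear_left[OF g(1)]] linear_sum[OF bilinear_linear_right[OF g(1)]] gterm
      by (rule sum.swap)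
    also have "\<dots> = std_g P u v"
      by (simp add: std_g_def std_herm_def sum.delta Re_sum) (auto intro!: sum.cong)
    finally show ?thesis .
  qed
  have inj: "inj \<Psi>"
    unfolding linear_injective_0[OF lin]
  proof (intro allI impI)
    fix u assume "\<Psi> u = 0"
    then have "std_g P u v = 0" for v using g\<Psi>[of u v] bilinear_lzero[OF g(1)] by simp
    then show "u = 0" by (rule std_g_nondegenerate)
  qed
  have "dim (range \<Psi>) = DIM('e)"
    using dim_image_eq[OF lin, of UNIV] inj dim by (simp add: dim_UNIV)
  then have "range \<Psi> = UNIV"
    using dim_eq_full[of "range \<Psi>"] span_eq_iff[of "range \<Psi>"] linear_subspace_image[OF lin subspace_UNIV] by auto
  then have "bij \<Psi>" using inj by (simp add: bij_def)
  then show ?thesis using that lin J\<Psi> g\<Psi> by blast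
qed

section \<open>The potential of a special Kaehler structure on a flat domain\<close>

lemma bounded_linear_axis: "bounded_linear (axis k :: 'a::real_normed_vector \<Rightarrow> 'a ^ 'n::finite)"
proof (rule bounded_linear_intro[of _ 1])
  show "norm (axis k x) \<le> norm x * 1" for x :: 'a
  proof -
    have "norm (axis k x) \<le> (\<Sum>i\<in>UNIV. norm (axis k x $ i))"
      unfolding norm_vec_def by (rule L2_set_le_sum) simp
    also have "\<dots> = (\<Sum>i\<in>UNIV. if i = k then norm x else 0)" by (intro sum.cong) (auto simp: axis_def)
    finally show ?thesis by simp
  qed
qed (simp_all add: axis_def vec_eq_iff)

lemma smooth_on_vec:
  assumes op: "open W" and f: "\<And>k. smooth_on W (f k)"
  shows "smooth_on W (\<lambda>z. \<chi> k. f k z)"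
proof -
  have "smooth_on W (\<lambda>z. \<Sum>k\<in>UNIV. axis k (f k z))"
    by (intro smooth_on_sum[OF op] smooth_on_linear[OF bounded_linear_axis op] f)
  moreover have "(\<Sum>k\<in>UNIV. axis k (f k z)) = (\<chi> k. f k z)" for z
    by (simp add: vec_eq_iff axis_def sum.delta)
  ultimately show ?thesis by simp
qed

lemma dderiv_vec_nth: "F differentiable (at z) \<Longrightarrow> dderiv u F z $ k = dderiv u (\<lambda>z. F z $ k) z"
  by (rule dderiv_eq[symmetric]) (rule bounded_linear.has_derivative[OF bounded_linear_vec_nth dderiv_works])

text \<open>Here the metric and J are already standard, and \<open>S\<close> is the difference of
  the two connections in flat coordinates. The remaining task is to exhibit \<open>S\<close> as the
  tensor of a third derivative.\<close>

lemma special_kaehler_potential: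
  fixes S :: "complex ^ 'n::finite \<Rightarrow> complex ^ 'n \<Rightarrow> complex ^ 'n \<Rightarrow> complex ^ 'n"
  assumes op: "open V" and y0: "y0 \<in> V"
    and bil: "\<And>y. y \<in> V \<Longrightarrow> bilinear (S y)" and sm: "\<And>u v. smooth_on V (\<lambda>y. S y u v)"
    and sym: "\<And>y u v. y \<in> V \<Longrightarrow> S y u v = S y v u"
    and skew: "\<And>y u v w. y \<in> V \<Longrightarrow> std_omega P (S y u v) w = - std_omega P v (S y u w)"
    and SJ: "\<And>y u v. y \<in> V \<Longrightarrow> S y u (std_J v) - std_J (S y u v) = S y v (std_J u) - std_J (S y v u)"
    and curv: "\<And>y u v w. y \<in> V \<Longrightarrow> dderiv u (\<lambda>y. S y v w) y - dderiv v (\<lambda>y. S y u w) y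
        + S y u (S y v w) - S y v (S y u w) = 0"
  obtains r f where "r > 0" "ball y0 r \<subseteq> V" "holomorphic_several_on f (ball y0 r)"
    "\<And>y. y \<in> ball y0 r \<Longrightarrow> isotropic_support P (d3 f y)"
    "\<And>y. y \<in> ball y0 r \<Longrightarrow> S_endo P f y = S y"
proof -
  have s12: "std_omega P (S y u v) w = std_omega P (S y v u) w" if "y \<in> V" for y u v w using sym[OF that] by simp
  have s23: "std_omega P (S y u v) w = std_omega P (S y u w) v" if "y \<in> V" for y u v w
    using skew[OF that, of u v w] std_omega_commute[of P v] by simp
  have SJ1: "S y u (std_J v) = S y (std_J u) v" if "y \<in> V" for y u v
    using SJ[OF that, of u v] sym[OF that, of u v] sym[OF that, of v "std_J u"] by simp
  have om: "std_omega P a (std_J b) = - std_omega P (std_J a) b" for a b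
    by (simp add: std_omega_eq std_J_def std_herm_simps)
  \<comment> \<open>\<open>SJ1\<close> moves \<open>std_J\<close> between the first two arguments
    and total symmetry brings it to the third, where compatibility of omega with J supplies the
    sign.\<close>
  have SJ2: "S y u (std_J v) = - std_J (S y u v)" if y: "y \<in> V" for y u v
  proof (rule std_omega_ext)
    fix w
    have "std_omega P (S y u (std_J v)) w = std_omega P (S y w (std_J v)) u"
      using s12[OF y] s23[OF y] by metis
    also have "\<dots> = std_omega P (S y (std_J w) v) u" using SJ1[OF y] by simp
    also have "\<dots> = std_omega P (S y u v) (std_J w)"
      using s12[OF y] s23[OF y] by metis
    also have "\<dots> = std_omega P (- std_J (S y u v)) w" by (simp add: om std_omega_simps)
    finally show "std_omega P (S y u (std_J v)) w = std_omega P (- std_J (S y u v)) w" .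
  qed
  note lin = bilinear_ladd[OF bil] bilinear_radd[OF bil] bilinear_lneg[OF bil] bilinear_rneg[OF bil]
    bilinear_lmul[OF bil] bilinear_rmul[OF bil]
  have smult: "a *s u = Re a *\<^sub>R u + Im a *\<^sub>R std_J u" for a and u :: "complex ^ 'n"
    by (simp add: std_J_def scaleR_eq_smult vec_eq_iff complex_eq_iff)
  have anti2: "S y u (a *s v) = cnj a *s S y u v" if "y \<in> V" for y u v a
    unfolding smult[of a v] smult[of "cnj a"] by (simp add: lin[OF that] SJ2[OF that])
  text \<open>The derivative terms of the curvature are \<open>J\<close>-antilinear, the commutator is \<open>J\<close>-linear.\<close>
  have dS: "dderiv u (\<lambda>y. S y v w) y = dderiv v (\<lambda>y. S y u w) y"
    and comm: "S y u (S y v w) = S y v (S y u w)" if y: "y \<in> V" for y u v w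
  proof -
    define Ed where "Ed w = dderiv u (\<lambda>y. S y v w) y - dderiv v (\<lambda>y. S y u w) y" for w
    define Kc where "Kc w = S y u (S y v w) - S y v (S y u w)" for w
    have 1: "Ed w + Kc w = 0" for w using curv[OF y, of u v w] by (simp only: Ed_def Kc_def add_diff_eq)
    have d: "dderiv h (\<lambda>y. S y v (std_J w)) y = - std_J (dderiv h (\<lambda>y. S y v w) y)" for h v w
    proof -
      have "((\<lambda>y. - std_J (S y v w)) has_derivative (\<lambda>h. - std_J (dderiv h (\<lambda>y. S y v w) y))) (at y)"
        by (intro has_derivative_minus bounded_linear.has_derivative[OF linear_conv_bounded_linear[THEN iffD1, OF linear_std_J]]
            smooth_on_has_derivative[OF sm y])
      from dderiv_cong[OF op y SJ2] dderiv_eq[OF this] show ?thesis by (rule trans)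
    qed
    have "Ed (std_J w) = - std_J (Ed w)" by (simp add: Ed_def d linear_diff[OF linear_std_J])
    moreover have "Kc (std_J w) = std_J (Kc w)"
      by (simp add: Kc_def SJ2[OF y] lin[OF y] linear_diff[OF linear_std_J])
    ultimately have "std_J (Kc w - Ed w) = 0" using 1[of "std_J w"] by (simp add: linear_diff[OF linear_std_J])
    then have "std_J (std_J (Kc w - Ed w)) = 0" by (simp add: linear_0[OF linear_std_J])
    then have "Kc w = Ed w" by (simp add: std_J_J)
    moreover from this have "2 *\<^sub>R Ed w = 0" using 1[of w] by (simp add: scaleR_2)
    ultimately have "Ed w = 0" "Kc w = 0" by simp_all
    then show "dderiv u (\<lambda>y. S y v w) y = dderiv v (\<lambda>y. S y u w) y" "S y u (S y v w) = S y v (S y u w)"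
      by (simp_all add: Ed_def Kc_def)
  qed
  have SS: "S y u (S y v w) = 0" if y: "y \<in> V" for y u v w
  proof -
    have "S y (std_J u) (S y v w) = S y v (S y (std_J u) w)" by (rule comm[OF y])
    then have "- std_J (S y u (S y v w)) = std_J (S y u (S y v w))"
      using SJ1[OF y, symmetric] SJ2[OF y] comm[OF y, of u v w] by (simp add: lin[OF y] std_J_J)
    then have "std_J (S y u (S y v w)) + std_J (S y u (S y v w)) = 0" by (metis add.right_inverse)
    then have "2 *\<^sub>R std_J (S y u (S y v w)) = 0" by (simp add: scaleR_2)
    then have "std_J (std_J (S y u (S y v w))) = 0" by (simp add: linear_0[OF linear_std_J])
    then show ?thesis by (simp add: std_J_J)
  qed
  \<comment> \<open>The complex cubic form with omega (S u v, w) = 2 Re T. Antilinearity of the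
    Hermitian product in its second argument compensates that of \<open>S\<close>, so
    \<open>T\<close> is complex trilinear.\<close>
  define T where "T y u v w = - (\<i> / 2) * std_herm P w (S y u v)" for y u v w
  have T12: "T y u v w = T y v u w" if "y \<in> V" for y u v w using sym[OF that] by (simp add: T_def)
  have T23: "T y u v w = T y u w v" if y: "y \<in> V" for y u v w
  proof -
    have Im: "Im (std_herm P w (S y u v)) = Im (std_herm P v (S y u w))" for v w
      using s23[OF y, of u v w] std_omega_commute[of P "S y u v" w] std_omega_commute[of P "S y u w" v]
      by (simp add: std_omega_eq)
    have "Re (std_herm P w (S y u v)) = Re (std_herm P v (S y u w))"
      using Im[of "std_J w" v] SJ2[OF y, of u w] by (simp add: std_J_def std_herm_simps)
    then have "std_herm P w (S y u v) = std_herm P v (S y u w)" using Im by (simp add: complex_eq_iff)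
    then show ?thesis by (simp add: T_def)
  qed
  have Tlin3: "complex_linear (T y u v)" for y u v
    by (simp add: complex_linear_def T_def std_herm_simps algebra_simps)
  have Tlin2: "complex_linear (\<lambda>v. T y u v w)" if "y \<in> V" for y u w
    using Tlin3[of y u w] T23[OF that, of u _ w] by simp
  have Tlin1: "complex_linear (\<lambda>u. T y u v w)" if "y \<in> V" for y v w
    using Tlin2[OF that, of v w] T12[OF that, of _ v w] by simp
  have Tre: "2 * Re (T y u v w) = std_omega P (S y u v) w" for y u v w
    using std_omega_commute[of P "S y u v" w] by (simp add: T_def std_omega_eq)
  have bh: "bounded_linear (\<lambda>s. - (\<i> / 2) * std_herm P w s)" for w
    by (rule linear_conv_bounded_linear[THEN iffD1]) (auto intro!: linearI simp: std_herm_simps algebra_simps)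
  have Tsm: "smooth_on V (\<lambda>y. T y u v w)" for u v w
    unfolding T_def by (rule smooth_on_linear[OF bh op sm])
  have dT: "dderiv u (\<lambda>y. T y v w x) y = dderiv v (\<lambda>y. T y u w x) y" if y: "y \<in> V" for y u v w x
  proof -
    have "dderiv u (\<lambda>y. T y v w x) y = - (\<i> / 2) * std_herm P x (dderiv u (\<lambda>y. S y v w) y)" for u v
      unfolding T_def by (rule dderiv_eq) (rule bounded_linear.has_derivative[OF bh smooth_on_has_derivative[OF sm y]])
    then show ?thesis using dS[OF y] by simp
  qed
  have real: "complex_linear L \<Longrightarrow> linear L" for L :: "complex ^ 'n \<Rightarrow> complex"
    by (auto intro!: linearI simp: complex_linear_def scaleR_eq_smult scaleR_conv_of_real)

  \<comment> \<open>\<open>T\<close> is integrated three times, as the future third derivative of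
    \<open>f\<close>: first to a matrix of second derivatives, then to the gradient
    \<open>h2\<close>, and finally to \<open>f\<close>.\<close>
  define w1 where "w1 y u = (\<chi> k l. T y u (axis k 1) (axis l 1))" for y u
  obtain r1 h1 where r1: "r1 > 0" "ball y0 r1 \<subseteq> V" "smooth_on (ball y0 r1) h1"
    "\<And>y. y \<in> ball y0 r1 \<Longrightarrow> (h1 has_derivative w1 y) (at y)"
  proof (rule poincare_lemma[OF op y0, of w1])
    show "linear (w1 y)" if "y \<in> V" for y
      using linear_add[OF real[OF Tlin1[OF that]]] linear_scale[OF real[OF Tlin1[OF that]]]
      by (auto intro!: linearI simp: w1_def vec_eq_iff)
    show smw: "smooth_on V (\<lambda>y. w1 y v)" for v
      unfolding w1_def by (intro smooth_on_vec[OF op] Tsm)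
    show "dderiv u (\<lambda>y. w1 y v) y = dderiv v (\<lambda>y. w1 y u) y" if y: "y \<in> V" for y u v
    proof -
      have "dderiv u (\<lambda>y. w1 y v) y $ k $ l = dderiv u (\<lambda>y. T y v (axis k 1) (axis l 1)) y" for u v k l
      proof -
        have "((\<lambda>y. w1 y v $ k $ l) has_derivative (\<lambda>u. dderiv u (\<lambda>y. w1 y v) y $ k $ l)) (at y)"
          by (intro bounded_linear.has_derivative[OF bounded_linear_vec_nth] smooth_on_has_derivative[OF smw y])
        from dderiv_eq[OF this, of u] show ?thesis by (simp add: w1_def)
      qed
      then show ?thesis using dT[OF y] by (simp add: vec_eq_iff)
    qed
  qed (use that in blast)
  \<comment> \<open>The primitive \<open>h1\<close> is determined up to a constant matrix, which may
    fail to be symmetric. Symmetrising keeps the derivative, because \<open>T\<close> is symmetric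
    in its last two arguments, and makes \<open>w3\<close> closed.\<close>
  define q where "q k l y = (h1 y $ k $ l + h1 y $ l $ k) / 2" for k l y
  have qsym: "q k l = q l k" for k l by (simp add: q_def fun_eq_iff add.commute)
  have bn: "bounded_linear (\<lambda>h :: complex ^ 'n ^ 'n. (h $ k $ l + h $ l $ k) / 2)" for k l
    by (intro bounded_linear_compose[OF bounded_linear_divide] bounded_linear_add
        bounded_linear_compose[OF bounded_linear_vec_nth bounded_linear_vec_nth])
  have dq: "(q k l has_derivative (\<lambda>u. T y u (axis k 1) (axis l 1))) (at y)" if y: "y \<in> ball y0 r1" for k l y
  proof -
    have "(q k l has_derivative (\<lambda>u. (w1 y u $ k $ l + w1 y u $ l $ k) / 2)) (at y)"
      unfolding q_def by (rule bounded_linear.has_derivative[OF bn r1(4)[OF y]])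
    moreover have "y \<in> V" using y r1(2) by blast
    ultimately show ?thesis using T23[of y _ "axis l 1" "axis k 1"] by (simp add: w1_def)
  qed
  have smq: "smooth_on (ball y0 r1) (q k l)" for k l
    unfolding q_def by (rule smooth_on_linear[OF bn open_ball r1(3)])
  have bm: "bounded_linear (\<lambda>x. a * x)" for a :: complex by (rule bounded_linear_mult_right)
  define w2 where "w2 y u = (\<chi> l. \<Sum>k\<in>UNIV. u $ k * q k l y)" for y and u :: "complex ^ 'n"
  have dw2: "((\<lambda>y. \<Sum>k\<in>UNIV. u $ k * q k l y) has_derivative (\<lambda>v. T y v u (axis l 1))) (at y)"
    if y: "y \<in> ball y0 r1" for y u l
  proof -
    have yV: "y \<in> V" using y r1(2) by blast
    have "((\<lambda>y. \<Sum>k\<in>UNIV. u $ k * q k l y) has_derivative (\<lambda>v. \<Sum>k\<in>UNIV. u $ k * T y v (axis k 1) (axis l 1))) (at y)"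
      by (intro has_derivative_sum has_derivative_mult_right dq y)
    then show ?thesis using complex_linear_expand[OF Tlin2[OF yV], of _ u "axis l 1"] by simp
  qed
  obtain r2 h2 where r2: "r2 > 0" "ball y0 r2 \<subseteq> ball y0 r1" "smooth_on (ball y0 r2) h2"
    "\<And>y. y \<in> ball y0 r2 \<Longrightarrow> (h2 has_derivative w2 y) (at y)"
  proof (rule poincare_lemma[OF open_ball[of y0 r1], of y0 w2])
    show "linear (w2 y)" for y
      by (auto intro!: linearI simp: w2_def vec_eq_iff algebra_simps sum.distrib scaleR_sum_right)
    show smw: "smooth_on (ball y0 r1) (\<lambda>y. w2 y v)" for v
      unfolding w2_def by (intro smooth_on_vec[OF open_ball] smooth_on_sum[OF open_ball] smooth_on_linear[OF bm open_ball] smq)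
    show "dderiv u (\<lambda>y. w2 y v) y = dderiv v (\<lambda>y. w2 y u) y" if y: "y \<in> ball y0 r1" for y u v
    proof -
      have "dderiv u (\<lambda>y. w2 y v) y $ l = T y u v (axis l 1)" for u v l
        unfolding dderiv_vec_nth[OF smooth_on_differentiable[OF smw y]]
        using dderiv_eq[OF dw2[OF y], of u v l] by (simp add: w2_def)
      then show ?thesis using T12[of y u v] y r1(2) by (auto simp: vec_eq_iff)
    qed
  qed (use that r1 in auto)
  define w3 where "w3 y u = (\<Sum>l\<in>UNIV. u $ l * h2 y $ l)" for y and u :: "complex ^ 'n"
  have dw3: "((\<lambda>y. w3 y u) has_derivative (\<lambda>v. \<Sum>l\<in>UNIV. u $ l * (\<Sum>k\<in>UNIV. v $ k * q k l y))) (at y)"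
    if y: "y \<in> ball y0 r2" for y u
  proof -
    have "((\<lambda>y. w3 y u) has_derivative (\<lambda>v. \<Sum>l\<in>UNIV. u $ l * w2 y v $ l)) (at y)"
      unfolding w3_def
      by (intro has_derivative_sum has_derivative_mult_right bounded_linear.has_derivative[OF bounded_linear_vec_nth] r2(4) y)
    then show ?thesis by (simp add: w2_def)
  qed
  obtain r f where r: "r > 0" "ball y0 r \<subseteq> ball y0 r2" "smooth_on (ball y0 r) f"
    "\<And>y. y \<in> ball y0 r \<Longrightarrow> (f has_derivative w3 y) (at y)"
  proof (rule poincare_lemma[OF open_ball[of y0 r2], of y0 w3])
    show "linear (w3 y)" for y
      by (auto intro!: linearI simp: w3_def algebra_simps sum.distrib scaleR_sum_right)
    show smw: "smooth_on (ball y0 r2) (\<lambda>y. w3 y v)" for v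
      unfolding w3_def
      by (intro smooth_on_sum[OF open_ball] smooth_on_linear[OF bm open_ball] smooth_on_linear[OF bounded_linear_vec_nth open_ball r2(3)])
    show "dderiv u (\<lambda>y. w3 y v) y = dderiv v (\<lambda>y. w3 y u) y" if y: "y \<in> ball y0 r2" for y u v
      unfolding dderiv_eq[OF dw3[OF y]] sum_distrib_left
      by (subst sum.swap) (simp add: qsym mult_ac)
  qed (use that r2 in auto)
  \<comment> \<open>The differential \<open>w3 y\<close> depends on the direction only through its
    complex coordinates, linearly; no Cauchy-Riemann equations have to be integrated.\<close>
  have hol: "holomorphic_several_on f (ball y0 r)"
    by (rule holomorphic_severalI[OF r(4)]) (simp_all add: w3_def sum_distrib_left mult_ac)
  have f3: "dderiv u (dderiv v (dderiv w f)) y = T y u v w" if y: "y \<in> ball y0 r" for y u v w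
  proof -
    have 1: "dderiv v (dderiv w f) x = (\<Sum>l\<in>UNIV. w $ l * (\<Sum>k\<in>UNIV. v $ k * q k l x))" if x: "x \<in> ball y0 r" for x
    proof -
      have "dderiv v (dderiv w f) x = dderiv v (\<lambda>y. w3 y w) x"
        by (rule dderiv_cong[OF open_ball x dderiv_eq[OF r(4)]])
      then show ?thesis using dderiv_eq[OF dw3] x r(2) by auto
    qed
    have y1: "y \<in> ball y0 r1" and yV: "y \<in> V" using y r(2) r2(2) r1(2) by blast+
    have "((\<lambda>x. \<Sum>l\<in>UNIV. w $ l * (\<Sum>k\<in>UNIV. v $ k * q k l x)) has_derivative
        (\<lambda>u. \<Sum>l\<in>UNIV. w $ l * T y u v (axis l 1))) (at y)"
      by (intro has_derivative_sum has_derivative_mult_right dw2 y1)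
    note d = dderiv_eq[OF this, of u]
    have "dderiv u (dderiv v (dderiv w f)) y = dderiv u (\<lambda>x. \<Sum>l\<in>UNIV. w $ l * (\<Sum>k\<in>UNIV. v $ k * q k l x)) y"
      by (rule dderiv_cong[OF open_ball y 1])
    then show ?thesis
      by (simp only: d complex_linear_expand[OF Tlin3[of y u v], of w])
  qed
  have Sf: "S_endo P f y = S y" if y: "y \<in> ball y0 r" for y
    by (intro ext S_endo_unique[OF hol open_ball y]) (simp add: f3[OF y] Tre)
  have "isotropic_support P (d3 f y)" if y: "y \<in> ball y0 r" for y
  proof -
    have yV: "y \<in> V" using y r(2) r2(2) r1(2) by blast
    \<comment> \<open>This product is \<open>T\<close> with \<open>S y a b\<close> as third
      argument. Exchanging the last two arguments brings it inside \<open>S\<close>, where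
      \<open>SS\<close> applies.\<close>
    have "std_herm P (S y a b) (S y a' b') = 0" for a b a' b'
      using T23[OF yV, of a' b' "S y a b"] by (simp add: T_def SS[OF yV] std_herm_def)
    then show ?thesis unfolding isotropic_support_iff[OF hol open_ball y] Sf[OF y] by blast
  qed
  then show ?thesis using that[OF r(1) _ hol _ Sf] r(2) r2(2) r1(2) by blast
qed

section \<open>Flat coordinates\<close>

lemma derivative_zero_ball:
  assumes "\<And>z. z \<in> ball z0 r \<Longrightarrow> (c has_derivative (\<lambda>_. 0)) (at z)" "z \<in> ball z0 r"
  shows "c z = c z0"
proof -
  have "\<exists>k. \<forall>x\<in>ball z0 r. c x = k"
    by (rule has_derivative_zero_constant[OF convex_ball has_derivative_at_withinI[OF assms(1)]])
  moreover have "z0 \<in> ball z0 r" using assms(2) zero_le_dist[of z0 z] unfolding mem_ball dist_self by linarith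
  ultimately show ?thesis using assms(2) by auto
qed

text \<open>\<open>X\<close> is a parallel frame with prescribed values at \<open>z0\<close>,
  \<open>Y\<close> the dual parallel coframe, and \<open>t\<close> the coordinates with differential
  \<open>Y\<close>. The coframe is obtained from its own equation, which gives its smoothness
  without inverting the frame.\<close>

lemma flat_frame:
  fixes D :: "'e::euclidean_space \<Rightarrow> 'e \<Rightarrow> 'e \<Rightarrow> 'e" and \<Psi> :: "'f::euclidean_space \<Rightarrow> 'e"
  assumes op: "open W" and z0: "z0 \<in> W"
    and bil: "\<And>z. z \<in> W \<Longrightarrow> bilinear (D z)" and sm: "\<And>u v. smooth_on W (\<lambda>z. D z u v)"
    and sym: "\<And>z u v. z \<in> W \<Longrightarrow> D z u v = D z v u"
    and flat: "\<And>z u v w. z \<in> W \<Longrightarrow> dderiv u (\<lambda>y. D y v w) z - dderiv v (\<lambda>y. D y u w) z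
      + D z u (D z v w) - D z v (D z u w) = 0"
    and \<Psi>: "linear \<Psi>" "bij \<Psi>"
  obtains r X Y t where "r > 0" "ball z0 r \<subseteq> W"
    "\<And>u. X u z0 = \<Psi> u" "\<And>u. smooth_on (ball z0 r) (X u)"
    "\<And>u z. z \<in> ball z0 r \<Longrightarrow> (X u has_derivative (\<lambda>v. - D z v (X u z))) (at z)"
    "\<And>z. z \<in> ball z0 r \<Longrightarrow> linear (Y z)" "\<And>v. smooth_on (ball z0 r) (\<lambda>z. Y z v)"
    "\<And>z v. z \<in> ball z0 r \<Longrightarrow> ((\<lambda>z. Y z v) has_derivative (\<lambda>u. Y z (D z u v))) (at z)"
    "\<And>z u. z \<in> ball z0 r \<Longrightarrow> Y z (X u z) = u" "\<And>z v. z \<in> ball z0 r \<Longrightarrow> X (Y z v) z = v"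
    "smooth_on (ball z0 r) t" "\<And>z. z \<in> ball z0 r \<Longrightarrow> (t has_derivative Y z) (at z)"
proof -
  note bl = bilinear_ladd[OF bil] bilinear_radd[OF bil] bilinear_lmul[OF bil] bilinear_rmul[OF bil]
    bilinear_rneg[OF bil]
  have flat': "dderiv u (\<lambda>y. D y v w) z + D z u (D z v w) = dderiv v (\<lambda>y. D y u w) z + D z v (D z u w)" if "z \<in> W" for z u v w
    using flat[OF that, of u v w] by (simp add: algebra_simps)
  obtain r1 where r1: "r1 > 0" "ball z0 r1 \<subseteq> W"
    "\<And>p0. \<exists>p. p z0 = p0 \<and> smooth_on (ball z0 r1) p \<and> (\<forall>z\<in>ball z0 r1. (p has_derivative (\<lambda>v. - D z v (p z))) (at z))"
  proof (rule total_differential_equation[OF op z0, of "\<lambda>z v x. - D z v x"])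
    show "bilinear (\<lambda>v x. - D z v x)" if "z \<in> W" for z
      by (auto simp: bilinear_def bl[OF that] intro!: linearI)
    show "smooth_on W (\<lambda>z. - D z v x)" for v x by (rule smooth_on_minus[OF op sm])
    show "dderiv u (\<lambda>y. - D y v x) z + - D z v (- D z u x) = dderiv v (\<lambda>y. - D y u x) z + - D z u (- D z v x)"
      if z: "z \<in> W" for z u v x
    proof -
      have "dderiv u (\<lambda>y. - D y v x) z = - dderiv u (\<lambda>y. D y v x) z" for u v
        by (rule dderiv_eq) (rule has_derivative_minus[OF smooth_on_has_derivative[OF sm z]])
      then show ?thesis using flat'[OF z, of u v x] by (simp add: bl[OF z] algebra_simps)
    qed
  qed (use that in blast)
  \<comment> \<open>The adjoint of \<open>D z v\<close>: with one-forms represented through the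
    inner product, dp(v) = A v p says that the one-form \<open>p\<close> is parallel. Its
    integrability is again flatness of \<open>D\<close>.\<close>
  define A where "A z v p = (\<Sum>i\<in>Basis. (p \<bullet> D z v i) *\<^sub>R i)" for z v and p :: 'e
  have A_inner: "A z v p \<bullet> w = p \<bullet> D z v w" if "z \<in> W" for z v p w
  proof -
    have "p \<bullet> D z v w = p \<bullet> (\<Sum>i\<in>Basis. (w \<bullet> i) *\<^sub>R D z v i)"
      using linear_basis_expand[OF bilinear_linear_right[OF bil[OF that]], of v w] by simp
    also have "\<dots> = A z v p \<bullet> w" by (simp add: A_def inner_sum_left inner_sum_right inner_commute mult.commute)
    finally show ?thesis by simp
  qed
  obtain r2 where r2: "r2 > 0" "ball z0 r2 \<subseteq> W"
    "\<And>p0. \<exists>p. p z0 = p0 \<and> smooth_on (ball z0 r2) p \<and> (\<forall>z\<in>ball z0 r2. (p has_derivative (\<lambda>v. A z v (p z))) (at z))"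
  proof (rule total_differential_equation[OF op z0, of A])
    have bd: "bounded_linear (\<lambda>d. (p \<bullet> d) *\<^sub>R i)" for p i :: 'e
      by (rule bounded_linear_compose[OF bounded_linear_scaleR_left bounded_linear_inner_right])
    show "bilinear (A z)" if "z \<in> W" for z
      by (auto simp: bilinear_def bl[OF that] A_def inner_add algebra_simps sum.distrib scaleR_sum_right intro!: linearI)
    show "smooth_on W (\<lambda>z. A z v x)" for v x unfolding A_def by (intro smooth_on_sum[OF op] smooth_on_linear[OF bd op] sm)
    show "dderiv u (\<lambda>y. A y v x) z + A z v (A z u x) = dderiv v (\<lambda>y. A y u x) z + A z u (A z v x)"
      if z: "z \<in> W" for z u v x
    proof -
      have "dderiv u (\<lambda>y. A y v x) z + A z v (A z u x) = (\<Sum>i\<in>Basis. (x \<bullet> (dderiv u (\<lambda>y. D y v i) z + D z u (D z v i))) *\<^sub>R i)" for u v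
      proof -
        have "((\<lambda>y. A y v x) has_derivative (\<lambda>u. \<Sum>i\<in>Basis. (x \<bullet> dderiv u (\<lambda>y. D y v i) z) *\<^sub>R i)) (at z)"
          unfolding A_def by (intro has_derivative_sum bounded_linear.has_derivative[OF bd] smooth_on_has_derivative[OF sm z])
        moreover have "A z v (A z u x) = (\<Sum>i\<in>Basis. (x \<bullet> D z u (D z v i)) *\<^sub>R i)"
          unfolding A_def[of z v] A_inner[OF z] ..
        ultimately show ?thesis by (simp add: dderiv_eq inner_add_right scaleR_add_left sum.distrib)
      qed
      then show ?thesis using flat'[OF z, of u v] by simp
    qed
  qed (use that in blast)
  define r3 where "r3 = min r1 r2"
  have r3: "r3 > 0" "ball z0 r3 \<subseteq> W" using r1 r2 by (auto simp: r3_def)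
  have sub: "ball z0 r3 \<subseteq> ball z0 r1" "ball z0 r3 \<subseteq> ball z0 r2" by (auto simp: r3_def)
  define X where "X u = (SOME p. p z0 = \<Psi> u \<and> smooth_on (ball z0 r1) p
      \<and> (\<forall>z\<in>ball z0 r1. (p has_derivative (\<lambda>v. - D z v (p z))) (at z)))" for u
  have "X u z0 = \<Psi> u \<and> smooth_on (ball z0 r1) (X u)
      \<and> (\<forall>z\<in>ball z0 r1. (X u has_derivative (\<lambda>v. - D z v (X u z))) (at z))" for u
    unfolding X_def by (rule someI_ex[OF r1(3)])
  then have X: "\<And>u. X u z0 = \<Psi> u" "\<And>u. smooth_on (ball z0 r1) (X u)"
    "\<And>u z. z \<in> ball z0 r1 \<Longrightarrow> (X u has_derivative (\<lambda>v. - D z v (X u z))) (at z)" by blast+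
  \<comment> \<open>This vector represents the functional taking v to the \<open>b\<close>-component
    of \<open>inv \<Psi> v\<close>, so that \<open>Y z0\<close> will be the inverse of
    \<open>\<Psi>\<close>.\<close>
  define p0 where "p0 b = (\<Sum>i\<in>Basis. (inv \<Psi> i \<bullet> b) *\<^sub>R i)" for b
  define p where "p b = (SOME p. p z0 = p0 b \<and> smooth_on (ball z0 r2) p
      \<and> (\<forall>z\<in>ball z0 r2. (p has_derivative (\<lambda>v. A z v (p z))) (at z)))" for b
  have "p b z0 = p0 b \<and> smooth_on (ball z0 r2) (p b)
      \<and> (\<forall>z\<in>ball z0 r2. (p b has_derivative (\<lambda>v. A z v (p b z))) (at z))" for b
    unfolding p_def by (rule someI_ex[OF r2(3)])
  then have p: "\<And>b. p b z0 = p0 b" "\<And>b. smooth_on (ball z0 r2) (p b)"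
    "\<And>b z. z \<in> ball z0 r2 \<Longrightarrow> (p b has_derivative (\<lambda>v. A z v (p b z))) (at z)" by blast+
  define Y where "Y z v = (\<Sum>b\<in>Basis. (p b z \<bullet> v) *\<^sub>R b)" for z v
  have linY: "linear (Y z)" for z
    by (auto intro!: linearI simp: Y_def inner_add_right algebra_simps sum.distrib scaleR_sum_right)
  have bd: "bounded_linear (\<lambda>p. (p \<bullet> v) *\<^sub>R b)" for v :: 'e and b :: 'f
    by (rule bounded_linear_compose[OF bounded_linear_scaleR_left bounded_linear_inner_left])
  have smY: "smooth_on (ball z0 r3) (\<lambda>z. Y z v)" for v
    unfolding Y_def by (intro smooth_on_sum[OF open_ball] smooth_on_linear[OF bd open_ball] smooth_on_subset[OF p(2) sub(2)])
  have dY: "((\<lambda>z. Y z v) has_derivative (\<lambda>u. Y z (D z u v))) (at z)" if z: "z \<in> ball z0 r3" for z v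
  proof -
    have "((\<lambda>z. Y z v) has_derivative (\<lambda>u. \<Sum>b\<in>Basis. (A z u (p b z) \<bullet> v) *\<^sub>R b)) (at z)"
      unfolding Y_def using z sub by (intro has_derivative_sum bounded_linear.has_derivative[OF bd] p(3)) auto
    moreover have "z \<in> W" using z r3 by blast
    ultimately show ?thesis by (simp add: A_inner Y_def)
  qed
  have linI: "linear (inv \<Psi>)"
  proof
    have I: "\<Psi> (inv \<Psi> x) = x" "inv \<Psi> (\<Psi> u) = u" for x u
      using \<Psi>(2) by (simp_all add: bij_is_inj bij_is_surj surj_f_inv_f)
    show "inv \<Psi> (a + b) = inv \<Psi> a + inv \<Psi> b" for a b
      using I(2)[of "inv \<Psi> a + inv \<Psi> b"] by (simp add: linear_add[OF \<Psi>(1)] I(1))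
    show "inv \<Psi> (c *\<^sub>R a) = c *\<^sub>R inv \<Psi> a" for c a
      using I(2)[of "c *\<^sub>R inv \<Psi> a"] by (simp add: linear_scale[OF \<Psi>(1)] I(1))
  qed
  have Y0: "Y z0 v = inv \<Psi> v" for v
  proof -
    have "p b z0 \<bullet> v = inv \<Psi> v \<bullet> b" for b
      using arg_cong[OF linear_basis_expand[OF linI, of v], of "\<lambda>x. x \<bullet> b"]
      by (simp add: p(1) p0_def inner_sum_right inner_sum_left inner_commute[of _ v] mult.commute)
    then show ?thesis by (simp add: Y_def euclidean_representation)
  qed
  \<comment> \<open>A parallel form evaluated on a parallel field is constant, and at
    \<open>z0\<close> the maps are inverse to each other.\<close>
  have YX: "Y z (X u z) = u" if z: "z \<in> ball z0 r3" for z u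
  proof -
    have "((\<lambda>z. Y z (X u z)) has_derivative (\<lambda>_. 0)) (at z)" if z: "z \<in> ball z0 r3" for z
    proof -
      have "((\<lambda>z. Y z (X u z)) has_derivative (\<lambda>h. dderiv h (\<lambda>y. Y y (X u z)) z + Y z (- D z h (X u z)))) (at z)"
        by (rule has_derivative_linear_family[OF open_ball z linY smooth_on_differentiable[OF smY z] X(3)]) (use z sub in auto)
      then show ?thesis by (simp add: dderiv_eq[OF dY[OF z]] linear_neg[OF linY])
    qed
    from derivative_zero_ball[OF this z] have "Y z (X u z) = Y z0 (X u z0)" .
    then show ?thesis using \<Psi>(2) by (simp add: Y0 X(1) bij_is_inj inv_f_f)
  qed
  \<comment> \<open>\<open>Y z\<close> is surjective by \<open>YX\<close>. Composed with
    \<open>\<Psi>\<close> it is a surjective, hence injective, endomorphism of a finite-dimensional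
    space; so the one-sided inverse is two-sided.\<close>
  have XY: "X (Y z v) z = v" if z: "z \<in> ball z0 r3" for z v
  proof -
    have "surj (\<Psi> \<circ> Y z)" using YX[OF z] \<Psi>(2) by (intro comp_surj) (auto simp: bij_def intro!: surjI)
    then have "inj (\<Psi> \<circ> Y z)" using linear_surjective_imp_injective[OF linear_compose[OF linY \<Psi>(1)]] by blast
    then have "inj (Y z)" using inj_on_imageI2 by blast
    then show ?thesis using YX[OF z, of "Y z v"] by (simp add: inj_eq)
  qed
  obtain r t where t: "r > 0" "ball z0 r \<subseteq> ball z0 r3" "smooth_on (ball z0 r) t"
    "\<And>z. z \<in> ball z0 r \<Longrightarrow> (t has_derivative Y z) (at z)"
  proof (rule poincare_lemma[OF open_ball[of z0 r3], of z0 Y])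
    \<comment> \<open>A parallel coframe is closed exactly because \<open>D\<close> is
      torsion-free.\<close>
    show "dderiv u (\<lambda>y. Y y v) z = dderiv v (\<lambda>y. Y y u) z" if z: "z \<in> ball z0 r3" for z u v
      using sym[of z u v] z r3(2) by (auto simp: dderiv_eq[OF dY[OF z]])
  qed (use that r3 linY smY in auto)
  have sub1: "ball z0 r \<subseteq> ball z0 r1" and subW: "ball z0 r \<subseteq> W" using t(2) sub(1) r3(2) by blast+
  show ?thesis
  proof (rule that[of r X Y t])
    show "smooth_on (ball z0 r) (X u)" for u by (rule smooth_on_subset[OF X(2) sub1])
    show "smooth_on (ball z0 r) (\<lambda>z. Y z v)" for v by (rule smooth_on_subset[OF smY t(2)])
    show "(X u has_derivative (\<lambda>v. - D z v (X u z))) (at z)" if "z \<in> ball z0 r" for u z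
      by (rule X(3)) (use that sub1 in blast)
    fix z assume "z \<in> ball z0 r"
    then have z: "z \<in> ball z0 r3" using t(2) by blast
    show "((\<lambda>z. Y z v) has_derivative (\<lambda>u. Y z (D z u v))) (at z)" for v by (rule dY[OF z])
    show "Y z (X u z) = u" "X (Y z v) z = v" for u v by (rule YX[OF z], rule XY[OF z])
  qed (rule t(1) subW X(1) linY t(3) t(4), assumption?)+
qed

text \<open>\<open>inverse_function_theorem\<close> concerns maps of a space to itself, so
  \<open>t\<close> is composed with the linear map \<open>\<Phi>\<close> inverse to its derivative
  at \<open>z0\<close>. The inverse \<open>s\<close> satisfies ds(u) = X u (s), whose right side is
  as regular as \<open>s\<close>; smoothness follows by bootstrapping.\<close>

lemma smooth_local_inverse:
  fixes t :: "'e::euclidean_space \<Rightarrow> 'f::euclidean_space"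
  assumes op: "open B" and z0: "z0 \<in> B"
    and dt: "\<And>z. z \<in> B \<Longrightarrow> (t has_derivative Y z) (at z)" and smY: "\<And>v. smooth_on B (\<lambda>z. Y z v)"
    and smX: "\<And>u. smooth_on B (X u)" and YX: "\<And>z u. z \<in> B \<Longrightarrow> Y z (X u z) = u"
    and XY: "\<And>z v. z \<in> B \<Longrightarrow> X (Y z v) z = v"
  obtains U V s where "open U" "U \<subseteq> B" "z0 \<in> U" "open V" "t z0 \<in> V" "homeomorphism U V t s"
    "smooth_on V s" "\<And>y. y \<in> V \<Longrightarrow> (s has_derivative (\<lambda>u. X u (s y))) (at y)"
proof -
  have linY: "linear (Y z)" if "z \<in> B" for z using has_derivative_linear[OF dt[OF that]] .
  define \<Phi> where "\<Phi> u = X u z0" for u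
  have lin\<Phi>: "linear \<Phi>"
  proof
    show "\<Phi> (a + b) = \<Phi> a + \<Phi> b" for a b
      using XY[OF z0, of "X a z0 + X b z0"] by (simp add: \<Phi>_def linear_add[OF linY[OF z0]] YX[OF z0])
    show "\<Phi> (c *\<^sub>R a) = c *\<^sub>R \<Phi> a" for a c
      using XY[OF z0, of "c *\<^sub>R X a z0"] by (simp add: \<Phi>_def linear_scale[OF linY[OF z0]] YX[OF z0])
  qed
  have bl: "bounded_linear \<Phi>" using lin\<Phi> linear_conv_bounded_linear by blast
  define F where "F z = Blinfun (\<Phi> \<circ> Y z)" for z
  have F: "blinfun_apply (F z) = \<Phi> \<circ> Y z" if "z \<in> B" for z
    using linear_compose[OF linY[OF that] lin\<Phi>] unfolding F_def
    by (intro bounded_linear_Blinfun_apply) (simp add: linear_conv_bounded_linear)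
  have dF: "((\<Phi> \<circ> t) has_derivative blinfun_apply (F z)) (at z)" if "z \<in> B" for z
    unfolding F[OF that] using bounded_linear.has_derivative[OF bl dt[OF that]] by (simp add: o_def)
  have cF: "continuous_on B F"
  proof (rule continuous_on_blinfun_componentwise)
    fix i :: 'e
    have "continuous_on B (\<lambda>z. \<Phi> (Y z i))"
      by (rule bounded_linear.continuous_on[OF bl smooth_on_continuous[OF smY]])
    then show "continuous_on B (\<lambda>z. blinfun_apply (F z) i)" by (rule continuous_on_eq) (simp add: F)
  qed
  have id: "id_blinfun o\<^sub>L F z0 = id_blinfun"
    by (rule blinfun_eqI) (simp add: F[OF z0] \<Phi>_def XY[OF z0])
  obtain U V g g' where U: "open U" "U \<subseteq> B" "z0 \<in> U" and V: "open V" "(\<Phi> \<circ> t) z0 \<in> V"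
    and hom: "homeomorphism U V (\<Phi> \<circ> t) g" and g: "\<And>y. y \<in> V \<Longrightarrow> (g has_derivative g' y) (at y)"
      "\<And>y. y \<in> V \<Longrightarrow> g' y = inv (blinfun_apply (F (g y)))"
    using inverse_function_theorem[OF op dF cF z0 id] by metis
  define V' where "V' = \<Phi> -` V"
  define s where "s = g \<circ> \<Phi>"
  have opV: "open V'" unfolding V'_def using V(1) bl open_vimage linear_continuous_on by metis
  have inj: "\<Phi> a = \<Phi> b \<longleftrightarrow> a = b" for a b using YX[OF z0] unfolding \<Phi>_def by metis
  have sU: "s y \<in> U" "t (s y) = y" if "y \<in> V'" for y
  proof -
    have "\<Phi> y \<in> V" using that by (simp add: V'_def)
    then show "s y \<in> U" using hom unfolding s_def homeomorphism_def by auto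
    have "\<Phi> (t (s y)) = \<Phi> y" using \<open>\<Phi> y \<in> V\<close> hom unfolding s_def homeomorphism_def by auto
    then show "t (s y) = y" using inj by blast
  qed
  have tV: "t z \<in> V'" "s (t z) = z" if "z \<in> U" for z
    using that hom unfolding s_def homeomorphism_def V'_def by auto
  have ds: "(s has_derivative (\<lambda>u. X u (s y))) (at y)" if y: "y \<in> V'" for y
  proof -
    have y': "\<Phi> y \<in> V" and sB: "s y \<in> B" using y U sU(1)[OF y] by (auto simp: V'_def)
    have "(\<Phi> has_derivative \<Phi>) (at y)" by (rule bounded_linear_imp_has_derivative[OF bl])
    from has_derivative_compose[OF this g(1)[OF y']]
    have "(s has_derivative (\<lambda>u. g' (\<Phi> y) (\<Phi> u))) (at y)" by (simp add: s_def o_def)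
    moreover have "g' (\<Phi> y) (\<Phi> u) = X u (s y)" for u
    proof -
      have "g (\<Phi> y) = s y" by (simp add: s_def)
      then have "g' (\<Phi> y) = inv (\<Phi> \<circ> Y (s y))" by (simp add: g(2)[OF y'] F[OF sB])
      moreover have "inj (\<Phi> \<circ> Y (s y))" using XY[OF sB] inj by (intro injI) (metis comp_apply)
      moreover have "(\<Phi> \<circ> Y (s y)) (X u (s y)) = \<Phi> u" by (simp add: YX[OF sB])
      ultimately show ?thesis by (metis inv_f_f)
    qed
    ultimately show ?thesis by simp
  qed
  have contt: "continuous_on U t"
    using dt U(2) has_derivative_continuous by (meson continuous_at_imp_continuous_on subsetD)
  have conts: "continuous_on V' s"
    using ds has_derivative_continuous by (meson continuous_at_imp_continuous_on)
  have "homeomorphism U V' t s"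
    unfolding homeomorphism_def using sU tV contt conts by (auto simp: image_iff) metis+
  moreover have "smooth_on V' s"
  proof (rule smooth_on_bootstrap[OF opV ds])
    fix k u assume k: "Ck_on k V' s"
    show "Ck_on k V' (\<lambda>y. X u (s y))"
    proof (rule Ck_on_compose[OF opV op _ k])
      show "s ` V' \<subseteq> B" using sU U by blast
      show "Ck_on k B (X u)" using smX by (simp add: smooth_on_def)
    qed
  qed
  ultimately show ?thesis using that[of U V' s] U opV tV(1)[OF U(3)] ds by blast
qed

section \<open>Flat special Kaehler structures in a chart\<close>

text \<open>The structure in one chart, as pointwise identities: \<open>D\<close> and
  \<open>G\<close> hold the Christoffel symbols of the Levi-Civita connection and of the special
  connection. \<open>G\<omega>\<close> and \<open>GJ\<close> restate the conditions on omega and J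
  for the difference tensor, the part due to \<open>D\<close> having been subtracted.\<close>

locale flat_special_kaehler_domain =
  fixes W :: "'e::euclidean_space set" and g :: "'e \<Rightarrow> 'e \<Rightarrow> 'e \<Rightarrow> real" and J :: "'e \<Rightarrow> 'e \<Rightarrow> 'e"
    and D G :: "'e \<Rightarrow> 'e \<Rightarrow> 'e \<Rightarrow> 'e"
  assumes W: "open W"
    and g: "z \<in> W \<Longrightarrow> bilinear (g z)" "smooth_on W (\<lambda>z. g z u v)" "z \<in> W \<Longrightarrow> g z u v = g z v u"
      "z \<in> W \<Longrightarrow> (\<And>v. g z u v = 0) \<Longrightarrow> u = 0"
    and J: "z \<in> W \<Longrightarrow> linear (J z)" "smooth_on W (\<lambda>z. J z u)" "z \<in> W \<Longrightarrow> J z (J z u) = - u"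
      "z \<in> W \<Longrightarrow> g z (J z u) (J z v) = g z u v"
    and D: "z \<in> W \<Longrightarrow> bilinear (D z)" "smooth_on W (\<lambda>z. D z u v)" "z \<in> W \<Longrightarrow> D z u v = D z v u"
      "z \<in> W \<Longrightarrow> dderiv u (\<lambda>y. D y v w) z - dderiv v (\<lambda>y. D y u w) z + D z u (D z v w) - D z v (D z u w) = 0"
    and Dg: "z \<in> W \<Longrightarrow> dderiv h (\<lambda>y. g y a b) z = g z (D z h a) b + g z a (D z h b)"
    and DJ: "z \<in> W \<Longrightarrow> dderiv h (\<lambda>y. J y a) z = J z (D z h a) - D z h (J z a)"
    and G: "z \<in> W \<Longrightarrow> bilinear (G z)" "smooth_on W (\<lambda>z. G z u v)" "z \<in> W \<Longrightarrow> G z u v = G z v u"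
      "z \<in> W \<Longrightarrow> dderiv u (\<lambda>y. G y v w) z - dderiv v (\<lambda>y. G y u w) z + G z u (G z v w) - G z v (G z u w) = 0"
    and G\<omega>: "z \<in> W \<Longrightarrow> g z (J z (G z h a - D z h a)) b = - g z (J z a) (G z h b - D z h b)"
    and GJ: "z \<in> W \<Longrightarrow> (G z a (J z b) - D z a (J z b)) - J z (G z a b - D z a b)
        = (G z b (J z a) - D z b (J z a)) - J z (G z b a - D z b a)"
begin

lemma local_normal_form:
  assumes z0: "z0 \<in> W" and dim: "DIM('e) = 2 * CARD('n)"
  obtains P :: "'n::finite set" and M f U t s where
    "open U" "U \<subseteq> W" "z0 \<in> U" "open M" "homeomorphism U M t s" "smooth_on U t" "smooth_on M s"
    "holomorphic_several_on f M" "\<And>y. y \<in> M \<Longrightarrow> isotropic_support P (d3 f y)"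
    "\<And>z. z \<in> U \<Longrightarrow> form_related t z g (\<lambda>_. std_g P)"
    "\<And>z. z \<in> U \<Longrightarrow> endo_related t z J (\<lambda>_. std_J)"
    "\<And>z. z \<in> U \<Longrightarrow> conn_related t z G (S_endo P f)"
proof -
  obtain P :: "'n set" and \<Psi> where \<Psi>: "linear \<Psi>" "bij \<Psi>" "\<And>w. \<Psi> (\<i> *s w) = J z0 (\<Psi> w)"
    "\<And>u v. g z0 (\<Psi> u) (\<Psi> v) = std_g P u v"
    by (rule hermitian_normal_form[of "g z0" "J z0", OF g(1)[OF z0] g(3)[OF z0] g(4)[OF z0] J(1)[OF z0] J(3)[OF z0] J(4)[OF z0] dim]) (assumption | rule that)+
  obtain r X Y t where r: "r > 0" "ball z0 r \<subseteq> W" and X: "\<And>u. X u z0 = \<Psi> u" "\<And>u. smooth_on (ball z0 r) (X u)"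
    "\<And>u z. z \<in> ball z0 r \<Longrightarrow> (X u has_derivative (\<lambda>v. - D z v (X u z))) (at z)"
    and Y: "\<And>z. z \<in> ball z0 r \<Longrightarrow> linear (Y z)" "\<And>v. smooth_on (ball z0 r) (\<lambda>z. Y z v)"
    "\<And>z v. z \<in> ball z0 r \<Longrightarrow> ((\<lambda>z. Y z v) has_derivative (\<lambda>u. Y z (D z u v))) (at z)"
    and YX: "\<And>z u. z \<in> ball z0 r \<Longrightarrow> Y z (X u z) = u" and XY: "\<And>z v. z \<in> ball z0 r \<Longrightarrow> X (Y z v) z = v"
    and t: "smooth_on (ball z0 r) t" "\<And>z. z \<in> ball z0 r \<Longrightarrow> (t has_derivative Y z) (at z)"
    by (rule flat_frame[of W z0 D \<Psi>, OF W z0 D(1) D(2) D(3) D(4) \<Psi>(1,2)]) (assumption | rule that)+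
  define B where "B = ball z0 r"
  note [folded B_def] = r X(2,3) Y YX XY t
  note r = this(1,2) and X' = this(3,4) and Y = this(5-7) and YX = this(8) and XY = this(9) and t = this(10,11)
  have opB: "open B" and z0B: "z0 \<in> B" using r(1) by (auto simp: B_def)
  have BW: "z \<in> W" if "z \<in> B" for z using that r(2) by blast
  note const = derivative_zero_ball[of z0 r, folded B_def]
  \<comment> \<open>The metric and the frame fields are parallel for \<open>D\<close>, so the
    components of the metric keep the values fixed by \<open>\<Psi>\<close> at \<open>z0\<close>.
    The same argument makes J standard below.\<close>
  have gX: "g z (X u z) (X v z) = std_g P u v" if z: "z \<in> B" for z u v
  proof -
    have "((\<lambda>z. g z (X u z) (X v z)) has_derivative (\<lambda>_. 0)) (at z)" if z: "z \<in> B" for z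
      using has_derivative_bilinear_family[OF opB z g(1)[OF BW] smooth_on_differentiable[OF g(2) BW[OF z]] X'(2)[OF z] X'(2)[OF z], of u v]
      by (simp add: Dg[OF BW[OF z]] bilinear_lneg[OF g(1)[OF BW[OF z]]] bilinear_rneg[OF g(1)[OF BW[OF z]]])
    from const[OF this z] show ?thesis by (simp add: X(1) \<Psi>(4))
  qed
  have dJX: "((\<lambda>z. J z (X u z)) has_derivative (\<lambda>h. - D z h (J z (X u z)))) (at z)" if z: "z \<in> B" for z u
    using has_derivative_linear_family[OF opB z J(1)[OF BW] smooth_on_differentiable[OF J(2) BW[OF z]] X'(2)[OF z], of u]
    by (simp add: DJ[OF BW[OF z]] linear_neg[OF J(1)[OF BW[OF z]]])
  have YJX: "Y z (J z (X u z)) = \<i> *s u" if z: "z \<in> B" for z u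
  proof -
    have "((\<lambda>z. Y z (J z (X u z))) has_derivative (\<lambda>_. 0)) (at z)" if z: "z \<in> B" for z
      using has_derivative_linear_family[OF opB z Y(1) smooth_on_differentiable[OF Y(2) z] dJX[OF z], of u]
      by (simp add: dderiv_eq[OF Y(3)[OF z]] linear_neg[OF Y(1)[OF z]])
    from const[OF this z] have "Y z (J z (X u z)) = Y z0 (X (\<i> *s u) z0)" by (simp add: X(1) \<Psi>(3))
    then show ?thesis using YX[OF z0B] by simp
  qed
  have JX: "J z (X u z) = X (std_J u) z" if "z \<in> B" for z u
    using XY[OF that, of "J z (X u z)"] YJX[OF that] by (simp add: std_J_def)
  have YJ: "Y z (J z a) = std_J (Y z a)" if "z \<in> B" for z a
    using JX[OF that, of "Y z a"] XY[OF that] YX[OF that] by simp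
  have Xadd: "X (u + u') z = X u z + X u' z" and Xscale: "X (c *\<^sub>R u) z = c *\<^sub>R X u z" if z: "z \<in> B" for z u u' c
    using XY[OF z, of "X u z + X u' z"] XY[OF z, of "c *\<^sub>R X u z"]
    by (simp_all add: linear_add[OF Y(1)[OF z]] linear_scale[OF Y(1)[OF z]] YX[OF z])

  define N where "N z u v = G z u v - D z u v" for z u v
  have bilN: "bilinear (N z)" if "z \<in> B" for z
    unfolding N_def
    by (auto simp: bilinear_def bilinear_ladd[OF G(1)[OF BW[OF that]]] bilinear_ladd[OF D(1)[OF BW[OF that]]]
        bilinear_radd[OF G(1)[OF BW[OF that]]] bilinear_radd[OF D(1)[OF BW[OF that]]]
        bilinear_lmul[OF G(1)[OF BW[OF that]]] bilinear_lmul[OF D(1)[OF BW[OF that]]]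
        bilinear_rmul[OF G(1)[OF BW[OF that]]] bilinear_rmul[OF D(1)[OF BW[OF that]]] algebra_simps intro!: linearI)
  have smN: "smooth_on B (\<lambda>z. N z u v)" for u v
    unfolding N_def by (intro smooth_on_diff[OF opB] smooth_on_subset[OF G(2) r(2)] smooth_on_subset[OF D(2) r(2)])
  \<comment> \<open>The components of the difference tensor in the parallel frame, still as
    functions on the original chart.\<close>
  define R where "R z u v = Y z (N z (X u z) (X v z))" for z u v
  have smR: "smooth_on B (\<lambda>z. R z u v)" for u v
    unfolding R_def
    by (intro smooth_on_linear_family[OF opB Y(1) Y(2)] smooth_on_bilinear_family[OF opB bilN smN] X'(1))
  \<comment> \<open>Since frame and coframe are parallel, differentiating the components yields the
    components of the covariant derivative of \<open>N\<close> for \<open>D\<close>.\<close>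
  have dR: "dderiv h (\<lambda>z. R z u v) z = Y z (D z h (N z (X u z) (X v z)) + (dderiv h (\<lambda>y. N y (X u z) (X v z)) z
      - N z (D z h (X u z)) (X v z) - N z (X u z) (D z h (X v z))))" if z: "z \<in> B" for z h u v
  proof -
    have dQ: "((\<lambda>z. N z (X u z) (X v z)) has_derivative (\<lambda>h. dderiv h (\<lambda>y. N y (X u z) (X v z)) z
        + N z (- D z h (X u z)) (X v z) + N z (X u z) (- D z h (X v z)))) (at z)"
      by (rule has_derivative_bilinear_family[OF opB z bilN smooth_on_differentiable[OF smN z] X'(2)[OF z] X'(2)[OF z]])
    have "((\<lambda>z. R z u v) has_derivative (\<lambda>h. dderiv h (\<lambda>y. Y y (N z (X u z) (X v z))) z
        + Y z (dderiv h (\<lambda>y. N y (X u z) (X v z)) z + N z (- D z h (X u z)) (X v z) + N z (X u z) (- D z h (X v z))))) (at z)"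
      unfolding R_def by (rule has_derivative_linear_family[OF opB z Y(1) smooth_on_differentiable[OF Y(2) z] dQ])
    from dderiv_eq[OF this, of h] show ?thesis
      by (simp add: dderiv_eq[OF Y(3)[OF z]] linear_add[OF Y(1)[OF z]] bilinear_lneg[OF bilN[OF z]] bilinear_rneg[OF bilN[OF z]]
          linear_diff[OF Y(1)[OF z]])
  qed

  obtain U0 V s where U0: "open U0" "U0 \<subseteq> B" "z0 \<in> U0" and V: "open V" "t z0 \<in> V" and hom: "homeomorphism U0 V t s"
    and s: "smooth_on V s" "\<And>y. y \<in> V \<Longrightarrow> (s has_derivative (\<lambda>u. X u (s y))) (at y)"
    by (rule smooth_local_inverse[of B z0 t Y X, OF opB z0B t(2) Y(2) X'(1) YX XY]) (assumption | rule that)+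
  have sB: "s y \<in> B" if "y \<in> V" for y using hom that U0 unfolding homeomorphism_def by blast
  \<comment> \<open>The same components as functions of the flat coordinates. A coordinate direction
    \<open>h\<close> there corresponds to the direction \<open>X h (s y)\<close> in the
    chart.\<close>
  define S where "S y u v = R (s y) u v" for y u v
  have XS: "X (S y u v) (s y) = N (s y) (X u (s y)) (X v (s y))" if "y \<in> V" for y u v
    by (simp add: S_def R_def XY[OF sB[OF that]])
  have dS: "dderiv h (\<lambda>y. S y u v) y = dderiv (X h (s y)) (\<lambda>z. R z u v) (s y)" if y: "y \<in> V" for h u v y
    unfolding S_def
    by (rule dderiv_eq) (rule has_derivative_compose[OF s(2)[OF y] smooth_on_has_derivative[OF smR sB[OF y]]])
  have om: "std_omega P a b = g z (J z (X a z)) (X b z)" if "z \<in> B" for a b z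
    by (simp add: std_omega_def gX[OF that, symmetric] JX[OF that])
  obtain \<rho> f where \<rho>: "\<rho> > 0" "ball (t z0) \<rho> \<subseteq> V" and f: "holomorphic_several_on f (ball (t z0) \<rho>)"
    "\<And>y. y \<in> ball (t z0) \<rho> \<Longrightarrow> isotropic_support P (d3 f y)"
    "\<And>y. y \<in> ball (t z0) \<rho> \<Longrightarrow> S_endo P f y = S y"
  proof (rule special_kaehler_potential[OF V, of S P])
    fix y assume y: "y \<in> V"
    define z where "z = s y"
    have z: "z \<in> B" and zW: "z \<in> W" using sB[OF y] BW by (auto simp: z_def)
    note lin = bilinear_ladd[OF bilN[OF z]] bilinear_radd[OF bilN[OF z]] bilinear_lmul[OF bilN[OF z]] bilinear_rmul[OF bilN[OF z]]
      linear_add[OF Y(1)[OF z]] linear_scale[OF Y(1)[OF z]]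
    have Sz: "S y u v = Y z (N z (X u z) (X v z))" for u v by (simp add: S_def R_def z_def)
    show "bilinear (S y)"
      unfolding bilinear_def by (auto intro!: linearI simp: Sz Xadd[OF z] Xscale[OF z] lin)
    show "S y u v = S y v u" for u v by (simp add: Sz N_def G(3)[OF zW, of "X u z"] D(3)[OF zW, of "X u z"])
    show "std_omega P (S y u v) w = - std_omega P v (S y u w)" for u v w
      using G\<omega>[OF zW, of "X u z" "X v z" "X w z"]
      by (simp add: om[OF z] Sz XY[OF z] N_def)
    show "S y u (std_J v) - std_J (S y u v) = S y v (std_J u) - std_J (S y v u)" for u v
      using arg_cong[OF GJ[OF zW, of "X u z" "X v z"], of "Y z"]
      by (simp add: Sz JX[OF z, symmetric] YJ[OF z, symmetric] linear_diff[OF Y(1)[OF z]] N_def[symmetric])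
    show "dderiv h (\<lambda>y. S y u v) y - dderiv u (\<lambda>y. S y h v) y + S y h (S y u v) - S y u (S y h v) = 0" for h u v
    proof -
      define a b c where "a = X h z" and "b = X u z" and "c = X v z"
      have dN: "dderiv k (\<lambda>y. N y b c) z = dderiv k (\<lambda>y. G y b c) z - dderiv k (\<lambda>y. D y b c) z" for k b c
        unfolding N_def
        by (rule dderiv_eq) (intro has_derivative_diff smooth_on_has_derivative[OF G(2) zW] smooth_on_has_derivative[OF D(2) zW])
      have Sd: "dderiv h (\<lambda>y. S y u v) y = Y z (D z (X h z) (N z (X u z) (X v z)) + (dderiv (X h z) (\<lambda>y. N y (X u z) (X v z)) z
          - N z (D z (X h z) (X u z)) (X v z) - N z (X u z) (D z (X h z) (X v z))))" for h u v
        unfolding dS[OF y] z_def[symmetric] by (rule dR[OF z])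
      have SS: "S y h (S y u v) = Y z (N z (X h z) (N z (X u z) (X v z)))" for h u v
        by (simp add: Sz[of h] XS[OF y, folded z_def])
      \<comment> \<open>The curvature of \<open>D + N\<close> is the curvature of \<open>D\<close>,
        plus the antisymmetrised covariant derivative of \<open>N\<close>, plus the commutator of
        \<open>N\<close>. Symmetry of \<open>D\<close> cancels the terms in which \<open>N\<close>
        is applied to \<open>D z a b\<close>.\<close>
      have "D z a (N z b c) + (dderiv a (\<lambda>y. N y b c) z - N z (D z a b) c - N z b (D z a c))
          - (D z b (N z a c) + (dderiv b (\<lambda>y. N y a c) z - N z (D z b a) c - N z a (D z b c)))
          + N z a (N z b c) - N z b (N z a c)
        = (dderiv a (\<lambda>y. G y b c) z - dderiv b (\<lambda>y. G y a c) z + G z a (G z b c) - G z b (G z a c))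
          - (dderiv a (\<lambda>y. D y b c) z - dderiv b (\<lambda>y. D y a c) z + D z a (D z b c) - D z b (D z a c))"
        unfolding dN N_def[of z] D(3)[OF zW, of b a]
        by (simp add: bilinear_rsub[OF G(1)[OF zW]] bilinear_rsub[OF D(1)[OF zW]] algebra_simps)
      also have "\<dots> = 0" by (simp only: G(4)[OF zW] D(4)[OF zW] diff_0_right)
      finally have "Y z (D z a (N z b c) + (dderiv a (\<lambda>y. N y b c) z - N z (D z a b) c - N z b (D z a c))
          - (D z b (N z a c) + (dderiv b (\<lambda>y. N y a c) z - N z (D z b a) c - N z a (D z b c)))
          + N z a (N z b c) - N z b (N z a c)) = Y z 0" by simp
      then show ?thesis
        unfolding Sd SS a_def b_def c_def
        by (simp only: linear_add[OF Y(1)[OF z]] linear_diff[OF Y(1)[OF z]] linear_0[OF Y(1)[OF z]])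
    qed
  next
    show "smooth_on V (\<lambda>y. S y u v)" for u v
      unfolding S_def by (rule smooth_on_compose[OF V(1) opB _ s(1) smR]) (use sB in blast)
  qed (use that in blast)
  define M where "M = ball (t z0) \<rho>"
  define U where "U = s ` M"
  have MV: "M \<subseteq> V" using \<rho> by (simp add: M_def)
  have homU: "homeomorphism U M t s"
    unfolding U_def
  proof (rule homeomorphism_of_subsets[OF hom])
    show "s ` M \<subseteq> U0" using MV hom unfolding homeomorphism_def by auto
    show "t ` s ` M = M" using MV homeomorphism_apply2[OF hom] by (force simp: image_image)
  qed (rule MV)
  have Ueq: "U = U0 \<inter> t -` M"
    using hom MV unfolding U_def homeomorphism_def by (auto simp: image_iff) (metis subsetD)+
  have UB: "U \<subseteq> B" using Ueq U0 by blast
  have contt: "continuous_on U0 t" using hom by (simp add: homeomorphism_def)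
  have opU: "open U"
    unfolding Ueq using continuous_open_preimage[OF contt U0(1), of M] by (simp add: M_def)
  have dt: "dderiv v t z = Y z v" if "z \<in> U" for v z using dderiv_eq[OF t(2)] that UB by blast
  have d2t: "dderiv u (dderiv v t) z = Y z (D z u v)" if z: "z \<in> U" for u v z
  proof -
    have "dderiv u (dderiv v t) z = dderiv u (\<lambda>z. Y z v) z" by (rule dderiv_cong[OF opU z dt])
    then show ?thesis using dderiv_eq[OF Y(3)] z UB by auto
  qed
  have related: "form_related t z g (\<lambda>_. std_g P)" "endo_related t z J (\<lambda>_. std_J)" "conn_related t z G (S_endo P f)" if z: "z \<in> U" for z
  proof -
    have zB: "z \<in> B" using z UB by blast
    show "form_related t z g (\<lambda>_. std_g P)"
      unfolding form_related_def using gX[OF zB, symmetric] by (simp add: dt[OF z] XY[OF zB])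
    show "endo_related t z J (\<lambda>_. std_J)"
      unfolding endo_related_def by (simp add: dt[OF z] YJ[OF zB])
    have tz: "t z \<in> M" and stz: "s (t z) = z" using homU z by (auto simp: homeomorphism_def)
    \<comment> \<open>\<open>G\<close> is split as \<open>D + N\<close>. The \<open>D\<close> part
      is the second derivative of \<open>t\<close>, because \<open>D\<close> vanishes in the new
      coordinates, and the \<open>N\<close> part becomes \<open>S\<close>.\<close>
    show "conn_related t z G (S_endo P f)"
      unfolding conn_related_def
      by (simp add: dt[OF z] d2t[OF z] f(3)[OF tz[unfolded M_def]] S_def R_def stz XY[OF zB] N_def
          linear_add[OF Y(1)[OF zB], symmetric])
  qed
  have z0U: "z0 \<in> U" using \<rho>(1) U0(3) by (simp add: Ueq M_def)
  have UW: "U \<subseteq> W" and opM: "open M" using UB BW by (auto simp: M_def)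
  show ?thesis
    by (rule that[OF opU UW z0U opM homU smooth_on_subset[OF t(1) UB] smooth_on_subset[OF s(1) MV]
          f(1,2)[folded M_def] related])
qed

end

section \<open>Coordinate expressions of special Kaehler structures\<close>

lemma levi_civita_chart:
  assumes LC: "levi_civita \<A> g D" and pr: "pseudo_riemannian \<A> g" and c: "c \<in> \<A>" and op: "open (coord_dom c)"
    and z: "z \<in> coord_dom c"
  shows "bilinear (D c z)" "D c z u v = D c z v u"
    "dderiv h (\<lambda>y. g c y a b) z = g c z (D c z h a) b + g c z a (D c z h b)"
proof -
  show "bilinear (D c z)" using LC c z by (simp add: levi_civita_def affine_connection_def)
  have "torsion (D c) (\<lambda>_. u) (\<lambda>_. v) z = 0" using LC c z by (simp add: levi_civita_def torsionfree_def)
  then show "D c z u v = D c z v u" by (simp add: torsion_eq)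
  have "bilinear (g c y)" if "y \<in> coord_dom c" for y
    using pr c that by (simp add: pseudo_riemannian_def form_field_def)
  moreover have "(\<lambda>y. g c y u v) differentiable (at z)" for u v
    by (rule smooth_on_differentiable[OF _ z]) (use pr c in \<open>simp add: pseudo_riemannian_def form_field_def\<close>)
  moreover have "covd_form (D c) (g c) (\<lambda>_. h) (\<lambda>_. a) (\<lambda>_. b) z = 0"
    using LC c z by (simp add: levi_civita_def parallel_form_def)
  ultimately show "dderiv h (\<lambda>y. g c y a b) z = g c z (D c z h a) b + g c z a (D c z h b)"
    by (simp add: covd_form_eq[OF op z])
qed

text \<open>A trilinear-type expression symmetric in its first two and skew in its last two
  arguments vanishes: alternating the two exchanges three times each returns the original arguments
  with the opposite sign.\<close>

lemma symmetric_skew_zero: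
  fixes g :: "'e::real_vector \<Rightarrow> 'e \<Rightarrow> real"
  assumes g: "\<And>u v. g u v = g v u" "\<And>u. (\<And>v. g u v = 0) \<Longrightarrow> u = 0"
    and T: "\<And>u v. T u v = T v u" "\<And>u v w. g (T u v) w = - g v (T u w)"
  shows "T u v = 0"
proof (rule g(2))
  fix w
  have "g (T u v) w = - g (T u w) v" for u v w using T(2)[of u v w] g(1)[of v] by simp
  then show "g (T u v) w = 0" using T(1) by (metis minus_minus neg_equal_zero)
qed

text \<open>The Kaehler condition and flatness each assert the existence of some Levi-Civita
  connection. Uniqueness lets one \<open>D\<close> be flat and have J parallel at once.\<close>

lemma levi_civita_unique:
  assumes LC: "levi_civita \<A> g D" "levi_civita \<A> g D'" and pr: "pseudo_riemannian \<A> g" and c: "c \<in> \<A>"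
    and op: "open (coord_dom c)" and z: "z \<in> coord_dom c"
  shows "D c z = D' c z"
proof (intro ext)
  fix u v
  note D = levi_civita_chart[OF LC(1) pr c op z] and D' = levi_civita_chart[OF LC(2) pr c op z]
  have g: "bilinear (g c z)" "\<And>u v. g c z u v = g c z v u" "\<And>u. (\<And>v. g c z u v = 0) \<Longrightarrow> u = 0"
    using pr c z by (auto simp: pseudo_riemannian_def form_field_def)
  have "D c z u v - D' c z u v = 0"
  proof (rule symmetric_skew_zero[of "g c z" "\<lambda>u v. D c z u v - D' c z u v", OF g(2) g(3)])
    show "D c z u v - D' c z u v = D c z v u - D' c z v u" for u v using D(2) D'(2) by simp
    show "g c z (D c z u v - D' c z u v) w = - g c z v (D c z u w - D' c z u w)" for u v w
      using D(3)[of u v w] D'(3)[of u v w] by (simp add: bilinear_lsub[OF g(1)] bilinear_rsub[OF g(1)])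
  qed
  then show "D c z u v = D' c z u v" by simp
qed

lemma flat_connection_chart:
  assumes "flat_connection \<A> G" "affine_connection \<A> G" "c \<in> \<A>" "open (coord_dom c)" "z \<in> coord_dom c"
  shows "dderiv u (\<lambda>y. G c y v w) z - dderiv v (\<lambda>y. G c y u w) z + G c z u (G c z v w) - G c z v (G c z u w) = 0"
proof -
  have "curvature (G c) (\<lambda>_. u) (\<lambda>_. v) (\<lambda>_. w) z = 0" using assms by (simp add: flat_connection_def)
  then show ?thesis using assms by (simp add: curvature_eq[OF assms(4,5)] affine_connection_def)
qed

lemma flat_special_kaehler_chart:
  assumes S: "flat_special_kaehler_manifold S" and c: "c \<in> sk_atlas S"
  obtains D where "flat_special_kaehler_domain (coord_dom c) (sk_g S c) (sk_J S c) D (sk_nabla S c)"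
proof -
  let ?A = "sk_atlas S" and ?g = "sk_g S" and ?J = "sk_J S" and ?G = "sk_nabla S"
  have sk: "special_kaehler_manifold S" and k: "kaehler_manifold S"
    using S by (auto simp: flat_special_kaehler_manifold_def special_kaehler_manifold_def)
  have pr: "pseudo_riemannian ?A ?g" and cs: "complex_structure ?A ?J" and op: "open (coord_dom c)"
    using k c by (auto simp: kaehler_manifold_def smooth_manifold_def)
  obtain D' where D': "levi_civita ?A ?g D'" "parallel_endo ?A D' ?J" using k by (auto simp: kaehler_manifold_def)
  obtain D where D: "levi_civita ?A ?g D" "flat_connection ?A D"
    using S by (auto simp: flat_special_kaehler_manifold_def)
  have aD: "affine_connection ?A D" and aG: "affine_connection ?A ?G"
    using D sk by (auto simp: levi_civita_def special_kaehler_manifold_def)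
  have J: "linear (?J c z)" if "z \<in> coord_dom c" for z
    using cs c that by (simp add: complex_structure_def endo_field_def)
  have smJ: "smooth_on (coord_dom c) (\<lambda>z. ?J c z u)" for u
    using cs c by (simp add: complex_structure_def endo_field_def)
  have g: "bilinear (?g c z)" if "z \<in> coord_dom c" for z
    using pr c that by (simp add: pseudo_riemannian_def form_field_def)
  have smg: "smooth_on (coord_dom c) (\<lambda>z. ?g c z u v)" for u v
    using pr c by (simp add: pseudo_riemannian_def form_field_def)
  have gJ: "?g c z (?J c z u) (?J c z v) = ?g c z u v" if "z \<in> coord_dom c" for z u v
    using k c that by (simp add: kaehler_manifold_def)
  have DJ: "dderiv h (\<lambda>y. ?J c y a) z = ?J c z (D c z h a) - D c z h (?J c z a)" if z: "z \<in> coord_dom c" for z h a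
  proof -
    have "covd_endo (D' c) (?J c) (\<lambda>_. h) (\<lambda>_. a) z = 0" using D'(2) c z by (simp add: parallel_endo_def)
    then have "dderiv h (\<lambda>y. ?J c y a) z + D' c z h (?J c z a) - ?J c z (D' c z h a) = 0"
      by (simp add: covd_endo_eq[OF op z J smooth_on_differentiable[OF smJ z]])
    then show ?thesis by (simp add: levi_civita_unique[OF D(1) D'(1) pr c op z] algebra_simps)
  qed
  note Dc = levi_civita_chart[OF D(1) pr c op]
  show ?thesis
  proof (rule that[of "D c"], rule flat_special_kaehler_domain.intro)
    fix z assume z: "z \<in> coord_dom c"
    show "bilinear (?g c z)" "linear (?J c z)" by (rule g[OF z], rule J[OF z])
    show "?g c z u v = ?g c z v u" for u v using pr c z by (simp add: pseudo_riemannian_def)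
    show "u = 0" if "\<And>v. ?g c z u v = 0" for u using pr c z that by (simp add: pseudo_riemannian_def)
    show "?J c z (?J c z u) = - u" for u using cs c z by (simp add: complex_structure_def)
    show "?g c z (?J c z u) (?J c z v) = ?g c z u v" for u v by (rule gJ[OF z])
    show "bilinear (D c z)" "D c z u v = D c z v u" for u v by (rule Dc[OF z])+
    show "dderiv u (\<lambda>y. D c y v w) z - dderiv v (\<lambda>y. D c y u w) z + D c z u (D c z v w) - D c z v (D c z u w) = 0" for u v w
      by (rule flat_connection_chart[OF D(2) aD c op z])
    show "dderiv h (\<lambda>y. ?g c y a b) z = ?g c z (D c z h a) b + ?g c z a (D c z h b)" for h a b by (rule Dc(3)[OF z])
    show "dderiv h (\<lambda>y. ?J c y a) z = ?J c z (D c z h a) - D c z h (?J c z a)" for h a by (rule DJ[OF z])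
    show "bilinear (?G c z)" using aG c z by (simp add: affine_connection_def)
    have "torsion (?G c) (\<lambda>_. u) (\<lambda>_. v) z = 0" for u v
      using sk c z by (simp add: special_kaehler_manifold_def torsionfree_def)
    then show "?G c z u v = ?G c z v u" for u v by (simp add: torsion_eq)
    show "dderiv u (\<lambda>y. ?G c y v w) z - dderiv v (\<lambda>y. ?G c y u w) z + ?G c z u (?G c z v w) - ?G c z v (?G c z u w) = 0" for u v w
      using flat_connection_chart[OF _ aG c op z] sk by (simp add: special_kaehler_manifold_def)
    have endo: "covd_endo (?G c) (?J c) (\<lambda>_. a) (\<lambda>_. b) z
        = dderiv a (\<lambda>y. ?J c y b) z + ?G c z a (?J c z b) - ?J c z (?G c z a b)" for a b
      by (simp add: covd_endo_eq[OF op z J smooth_on_differentiable[OF smJ z]])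
    have "covd_endo (?G c) (?J c) (\<lambda>_. a) (\<lambda>_. b) z = covd_endo (?G c) (?J c) (\<lambda>_. b) (\<lambda>_. a) z" for a b
      using sk c z by (simp add: special_kaehler_manifold_def)
    then show "(?G c z a (?J c z b) - D c z a (?J c z b)) - ?J c z (?G c z a b - D c z a b)
        = (?G c z b (?J c z a) - D c z b (?J c z a)) - ?J c z (?G c z b a - D c z b a)" for a b
      unfolding endo DJ[OF z] by (simp add: linear_diff[OF J[OF z]] algebra_simps)
    show "?g c z (?J c z (?G c z h a - D c z h a)) b = - ?g c z (?J c z a) (?G c z h b - D c z h b)" for h a b
    proof -
      have bk: "bilinear (kaehler_form S c y)" if "y \<in> coord_dom c" for y
        using g[OF that] J[OF that] unfolding bilinear_def kaehler_form_def
        by (auto intro!: linearI simp: linear_add linear_scale bilinear_ladd[OF g[OF that]] bilinear_lmul[OF g[OF that]])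
      \<comment> \<open>The Kaehler form is parallel for \<open>D\<close>, as g and J are. Comparing
        with its parallelism for \<open>sk_nabla\<close> leaves skewness of the difference of the
        connections.\<close>
      have dk: "((\<lambda>y. kaehler_form S c y a b) has_derivative (\<lambda>h. ?g c z (?J c z (D c z h a)) b + ?g c z (?J c z a) (D c z h b))) (at z)" for a b
      proof -
        have "((\<lambda>y. ?g c y (?J c y a) b) has_derivative (\<lambda>h. dderiv h (\<lambda>y. ?g c y (?J c z a) b) z
            + ?g c z (dderiv h (\<lambda>y. ?J c y a) z) b + ?g c z (?J c z a) 0)) (at z)"
          by (rule has_derivative_bilinear_family[OF op z g smooth_on_differentiable[OF smg z] smooth_on_has_derivative[OF smJ z] has_derivative_const])
        then show ?thesis
          by (simp add: kaehler_form_def Dc(3)[OF z] DJ[OF z] bilinear_lsub[OF g[OF z]] bilinear_rzero[OF g[OF z]] add.commute)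
      qed
      have "covd_form (?G c) (kaehler_form S c) (\<lambda>_. h) (\<lambda>_. a) (\<lambda>_. b) z = 0"
        using sk c z by (simp add: special_kaehler_manifold_def parallel_form_def)
      moreover have "(\<lambda>y. kaehler_form S c y u v) differentiable (at z)" for u v
        using dk unfolding differentiable_def by blast
      ultimately have "dderiv h (\<lambda>y. kaehler_form S c y a b) z
          = kaehler_form S c z (?G c z h a) b + kaehler_form S c z a (?G c z h b)"
        by (simp add: covd_form_eq[OF op z bk])
      then show ?thesis unfolding dderiv_eq[OF dk]
        by (simp add: kaehler_form_def linear_diff[OF J[OF z]] bilinear_lsub[OF g[OF z]] bilinear_rsub[OF g[OF z]])
    qed
  qed (use op smg smJ aD aG c in \<open>simp_all add: affine_connection_def\<close>)
qed

section \<open>Composition of the transformation laws\<close>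

context
  fixes \<phi> :: "'e::euclidean_space \<Rightarrow> 'f::euclidean_space" and t :: "'f \<Rightarrow> 'g::euclidean_space" and t' W U
  assumes op: "open W" "open U" and sm: "smooth_on W \<phi>" "smooth_on U t" and im: "\<phi> ` W \<subseteq> U"
    and eq: "\<And>z. z \<in> W \<Longrightarrow> t' z = t (\<phi> z)"
begin

lemma dderiv_compose: "z \<in> W \<Longrightarrow> dderiv v t' z = dderiv (dderiv v \<phi> z) t (\<phi> z)"
proof -
  assume z: "z \<in> W"
  have "((\<lambda>z. t (\<phi> z)) has_derivative (\<lambda>v. dderiv (dderiv v \<phi> z) t (\<phi> z))) (at z)"
    by (rule has_derivative_compose[OF smooth_on_has_derivative[OF sm(1) z] smooth_on_has_derivative[OF sm(2)]])
      (use im z in blast)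
  from dderiv_eq[OF this] show ?thesis using dderiv_cong[OF op(1) z eq] by simp
qed

text \<open>The second summand, through the second derivative of \<open>\<phi>\<close>, is the
  inhomogeneous term that makes \<open>conn_related\<close> compatible with composition. The map
  \<open>t'\<close> is tied to the composite on \<open>W\<close> only, as coordinate maps have
  irrelevant values elsewhere.\<close>

lemma dderiv2_compose:
  assumes z: "z \<in> W"
  shows "dderiv u (dderiv v t') z = dderiv (dderiv u \<phi> z) (dderiv (dderiv v \<phi> z) t) (\<phi> z)
    + dderiv (dderiv u (dderiv v \<phi>) z) t (\<phi> z)"
proof -
  have \<phi>U: "\<phi> y \<in> U" if "y \<in> W" for y using im that by blast
  have dA: "((\<lambda>y. dderiv w t (\<phi> y)) has_derivative (\<lambda>u. dderiv (dderiv u \<phi> z) (dderiv w t) (\<phi> z))) (at z)" for w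
    by (rule has_derivative_compose[OF smooth_on_has_derivative[OF sm(1) z] smooth_on_has_derivative[OF smooth_on_dderiv[OF sm(2)] \<phi>U[OF z]]])
  have "((\<lambda>y. dderiv (dderiv v \<phi> y) t (\<phi> y)) has_derivative
      (\<lambda>u. dderiv u (\<lambda>y. dderiv (dderiv v \<phi> z) t (\<phi> y)) z + dderiv (dderiv u (dderiv v \<phi>) z) t (\<phi> z))) (at z)"
  proof (rule has_derivative_linear_family[OF op(1) z, of "\<lambda>y w. dderiv w t (\<phi> y)"])
    show "linear (\<lambda>w. dderiv w t (\<phi> y))" if "y \<in> W" for y
      using has_derivative_linear[OF smooth_on_has_derivative[OF sm(2) \<phi>U[OF that]]] .
    show "(\<lambda>y. dderiv w t (\<phi> y)) differentiable at z" for w using dA unfolding differentiable_def by blast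
  qed (rule smooth_on_has_derivative[OF smooth_on_dderiv[OF sm(1)] z])
  note d = dderiv_eq[OF this, of u]
  have "dderiv u (dderiv v t') z = dderiv u (\<lambda>y. dderiv (dderiv v \<phi> y) t (\<phi> y)) z"
    by (rule dderiv_cong[OF op(1) z dderiv_compose])
  then show ?thesis by (simp only: d dderiv_eq[OF dA])
qed

lemma related_compose:
  assumes z: "z \<in> W"
  shows "form_related \<phi> z b b' \<Longrightarrow> form_related t (\<phi> z) b' b'' \<Longrightarrow> form_related t' z b b''"
    "endo_related \<phi> z A A' \<Longrightarrow> endo_related t (\<phi> z) A' A'' \<Longrightarrow> endo_related t' z A A''"
    "conn_related \<phi> z G G' \<Longrightarrow> conn_related t (\<phi> z) G' G'' \<Longrightarrow> conn_related t' z G G''"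
proof -
  have add: "dderiv (a + b) t (\<phi> z) = dderiv a t (\<phi> z) + dderiv b t (\<phi> z)" for a b
    using linear_add[OF has_derivative_linear[OF smooth_on_has_derivative[OF sm(2)]]] im z by blast
  show "form_related \<phi> z b b' \<Longrightarrow> form_related t (\<phi> z) b' b'' \<Longrightarrow> form_related t' z b b''"
    by (simp add: form_related_def dderiv_compose[OF z] eq[OF z])
  show "endo_related \<phi> z A A' \<Longrightarrow> endo_related t (\<phi> z) A' A'' \<Longrightarrow> endo_related t' z A A''"
    by (simp add: endo_related_def dderiv_compose[OF z] eq[OF z])
  show "conn_related \<phi> z G G' \<Longrightarrow> conn_related t (\<phi> z) G' G'' \<Longrightarrow> conn_related t' z G G''"
    by (simp add: conn_related_def dderiv_compose[OF z] dderiv2_compose[OF z] eq[OF z] add)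
qed

end

section \<open>The local isomorphism\<close>

context
  fixes T :: "'a topology" and \<A> :: "('a, 'e::euclidean_space) chart set"
  assumes mfd: "smooth_manifold T \<A>"
begin

lemma chart_homeo:
  assumes c: "c \<in> \<A>"
  shows "homeomorphic_map (subtopology T (fst c)) (top_of_set (coord_dom c)) (snd c)"
    "openin T (fst c)" "open (coord_dom c)" "inj_on (snd c) (fst c)"
proof -
  show h: "homeomorphic_map (subtopology T (fst c)) (top_of_set (coord_dom c)) (snd c)"
    and o: "openin T (fst c)" and "open (coord_dom c)" using mfd c by (auto simp: smooth_manifold_def)
  show "inj_on (snd c) (fst c)"
    using homeomorphic_imp_injective_map[OF h] openin_subset[OF o] by (simp add: Int_absorb1)
qed

lemma chart_image_open:
  assumes c: "c \<in> \<A>" and V: "openin T V" "V \<subseteq> fst c"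
  shows "open (snd c ` V)"
proof -
  have "openin (subtopology T (fst c)) V" using V by (simp add: openin_subtopology) (metis inf.absorb1)
  then have "openin (top_of_set (coord_dom c)) (snd c ` V)"
    using homeomorphic_imp_open_map[OF chart_homeo(1)[OF c]] by (simp add: open_map_def)
  then show ?thesis using chart_homeo(3)[OF c] openin_open_eq by blast
qed

lemma coord_inv_apply: "c \<in> \<A> \<Longrightarrow> x \<in> fst c \<Longrightarrow> coord_inv c (snd c x) = x"
  unfolding coord_inv_def using chart_homeo(4) by (rule inv_into_f_f)

lemma transition_apply: "c \<in> \<A> \<Longrightarrow> x \<in> fst c \<Longrightarrow> transition c d (snd c x) = snd d x"
  by (simp add: transition_def coord_inv_apply)

lemma transition_smooth:
  "c \<in> \<A> \<Longrightarrow> d \<in> \<A> \<Longrightarrow> smooth_on (overlap c d) (transition c d)"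
  using mfd by (simp add: smooth_manifold_def)

end

lemma homeomorphism_imp_homeomorphic_map:
  assumes "homeomorphism S T f g"
  shows "homeomorphic_map (top_of_set S) (top_of_set T) f"
proof -
  have "homeomorphic_maps (top_of_set S) (top_of_set T) f g"
    using assms unfolding homeomorphic_maps_def homeomorphism_def by auto
  then show ?thesis using homeomorphic_maps_map by blast
qed

text \<open>The normal form is found in one chart \<open>c\<close> around \<open>x\<close>, while an
  isomorphism has to be checked in every chart of the atlas. The changes of charts transport
  smoothness and the transformation laws from \<open>c\<close>.\<close>

lemma flat_special_kaehler_local_isomorphism:
  fixes S :: "('a, 'e::euclidean_space) sk_data"
  assumes S: "flat_special_kaehler_manifold S" and dim: "DIM('e) = 2 * CARD('n)" and x: "x \<in> topspace (sk_top S)"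
  obtains P :: "'n::finite set" and M f U F where "open M" "holomorphic_several_on f M"
    "\<And>z. z \<in> M \<Longrightarrow> isotropic_support P (d3 f z)" "x \<in> U" "sk_isomorphism S U (M_f P M f) M F"
proof -
  have sk: "special_kaehler_manifold S" and k: "kaehler_manifold S"
    using S by (auto simp: flat_special_kaehler_manifold_def special_kaehler_manifold_def)
  have mfd: "smooth_manifold (sk_top S) (sk_atlas S)" using k by (simp add: kaehler_manifold_def)
  have "x \<in> (\<Union>c\<in>sk_atlas S. fst c)" using mfd x unfolding smooth_manifold_def by simp
  then obtain c where c: "c \<in> sk_atlas S" "x \<in> fst c" by blast
  obtain D where "flat_special_kaehler_domain (coord_dom c) (sk_g S c) (sk_J S c) D (sk_nabla S c)"
    by (rule flat_special_kaehler_chart[OF S c(1)])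
  then interpret flat_special_kaehler_domain "coord_dom c" "sk_g S c" "sk_J S c" D "sk_nabla S c" .
  have "snd c x \<in> coord_dom c" using c by (simp add: coord_dom_def)
  then obtain P :: "'n set" and M f U t s where U: "open U" "U \<subseteq> coord_dom c" "snd c x \<in> U" and M: "open M"
    and hom: "homeomorphism U M t s" and sm: "smooth_on U t" "smooth_on M s"
    and f: "holomorphic_several_on f M" "\<And>y. y \<in> M \<Longrightarrow> isotropic_support P (d3 f y)"
    and rel: "\<And>z. z \<in> U \<Longrightarrow> form_related t z (sk_g S c) (\<lambda>_. std_g P)"
      "\<And>z. z \<in> U \<Longrightarrow> endo_related t z (sk_J S c) (\<lambda>_. std_J)"
      "\<And>z. z \<in> U \<Longrightarrow> conn_related t z (sk_nabla S c) (S_endo P f)"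
    by (rule local_normal_form[OF _ dim]) (assumption | rule that)+
  note homeo = chart_homeo[OF mfd]
  define U' where "U' = {y \<in> fst c. snd c y \<in> U}"
  define F where "F = t \<circ> snd c"
  have fstT: "fst d \<subseteq> topspace (sk_top S)" if "d \<in> sk_atlas S" for d using openin_subset[OF homeo(2)[OF that]] .
  have opU': "openin (sk_top S) U'"
  proof -
    have "openin (top_of_set (coord_dom c)) U" using U(1,2) by (simp add: openin_open_eq[OF homeo(3)[OF c(1)]])
    then have "openin (subtopology (sk_top S) (fst c)) {y \<in> topspace (subtopology (sk_top S) (fst c)). snd c y \<in> U}"
      using homeomorphic_imp_continuous_map[OF homeo(1)[OF c(1)]] openin_continuous_map_preimage by blast
    moreover have "{y \<in> topspace (subtopology (sk_top S) (fst c)). snd c y \<in> U} = U'"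
      using fstT[OF c(1)] by (auto simp: U'_def)
    ultimately show ?thesis using openin_trans_full homeo(2)[OF c(1)] by metis
  qed
  have imU': "snd c ` U' = U" using U(2) by (auto simp: U'_def coord_dom_def)
  have U'c: "U' \<subseteq> fst c" by (auto simp: U'_def)
  have homF: "homeomorphic_map (subtopology (sk_top S) U') (top_of_set M) F"
  proof -
    have "homeomorphic_map (subtopology (subtopology (sk_top S) (fst c)) U') (subtopology (top_of_set (coord_dom c)) U) (snd c)"
      by (rule homeomorphic_map_subtopologies[OF homeo(1)[OF c(1)]])
        (use imU' U(2) U'c fstT[OF c(1)] in \<open>auto simp: Int_absorb1\<close>)
    moreover have "fst c \<inter> U' = U'" "coord_dom c \<inter> U = U" using U'c U(2) by auto
    ultimately have "homeomorphic_map (subtopology (sk_top S) U') (top_of_set U) (snd c)"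
      by (simp add: subtopology_subtopology)
    then show ?thesis unfolding F_def
      using homeomorphic_map_compose homeomorphism_imp_homeomorphic_map[OF hom] by blast
  qed
  have injF: "inj_on F U'"
    using homeomorphic_imp_injective_map[OF homF] openin_subset[OF opU'] by (simp add: Int_absorb1)
  have FM: "F y \<in> M" if "y \<in> U'" for y using that hom by (auto simp: F_def U'_def homeomorphism_def)
  have sF: "s (F y) = snd c y" if "y \<in> U'" for y using that hom by (auto simp: F_def U'_def homeomorphism_def)
  have "sk_isomorphism S U' (M_f P M f) M F"
    unfolding sk_isomorphism_def
  proof (intro conjI ballI)
    show "openin (sk_top S) U'" by (rule opU')
    show "openin (sk_top (M_f P M f)) M" by (simp add: M_f_def)
    show "homeomorphic_map (subtopology (sk_top S) U') (subtopology (sk_top (M_f P M f)) M) F"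
      using homF by (simp add: M_f_def subtopology_subtopology)
    fix c' d assume c': "c' \<in> sk_atlas S" and "d \<in> sk_atlas (M_f P M f)"
    then have d: "d = (M, \<lambda>z. z)" by (simp add: M_f_def)
    define V where "V = U' \<inter> fst c'"
    have V: "{x \<in> U' \<inter> fst c'. F x \<in> fst d} = V" using FM by (auto simp: V_def d)
    have opV: "openin (sk_top S) V" unfolding V_def using opU' homeo(2)[OF c'] by (rule openin_Int)
    have opc'V: "open (snd c' ` V)" "open (snd c ` V)"
      using chart_image_open[OF mfd c' opV] chart_image_open[OF mfd c(1) opV] U'c by (auto simp: V_def)
    have ov: "snd c' ` V \<subseteq> overlap c' c" "snd c ` V \<subseteq> overlap c c'" using U'c by (auto simp: V_def overlap_def)
    let ?\<phi> = "transition c' c" and ?t = "snd d \<circ> F \<circ> coord_inv c'"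
    have \<phi>: "?\<phi> (snd c' y) = snd c y" "coord_inv c' (snd c' y) = y" if "y \<in> V" for y
      using that transition_apply[OF mfd c'] coord_inv_apply[OF mfd c'] by (auto simp: V_def)
    have \<phi>im: "?\<phi> ` (snd c' ` V) \<subseteq> U" using \<phi>(1) imU' by (auto simp: V_def)
    have \<phi>sm: "smooth_on (snd c' ` V) ?\<phi>" by (rule smooth_on_subset[OF transition_smooth[OF mfd c' c(1)] ov(1)])
    have teq: "?t z = t (?\<phi> z)" if "z \<in> snd c' ` V" for z using that \<phi> by (auto simp: F_def d)
    have tsm: "smooth_on (snd c' ` V) ?t"
      by (rule smooth_on_cong[OF smooth_on_compose[OF opc'V(1) U(1) \<phi>im \<phi>sm sm(1)] opc'V(1)]) (simp only: teq)
    \<comment> \<open>Written as a preimage under the continuous map \<open>s\<close>, the image of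
      the overlap is seen to be open, as smoothness of the inverse requires.\<close>
    have FV: "F ` V = M \<inter> s -` (snd c ` V)"
    proof (intro equalityI subsetI)
      fix y assume y: "y \<in> M \<inter> s -` (snd c ` V)"
      then obtain v where v: "v \<in> V" "s y = snd c v" by auto
      then have "F v = y" using homeomorphism_apply2[OF hom, of y] y by (simp add: F_def)
      then show "y \<in> F ` V" using v(1) by blast
    qed (use FM sF in \<open>auto simp: V_def\<close>)
    have opFV: "open (F ` V)"
      unfolding FV using hom by (intro continuous_open_preimage M opc'V(2)) (simp add: homeomorphism_def)
    have ism: "smooth_on (F ` V) (snd c' \<circ> inv_into U' F \<circ> coord_inv d)"
    proof (rule smooth_on_cong[OF _ opFV])
      show "smooth_on (F ` V) (\<lambda>y. transition c c' (s y))"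
      proof (rule smooth_on_compose[where f = s and g = "transition c c'", OF opFV opc'V(2)])
        show "s ` F ` V \<subseteq> snd c ` V" unfolding FV by blast
        show "smooth_on (F ` V) s" by (rule smooth_on_subset[OF sm(2)]) (use FV in blast)
        show "smooth_on (snd c ` V) (transition c c')" by (rule smooth_on_subset[OF transition_smooth[OF mfd c(1) c'] ov(2)])
      qed
      fix y assume "y \<in> F ` V"
      then obtain v where v: "v \<in> V" "y = F v" by blast
      have vU: "v \<in> U'" "v \<in> fst c" using v(1) U'c by (auto simp: V_def)
      show "transition c c' (s y) = (snd c' \<circ> inv_into U' F \<circ> coord_inv d) y"
        using v(2) sF[OF vU(1)] transition_apply[OF mfd c(1) vU(2)] coord_inv_id[OF FM[OF vU(1)]] inv_into_f_f[OF injF vU(1)]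
        by (simp add: d)
    qed
    have related: "form_related ?t z (sk_g S c') (sk_g (M_f P M f) d)"
        "endo_related ?t z (sk_J S c') (sk_J (M_f P M f) d)"
        "conn_related ?t z (sk_nabla S c') (sk_nabla (M_f P M f) d)" if z: "z \<in> snd c' ` V" for z
    proof -
      have zo: "z \<in> overlap c' c" and \<phi>U: "?\<phi> z \<in> U" using z ov \<phi>im by auto
      have "form_related ?\<phi> z (sk_g S c') (sk_g S c)" "endo_related ?\<phi> z (sk_J S c') (sk_J S c)"
        "conn_related ?\<phi> z (sk_nabla S c') (sk_nabla S c)"
        using k sk c(1) c' zo
        by (auto simp: kaehler_manifold_def pseudo_riemannian_def form_field_def complex_structure_def endo_field_def
            special_kaehler_manifold_def affine_connection_def)
      note r = this
      show "form_related ?t z (sk_g S c') (sk_g (M_f P M f) d)"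
        using related_compose(1)[OF opc'V(1) U(1) \<phi>sm sm(1) \<phi>im teq z r(1) rel(1)[OF \<phi>U]] by (simp add: M_f_def o_def)
      show "endo_related ?t z (sk_J S c') (sk_J (M_f P M f) d)"
        using related_compose(2)[OF opc'V(1) U(1) \<phi>sm sm(1) \<phi>im teq z r(2) rel(2)[OF \<phi>U]] by (simp add: M_f_def o_def)
      show "conn_related ?t z (sk_nabla S c') (sk_nabla (M_f P M f) d)"
        using related_compose(3)[OF opc'V(1) U(1) \<phi>sm sm(1) \<phi>im teq z r(3) rel(3)[OF \<phi>U]] by (simp add: M_f_def o_def)
    qed
    have "snd d ` F ` V = F ` V" by (simp add: d)
    then show "let W = {x \<in> U' \<inter> fst c'. F x \<in> fst d}; t = snd d \<circ> F \<circ> coord_inv c'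
        in smooth_on (snd c' ` W) t \<and> smooth_on (snd d ` F ` W) (snd c' \<circ> inv_into U' F \<circ> coord_inv d) \<and>
           (\<forall>z\<in>snd c' ` W. form_related t z (sk_g S c') (sk_g (M_f P M f) d) \<and>
              endo_related t z (sk_J S c') (sk_J (M_f P M f) d) \<and>
              conn_related t z (sk_nabla S c') (sk_nabla (M_f P M f) d))"
      unfolding Let_def V using tsm ism related by simp
  qed
  moreover have "x \<in> U'" using c(2) U(3) by (simp add: U'_def)
  ultimately show ?thesis using that M f by blast
qed

theorem theorem4:
  shows "(\<forall>(p::nat) q (P :: 'n::finite set) (M :: (complex ^ 'n) set) f.
            p + q = CARD('n) \<and> card P = p \<and> open M \<and> holomorphic_several_on f M \<and>
            (\<forall>z\<in>M. isotropic_support P (d3 f z))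
            \<longrightarrow> flat_special_kaehler_manifold (M_f P M f))
       \<and> (\<forall>S :: ('a, 'e::euclidean_space) sk_data.
            flat_special_kaehler_manifold S \<and> DIM('e) = 2 * CARD('n)
            \<longrightarrow> (\<forall>x\<in>topspace (sk_top S).
                  \<exists>(p::nat) q (P :: 'n set) (M :: (complex ^ 'n) set) f U F.
                    p + q = CARD('n) \<and> card P = p \<and> open M \<and> holomorphic_several_on f M \<and>
                    (\<forall>z\<in>M. isotropic_support P (d3 f z)) \<and>
                    x \<in> U \<and> sk_isomorphism S U (M_f P M f) M F))"
proof (intro conjI allI impI ballI)
  fix p q :: nat and P :: "'n set" and M :: "(complex ^ 'n) set" and f
  assume "p + q = CARD('n) \<and> card P = p \<and> open M \<and> holomorphic_several_on f M \<and>
            (\<forall>z\<in>M. isotropic_support P (d3 f z))"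
  then show "flat_special_kaehler_manifold (M_f P M f)" using flat_special_kaehler_M_f by blast
next
  fix S :: "('a, 'e) sk_data" and x
  assume S: "flat_special_kaehler_manifold S \<and> DIM('e) = 2 * CARD('n)" and x: "x \<in> topspace (sk_top S)"
  obtain P :: "'n set" and M f U F where *: "open M" "holomorphic_several_on f M"
    "\<And>z. z \<in> M \<Longrightarrow> isotropic_support P (d3 f z)" "x \<in> U" "sk_isomorphism S U (M_f P M f) M F"
    using flat_special_kaehler_local_isomorphism[OF conjunct1[OF S] conjunct2[OF S] x] by metis
  have "card P + card (- P) = CARD('n)"
    by (simp add: Compl_eq_Diff_UNIV card_Diff_subset card_mono)
  with * show "\<exists>(p::nat) q (P :: 'n set) (M :: (complex ^ 'n) set) f U F.
      p + q = CARD('n) \<and> card P = p \<and> open M \<and> holomorphic_several_on f M \<and>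
      (\<forall>z\<in>M. isotropic_support P (d3 f z)) \<and> x \<in> U \<and> sk_isomorphism S U (M_f P M f) M F"
    by blast
qed

end
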